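(* Let $p$ be an odd prime, $k$ an algebraically closed field of characteristic $p$, and $G=SL_2$ over $k$. Suppose $m_1,m_2$ are non-negative integers and $m_2<p^r$ for some integer $r\ge 1$. Then for all integers $0\le n\le 2p-3$, $$\dim\mathrm{Ext}^n_G(V(m_2),V(m_1))\le F(n+1)+(r-1)F(n).$$
   Context: Dominant weights of $SL_2$ are identified with $\mathbb N=\{0,1,2,\dots\}$. $V(m)=\mathrm{ind}_B^G(m)^*$ is the Weyl module of highest weight $m$, where $B$ is a Borel subgroup (corresponding to the negative root). $\mathrm{Ext}_G$ is taken in the category of rational $G$-modules. Fibonacci numbers: $F(0)=0$, $F(1)=F(2)=1$ and $F(n)=F(n-1)+F(n-2)$ for $n\ge 2$. *)

theory Defs
  imports
    "HOL-Analysis.Determinants"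
    "HOL-Computational_Algebra.Polynomial"
    "HOL-Library.Extended_Nat"
    "HOL-Library.Function_Algebras"
    "HOL-Number_Theory.Fib"
begin

section \<open>The algebraic group \<open>SL\<^sub>2\<close>\<close>

text \<open>
  Over an algebraically closed field the (reduced) group scheme \<open>SL\<^sub>2\<close> is determined by its
  group of points together with its coordinate ring, and it is represented here in this way.
\<close>

definition SL2 :: "('k::field ^ 2 ^ 2) set" where
  "SL2 = {g. det g = 1}"

text \<open>The Borel subgroup of the negative root: lower triangular matrices.\<close>

definition borel2 :: "('k::field ^ 2 ^ 2) set" where
  "borel2 = {b \<in> SL2. b $ 1 $ 2 = 0}"

inductive_set poly_funs :: "('k::field ^ 2 ^ 2 \<Rightarrow> 'k) set" where
  const: "(\<lambda>_. c) \<in> poly_funs"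
| entry: "(\<lambda>g. g $ i $ j) \<in> poly_funs"
| add: "f \<in> poly_funs \<Longrightarrow> h \<in> poly_funs \<Longrightarrow> (\<lambda>g. f g + h g) \<in> poly_funs"
| mult: "f \<in> poly_funs \<Longrightarrow> h \<in> poly_funs \<Longrightarrow> (\<lambda>g. f g * h g) \<in> poly_funs"

text \<open>
  \<open>k[SL\<^sub>2]\<close>: restrictions of polynomial functions, extended by zero off \<open>SL\<^sub>2\<close> so that equality of
  HOL functions is equality on \<open>SL\<^sub>2\<close>.
\<close>

definition coord_ring :: "('k::field ^ 2 ^ 2 \<Rightarrow> 'k) set" where
  "coord_ring = {f. (\<exists>q\<in>poly_funs. \<forall>g\<in>SL2. f g = q g) \<and> (\<forall>g. g \<notin> SL2 \<longrightarrow> f g = 0)}"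


section \<open>Rational modules\<close>

text \<open>
  The vector space \<open>gspace M\<close> is a subspace of an ambient vector space whose underlying set is
  the whole type \<open>'v\<close>; every vector space has this form up to isomorphism.  The action is only
  relevant for group elements in \<open>SL2\<close> and vectors in \<open>gspace M\<close>.
\<close>

record ('k, 'v) gmod =
  gscale :: "'k \<Rightarrow> 'v \<Rightarrow> 'v"
  gspace :: "'v set"
  gact :: "'k ^ 2 ^ 2 \<Rightarrow> 'v \<Rightarrow> 'v"

definition linear_on ::
  "'v set \<Rightarrow> ('k \<Rightarrow> 'v \<Rightarrow> 'v) \<Rightarrow> ('k \<Rightarrow> 'w \<Rightarrow> 'w) \<Rightarrow> ('v::plus \<Rightarrow> 'w::plus) \<Rightarrow> bool" where
  "linear_on V s t f \<longleftrightarrow>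
     (\<forall>x\<in>V. \<forall>y\<in>V. f (x + y) = f x + f y) \<and> (\<forall>c. \<forall>x\<in>V. f (s c x) = t c (f x))"

text \<open>
  The last condition provides the comodule map \<open>v \<mapsto> \<Sum> w\<^sub>i \<otimes> f\<^sub>i\<close>; it says at once that the action
  is locally finite and that its matrix coefficients are regular functions.
\<close>

definition rational_module :: "('k::field, 'v::ab_group_add) gmod \<Rightarrow> bool" where
  "rational_module M \<longleftrightarrow>
     vector_space (gscale M) \<and>
     module.subspace (gscale M) (gspace M) \<and>
     (\<forall>g\<in>SL2. gact M g ` gspace M \<subseteq> gspace M \<and>
               linear_on (gspace M) (gscale M) (gscale M) (gact M g)) \<and>
     (\<forall>v\<in>gspace M. gact M (mat 1) v = v) \<and>
     (\<forall>g\<in>SL2. \<forall>h\<in>SL2. \<forall>v\<in>gspace M. gact M (g ** h) v = gact M g (gact M h v)) \<and>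
     (\<forall>v\<in>gspace M. \<exists>(N::nat) w f.
        (\<forall>i<N. w i \<in> gspace M \<and> f i \<in> coord_ring) \<and>
        (\<forall>g\<in>SL2. gact M g v = (\<Sum>i<N. gscale M (f i g) (w i))))"

definition submodule_of :: "'v set \<Rightarrow> ('k::field, 'v::ab_group_add) gmod \<Rightarrow> bool" where
  "submodule_of A M \<longleftrightarrow>
     A \<subseteq> gspace M \<and> module.subspace (gscale M) A \<and> (\<forall>g\<in>SL2. gact M g ` A \<subseteq> A)"

text \<open>
  \<open>Hom\<^sub>G(M, N)\<close>; homomorphisms vanish outside \<open>gspace M\<close> so that equality of HOL functions is
  equality of homomorphisms.
\<close>

definition G_hom ::
  "('k::field, 'v::ab_group_add) gmod \<Rightarrow> ('k, 'w::ab_group_add) gmod \<Rightarrow> ('v \<Rightarrow> 'w) set" where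
  "G_hom M N = {f.
     f ` gspace M \<subseteq> gspace N \<and>
     linear_on (gspace M) (gscale M) (gscale N) f \<and>
     (\<forall>g\<in>SL2. \<forall>v\<in>gspace M. f (gact M g v) = gact N g (f v)) \<and>
     (\<forall>v. v \<notin> gspace M \<longrightarrow> f v = 0)}"


section \<open>Weyl modules\<close>

definition fun_scale :: "'k::times \<Rightarrow> ('x \<Rightarrow> 'k) \<Rightarrow> 'x \<Rightarrow> 'k" where
  "fun_scale c f = (\<lambda>x. c * f x)"

text \<open>
  \<open>ind\<^sub>B\<^sup>G(m) = {f \<in> k[G]. f(gb) = m(b)\<^sup>-\<^sup>1 f(g)}\<close> with the left regular action; the weight \<open>m\<close> is
  the character of \<open>B\<close> sending \<open>b\<close> to the \<open>m\<close>-th power of its upper left entry.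
\<close>

definition ind_B :: "nat \<Rightarrow> ('k::field, 'k ^ 2 ^ 2 \<Rightarrow> 'k) gmod" where
  "ind_B m =
     \<lparr>gscale = fun_scale,
      gspace = {f \<in> coord_ring. \<forall>g\<in>SL2. \<forall>b\<in>borel2. f (g ** b) = inverse ((b $ 1 $ 1) ^ m) * f g},
      gact = (\<lambda>g f x. f (matrix_inv g ** x))\<rparr>"

text \<open>The contragredient module; functionals are extended by zero off \<open>gspace M\<close>.\<close>

definition dual_module :: "('k::field, 'v::ab_group_add) gmod \<Rightarrow> ('k, 'v \<Rightarrow> 'k) gmod" where
  "dual_module M =
     \<lparr>gscale = fun_scale,
      gspace = {\<phi>. linear_on (gspace M) (gscale M) (*) \<phi> \<and> (\<forall>v. v \<notin> gspace M \<longrightarrow> \<phi> v = 0)},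
      gact = (\<lambda>g \<phi> v. if v \<in> gspace M then \<phi> (gact M (matrix_inv g) v) else 0)\<rparr>"

definition weyl :: "nat \<Rightarrow> ('k::field, ('k ^ 2 ^ 2 \<Rightarrow> 'k) \<Rightarrow> 'k) gmod" where
  "weyl m = dual_module (ind_B m)"


section \<open>Injective resolutions and Ext\<close>

text \<open>
  A definition cannot quantify over all types, so the extension property is tested on the rational
  modules \<open>M\<close> over the ambient type \<open>'v \<times> (nat \<Rightarrow> 'k)\<close>.  Up to isomorphism these include all
  rational modules over the ambient type \<open>'v\<close> of \<open>I\<close> itself and all those of countable dimension.
  As rational modules are locally finite, the extension property for finite-dimensional \<open>M\<close>
  already implies it for every \<open>M\<close> (Zorn's lemma), so this is injectivity in the category of all
  rational modules.
\<close>

definition injective_module :: "('k::field, 'v::ab_group_add) gmod \<Rightarrow> bool" where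
  "injective_module I \<longleftrightarrow>
     rational_module I \<and>
     (\<forall>(M :: ('k, 'v \<times> (nat \<Rightarrow> 'k)) gmod) A. rational_module M \<longrightarrow> submodule_of A M \<longrightarrow>
        (\<forall>f \<in> G_hom (M\<lparr>gspace := A\<rparr>) I. \<exists>h \<in> G_hom M I. \<forall>a\<in>A. h a = f a))"

text \<open>An exact sequence \<open>0 \<rightarrow> N \<rightarrow> I 0 \<rightarrow> I 1 \<rightarrow> \<dots>\<close> with augmentation \<open>\<epsilon>\<close> and differentials \<open>d n\<close>.\<close>

definition injective_resolution ::
  "('k::field, 'w::ab_group_add) gmod \<Rightarrow> ('w \<Rightarrow> 'v) \<Rightarrow> (nat \<Rightarrow> ('k, 'v::ab_group_add) gmod) \<Rightarrow>
     (nat \<Rightarrow> 'v \<Rightarrow> 'v) \<Rightarrow> bool" where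
  "injective_resolution N \<epsilon> I d \<longleftrightarrow>
     (\<forall>n. injective_module (I n)) \<and>
     \<epsilon> \<in> G_hom N (I 0) \<and> (\<forall>n. d n \<in> G_hom (I n) (I (Suc n))) \<and>
     inj_on \<epsilon> (gspace N) \<and>
     \<epsilon> ` gspace N = {x \<in> gspace (I 0). d 0 x = 0} \<and>
     (\<forall>n. d n ` gspace (I n) = {x \<in> gspace (I (Suc n)). d (Suc n) x = 0})"

text \<open>Dimension of \<open>Z / B\<close> for subspaces \<open>B \<subseteq> Z\<close>: the size of a basis, \<open>\<infinity>\<close> if there is no finite one.\<close>

definition basis_mod :: "('k::field \<Rightarrow> 'a::ab_group_add \<Rightarrow> 'a) \<Rightarrow> 'a set \<Rightarrow> 'a set \<Rightarrow> 'a set \<Rightarrow> bool" where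
  "basis_mod s Z B S \<longleftrightarrow>
     S \<subseteq> Z \<and> Z \<subseteq> module.span s (S \<union> B) \<and> (\<forall>x\<in>S. x \<notin> module.span s ((S - {x}) \<union> B))"

definition quotient_dim :: "('k::field \<Rightarrow> 'a::ab_group_add \<Rightarrow> 'a) \<Rightarrow> 'a set \<Rightarrow> 'a set \<Rightarrow> enat" where
  "quotient_dim s Z B = (INF S \<in> {S. finite S \<and> basis_mod s Z B S}. enat (card S))"

definition cocycles ::
  "('k::field, 'w::ab_group_add) gmod \<Rightarrow> (nat \<Rightarrow> ('k, 'v::ab_group_add) gmod) \<Rightarrow> (nat \<Rightarrow> 'v \<Rightarrow> 'v) \<Rightarrow>
     nat \<Rightarrow> ('w \<Rightarrow> 'v) set" where
  "cocycles M I d n = {\<phi> \<in> G_hom M (I n). d n \<circ> \<phi> = (\<lambda>_. 0)}"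

definition coboundaries ::
  "('k::field, 'w::ab_group_add) gmod \<Rightarrow> (nat \<Rightarrow> ('k, 'v::ab_group_add) gmod) \<Rightarrow> (nat \<Rightarrow> 'v \<Rightarrow> 'v) \<Rightarrow>
     nat \<Rightarrow> ('w \<Rightarrow> 'v) set" where
  "coboundaries M I d n =
     (case n of 0 \<Rightarrow> {\<lambda>_. 0} | Suc j \<Rightarrow> (\<lambda>\<psi>. d j \<circ> \<psi>) ` G_hom M (I j))"

text \<open>
  \<open>dim Ext\<^sup>n\<^sub>G(M, N) = dim H\<^sup>n(Hom\<^sub>G(M, I))\<close>, computed from an injective resolution \<open>(I, d)\<close> of \<open>N\<close>.
\<close>

definition Ext_dim ::
  "('k::field, 'w::ab_group_add) gmod \<Rightarrow> (nat \<Rightarrow> ('k, 'v::ab_group_add) gmod) \<Rightarrow> (nat \<Rightarrow> 'v \<Rightarrow> 'v) \<Rightarrow>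
     nat \<Rightarrow> enat" where
  "Ext_dim M I d n =
     quotient_dim (\<lambda>c \<phi> x. gscale (I n) c (\<phi> x)) (cocycles M I d n) (coboundaries M I d n)"

end

theory Submission
  imports Defs "HOL-Computational_Algebra.Primes" "HOL-Library.Multiset"
begin

text \<open>
  A homomorphism \<open>V(m) \<rightarrow> M\<close> is a vector of weight \<open>m\<close> in \<open>M\<close> killed by the divided powers \<open>E t\<close>,
  \<open>t \<ge> 1\<close>, of the positive root vector.  The algebra of divided powers is the tensor product of the
  truncated polynomial algebras \<open>k[X\<^sub>s]/(X\<^sub>s\<^sup>p)\<close> with \<open>X\<^sub>s = E (p\<^sup>s)\<close>.  Each factor has a periodic minimal
  resolution, so the cohomology of the algebra is that of a complex whose cells are the finite multisets
  of indices \<open>s\<close>.  On an injective \<open>G\<close>-module this complex has no cohomology in positive degree and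
  non-negative weight; dimension shifting therefore bounds \<open>Ext\<^sup>n(V(m2), V(m1))\<close> by the cohomology
  of \<open>V(m1)\<close> in degree \<open>n\<close> and weight \<open>m2\<close>.  There every cell carries a space of dimension at most one,
  an acyclic matching cancels most cells, and for \<open>n \<le> 2p - 3\<close> the remaining critical cells are
  counted by Fibonacci numbers.
\<close>

section \<open>Linear algebra\<close>

text \<open>Injectivity over \<open>G\<close> can only be tested on modules for \<open>G\<close>. A
  vector of weight \<open>y\<close> killed by all \<open>E j\<close> with \<open>j \<ge> 1\<close>
  generates an image of \<open>V(y)\<close>; the larger module used to extend it is a tensor product
  of \<open>V(y - t)\<close> with a truncated symmetric power, and \<open>V(y)\<close> is seen to
  embed there when \<open>2 * t \<le> y\<close>. This is why acyclicity is confined to non-negative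
  weights. The matching comes from one number. With \<open>m1 = m2 + 2 * g\<close> a cell
  \<open>c\<close> carries the basis vector of index \<open>m2 + g + cell_wt p c\<close>, and by
  Lucas a single \<open>p\<close>-adic digit decides whether a step of the differential is non-zero
  there. If \<open>p ^ \<sigma>\<close> is the exact power of \<open>p\<close> in
  \<open>Suc (m2 + g)\<close>, then \<open>m2 + g\<close> has the digit \<open>p - 1\<close> below
  \<open>\<sigma>\<close> and a smaller one at \<open>\<sigma>\<close>: hence pairs are formed by
  steps X^(p-1) below \<open>\<sigma>\<close> and by steps X at \<open>\<sigma>\<close>. The bound
  \<open>2 * p - 3\<close> prevents carries when a cell is counted by the digits of its weight. The
  bound on \<open>m2\<close> forces digits \<open>p - 1\<close> from position \<open>r\<close> on,
  which so few elements cannot produce; this leaves at most \<open>r - 1\<close> summands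
  \<open>F(n)\<close>.\<close>

lemma infinite_UNIV_alg_closed: "infinite (UNIV :: 'k::alg_closed_field set)"
proof
  assume fin: "finite (UNIV :: 'k set)"
  let ?P = "(\<Prod>a\<in>(UNIV::'k set). [:-a, 1:])"
  have nz: "?P \<noteq> 0" using fin by simp
  have "degree ?P = card (UNIV::'k set)"
    by (subst degree_prod_eq_sum_degree) auto
  hence "degree ?P > 0" using fin by (simp add: finite_UNIV_card_ge_0)
  hence "degree (?P + 1) > 0" by (simp add: degree_add_eq_left)
  then obtain x where "poly (?P + 1) x = 0" using alg_closed_imp_poly_has_root by blast
  moreover have "poly ?P x = 0" using fin by (auto simp: poly_prod)
  ultimately show False by simp
qed

lemma infinite_nonzero: "infinite (- {0 :: 'k::alg_closed_field})"
  using infinite_UNIV_alg_closed by (simp add: Compl_eq_Diff_UNIV)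

lemma poly_eqI_infinite:
  fixes P Q :: "'k::idom poly"
  assumes "infinite T" and "\<And>x. x \<in> T \<Longrightarrow> poly P x = poly Q x"
  shows "P = Q"
proof (rule ccontr)
  assume "P \<noteq> Q"
  hence "finite {x. poly (P - Q) x = 0}" by (intro poly_roots_finite) simp
  moreover have "T \<subseteq> {x. poly (P - Q) x = 0}" using assms(2) by auto
  ultimately show False using assms(1) finite_subset by blast
qed

context vector_space
begin

text \<open>Reduces statements about vectors to statements about scalars, so that identities between
  vector-valued polynomials can be decided by counting roots.\<close>

lemma separating_functional:
  assumes "subspace S" and "x \<notin> S"
  obtains f where "Vector_Spaces.linear scale (*) f" and "\<And>y. y \<in> S \<Longrightarrow> f y = 0" and "f x = 1"
proof -
  interpret p: vector_space_pair scale "(*) :: 'a \<Rightarrow> 'a \<Rightarrow> 'a"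
    by (unfold_locales) (auto simp: algebra_simps)
  obtain B where B: "B \<subseteq> S" "independent B" "S \<subseteq> span B"
    by (rule maximal_independent_subset[of S])
  have "span B = S" using B assms(1) span_subspace by blast
  hence "x \<notin> span B" using assms(2) by simp
  hence ind: "independent (insert x B)" using B(2) by (simp add: independent_insert)
  then obtain f where f: "Vector_Spaces.linear scale (*) f"
    "\<forall>y\<in>insert x B. f y = (if y = x then 1 else 0)"
    using p.linear_independent_extend[of "insert x B" "\<lambda>y. if y = x then 1 else 0"] by blast
  interpret l: Vector_Spaces.linear scale "(*)" f by fact
  have "x \<notin> B" using \<open>x \<notin> span B\<close> span_base by blast
  hence "f y = 0" if "y \<in> B" for y using f(2) that by auto
  hence "f y = 0" if "y \<in> S" for y
    using that \<open>span B = S\<close> p.linear_eq_0_on_span[OF f(1)] by blast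
  with f that show ?thesis by simp
qed

text \<open>A functional that vanishes on \<open>S\<close> but not at the coefficient would give a
  non-zero scalar polynomial with infinitely many roots.\<close>

lemma poly_coeffs_mem:
  assumes inf: "infinite T" and S: "subspace S"
    and mem: "\<And>b. b \<in> T \<Longrightarrow> (\<Sum>j<J. scale (b ^ j) (m j)) \<in> S" and "j < J"
  shows "m j \<in> S"
proof (rule ccontr)
  assume "m j \<notin> S"
  then obtain f where f: "Vector_Spaces.linear scale (*) f" "\<And>y. y \<in> S \<Longrightarrow> f y = 0" "f (m j) = 1"
    using separating_functional[OF S] by metis
  interpret l: Vector_Spaces.linear scale "(*)" f by fact
  define P where "P = (\<Sum>i<J. monom (f (m i)) i)"
  have "poly P b = 0" if "b \<in> T" for b
  proof -
    have "f (\<Sum>j<J. scale (b ^ j) (m j)) = 0" using f(2) mem that by blast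
    thus ?thesis by (simp add: P_def poly_sum poly_monom l.sum l.scale mult.commute)
  qed
  hence "P = 0" using poly_eqI_infinite[OF inf, of P 0] by simp
  moreover have "coeff P j = f (m j)"
    using \<open>j < J\<close> by (simp add: P_def coeff_sum)
  ultimately show False using f(3) by simp
qed

text \<open>The analogue for characters of the torus: a shift of all exponents by \<open>L\<close>
  makes them non-negative and reduces the claim to polynomials.\<close>

lemma laurent_coeffs_mem:
  assumes inf: "infinite (- {0 :: 'a})" and S: "subspace S" and K: "finite (K :: int set)"
    and mem: "\<And>b. b \<noteq> 0 \<Longrightarrow> (\<Sum>n\<in>K. scale (b powi n) (m n)) \<in> S" and "n \<in> K"
  shows "m n \<in> S"
proof (rule ccontr)
  assume "m n \<notin> S"
  then obtain f where f: "Vector_Spaces.linear scale (*) f" "\<And>y. y \<in> S \<Longrightarrow> f y = 0" "f (m n) = 1"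
    using separating_functional[OF S] by metis
  interpret l: Vector_Spaces.linear scale "(*)" f by fact
  obtain L where L: "\<And>i. i \<in> K \<Longrightarrow> 0 \<le> i + L"
  proof -
    have "0 \<le> i + (\<Sum>i\<in>K. \<bar>i\<bar>)" if "i \<in> K" for i
      using member_le_sum[of i K "\<lambda>i. \<bar>i\<bar>"] that K by auto
    thus ?thesis using that by blast
  qed
  define P where "P = (\<Sum>i\<in>K. monom (f (m i)) (nat (i + L)))"
  have "poly P b = 0" if "b \<noteq> 0" for b
  proof -
    have "f (\<Sum>i\<in>K. scale (b powi i) (m i)) = 0" using f(2) mem that by blast
    hence "b powi L * (\<Sum>i\<in>K. b powi i * f (m i)) = 0" by (simp add: l.sum l.scale)
    moreover have "b powi L * (\<Sum>i\<in>K. b powi i * f (m i)) = (\<Sum>i\<in>K. b ^ nat (i + L) * f (m i))"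
      unfolding sum_distrib_left
    proof (rule sum.cong, simp)
      fix i assume "i \<in> K"
      hence "b powi (i + L) = b ^ nat (i + L)" using L by (simp add: power_int_def)
      thus "b powi L * (b powi i * f (m i)) = b ^ nat (i + L) * f (m i)"
        using that by (simp add: power_int_add mult_ac)
    qed
    ultimately show ?thesis by (simp add: P_def poly_sum poly_monom mult.commute)
  qed
  hence "P = 0" using poly_eqI_infinite[OF inf, of P 0] by simp
  moreover have "coeff P (nat (n + L)) = f (m n)"
  proof -
    have "nat (i + L) = nat (n + L) \<longleftrightarrow> i = n" if "i \<in> K" for i
      using L[OF that] L[OF \<open>n \<in> K\<close>] by auto
    hence "coeff P (nat (n + L)) = (\<Sum>i\<in>K. if i = n then f (m i) else 0)"
      by (simp add: P_def coeff_sum)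
    thus ?thesis using K \<open>n \<in> K\<close> by (simp add: sum.delta)
  qed
  ultimately show False using f(3) by simp
qed

end

text \<open>Gaussian elimination: if equation \<open>c\<close> involves the unknown
  \<open>j\<close>, it is solved for \<open>j\<close> and substituted into the others. The reduced
  coefficients are \<open>\<kappa>'\<close>, and the value of the unknown \<open>j\<close> is
  restored in \<open>b\<close>.\<close>

lemma homogeneous_system:
  fixes \<kappa> :: "'i \<Rightarrow> 'c \<Rightarrow> 'k::field"
  assumes "finite C" and "finite I" and "card C < card I"
  shows "\<exists>a. (\<exists>i\<in>I. a i \<noteq> 0) \<and> (\<forall>c\<in>C. (\<Sum>i\<in>I. a i * \<kappa> i c) = 0)"
  using assms
proof (induction C arbitrary: I \<kappa> rule: finite_induct)
  case empty
  hence "I \<noteq> {}" by auto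
  thus ?case by (intro exI[of _ "\<lambda>_. 1"]) auto
next
  case (insert c C)
  show ?case
  proof (cases "\<forall>i\<in>I. \<kappa> i c = 0")
    case True
    have "card C < card I" using insert by simp
    from insert.IH[OF insert.prems(1) this, of \<kappa>] True show ?thesis by auto
  next
    case False
    then obtain j where j: "j \<in> I" "\<kappa> j c \<noteq> 0" by blast
    define I' where "I' = I - {j}"
    define \<kappa>' where "\<kappa>' i d = \<kappa> i d - \<kappa> i c / \<kappa> j c * \<kappa> j d" for i d
    have I: "I = insert j I'" "j \<notin> I'" "finite I'" using j insert.prems by (auto simp: I'_def)
    have "card C < card I'" using insert I by simp
    from insert.IH[OF I(3) this, of \<kappa>'] obtain a where
      a: "\<exists>i\<in>I'. a i \<noteq> 0" "\<forall>d\<in>C. (\<Sum>i\<in>I'. a i * \<kappa>' i d) = 0" by blast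
    define b where "b i = (if i = j then - (\<Sum>i\<in>I'. a i * \<kappa> i c) / \<kappa> j c else a i)" for i
    have sb: "(\<Sum>i\<in>I. b i * \<kappa> i d) = (\<Sum>i\<in>I'. a i * \<kappa>' i d)" for d
    proof -
      have "(\<Sum>i\<in>I'. b i * \<kappa> i d) = (\<Sum>i\<in>I'. a i * \<kappa> i d)"
        by (rule sum.cong) (use I in \<open>auto simp: b_def\<close>)
      hence "(\<Sum>i\<in>I. b i * \<kappa> i d) = - (\<Sum>i\<in>I'. a i * \<kappa> i c) / \<kappa> j c * \<kappa> j d + (\<Sum>i\<in>I'. a i * \<kappa> i d)"
        using I by (simp add: b_def)
      also have "- (\<Sum>i\<in>I'. a i * \<kappa> i c) / \<kappa> j c * \<kappa> j d = (\<Sum>i\<in>I'. - (a i * (\<kappa> i c / \<kappa> j c * \<kappa> j d)))"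
        by (simp add: sum_distrib_right sum_divide_distrib sum_negf mult.assoc)
      also have "\<dots> + (\<Sum>i\<in>I'. a i * \<kappa> i d) = (\<Sum>i\<in>I'. a i * \<kappa>' i d)"
        by (simp add: \<kappa>'_def algebra_simps flip: sum.distrib)
      finally show ?thesis .
    qed
    have "(\<Sum>i\<in>I. b i * \<kappa> i c) = 0" using j by (simp add: sb \<kappa>'_def)
    moreover have "\<exists>i\<in>I. b i \<noteq> 0" using a(1) I by (auto simp: b_def)
    ultimately show ?thesis using a(2) sb by auto
  qed
qed

text \<open>
  \<open>dim_le s N Z B\<close> says \<open>dim (Z + B) / B \<le> N\<close> for a subspace \<open>B\<close>.  This form needs no basis of the quotient and
  passes along linear relations.
\<close>

definition dim_le :: "('k::field \<Rightarrow> 'a::ab_group_add \<Rightarrow> 'a) \<Rightarrow> nat \<Rightarrow> 'a set \<Rightarrow> 'a set \<Rightarrow> bool" where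
  "dim_le s N Z B \<longleftrightarrow>
     (\<forall>z. (\<forall>i\<le>N. z i \<in> Z) \<longrightarrow> (\<exists>a. (\<exists>i\<le>N. a i \<noteq> 0) \<and> (\<Sum>i\<le>N. s (a i) (z i)) \<in> B))"

text \<open>The bound makes the sizes of finite independent families bounded, so one of maximal size
  exists, and the exchange property shows that it spans modulo \<open>B\<close>.\<close>

lemma quotient_dim_le:
  assumes "vector_space s" and B: "module.subspace s B" and le: "dim_le s N Z B"
  shows "quotient_dim s Z B \<le> enat N"
proof -
  interpret vector_space s by fact
  define ind where "ind S \<longleftrightarrow> (\<forall>x\<in>S. x \<notin> span ((S - {x}) \<union> B))" for S
  define F where "F = {S. finite S \<and> S \<subseteq> Z \<and> ind S}"
  have card_le: "card S \<le> N" if S: "S \<in> F" for S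
  proof (rule ccontr)
    assume "\<not> card S \<le> N"
    \<comment> \<open>\<open>N + 1\<close> distinct members of \<open>S\<close> satisfy a relation
      modulo \<open>B\<close>; dividing by a non-zero coefficient contradicts independence.\<close>
    hence "card {..N} \<le> card S" by simp
    moreover have "finite S" using S by (simp add: F_def)
    ultimately obtain z where z: "inj_on z {..N}" "z ` {..N} \<subseteq> S"
      using card_le_inj[of "{..N}" S] by auto
    hence zZ: "\<forall>i\<le>N. z i \<in> Z" using S by (auto simp: F_def)
    obtain a where a: "\<exists>i\<le>N. a i \<noteq> 0" "(\<Sum>i\<le>N. s (a i) (z i)) \<in> B"
      using le[unfolded dim_le_def, rule_format, of z] zZ by auto
    then obtain i where i: "i \<le> N" "a i \<noteq> 0" by blast
    let ?X = "span ((S - {z i}) \<union> B)"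
    have "s (a j) (z j) \<in> ?X" if "j \<in> {..N} - {i}" for j
    proof -
      have "z j \<noteq> z i" using z(1) that i(1) by (auto simp: inj_on_def)
      hence "z j \<in> S - {z i}" using z(2) that by auto
      thus ?thesis by (intro span_scale span_base) auto
    qed
    hence "(\<Sum>j\<in>{..N} - {i}. s (a j) (z j)) \<in> ?X" by (rule span_sum)
    moreover have "(\<Sum>j\<le>N. s (a j) (z j)) \<in> ?X" using a(2) span_base by blast
    moreover have "s (a i) (z i) = (\<Sum>j\<le>N. s (a j) (z j)) - (\<Sum>j\<in>{..N} - {i}. s (a j) (z j))"
      using i(1) by (simp add: sum.remove)
    ultimately have "s (a i) (z i) \<in> ?X" using span_diff by metis
    hence "s (inverse (a i)) (s (a i) (z i)) \<in> ?X" by (rule span_scale)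
    hence "z i \<in> ?X" using i(2) by simp
    moreover have "z i \<in> S" using z(2) i(1) by auto
    ultimately show False using S by (auto simp: F_def ind_def)
  qed
  have "{} \<in> F" by (simp add: F_def ind_def)
  moreover have "finite (card ` F)"
    by (rule finite_subset[of _ "{..N}"]) (use card_le in auto)
  ultimately obtain S where S: "S \<in> F" "\<And>T. T \<in> F \<Longrightarrow> card T \<le> card S"
    using Max_in[of "card ` F"] Max_ge[of "card ` F"] by (metis empty_iff imageE image_eqI)
  have fS: "finite S" and SZ: "S \<subseteq> Z" and iS: "ind S" using S(1) by (auto simp: F_def)
  have "Z \<subseteq> span (S \<union> B)"
  proof
    fix x assume x: "x \<in> Z"
    show "x \<in> span (S \<union> B)"
    proof (rule ccontr)
      assume nx: "x \<notin> span (S \<union> B)"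
      hence xS: "x \<notin> S" using span_base by blast
      have "ind (insert x S)"
        unfolding ind_def
      proof
        fix y assume y: "y \<in> insert x S"
        show "y \<notin> span ((insert x S - {y}) \<union> B)"
        proof (cases "y = x")
          case True
          thus ?thesis using nx xS by simp
        next
          case False
          hence yS: "y \<in> S" using y by simp
          have eq: "(insert x S - {y}) \<union> B = insert x ((S - {y}) \<union> B)" using False by auto
          show ?thesis
          proof
            assume "y \<in> span ((insert x S - {y}) \<union> B)"
            moreover have "y \<notin> span ((S - {y}) \<union> B)" using iS yS by (auto simp: ind_def)
            ultimately have "x \<in> span (insert y ((S - {y}) \<union> B))"
              unfolding eq by (rule in_span_insert)
            also have "insert y ((S - {y}) \<union> B) = S \<union> B" using yS by auto
            finally show False using nx by simp
          qed
        qed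
      qed
      hence "insert x S \<in> F" using fS SZ x by (simp add: F_def)
      from S(2)[OF this] show False using xS fS by simp
    qed
  qed
  hence "basis_mod s Z B S" using SZ iS by (simp add: basis_mod_def ind_def)
  hence "quotient_dim s Z B \<le> enat (card S)"
    unfolding quotient_dim_def using fS by (intro INF_lower) simp
  also have "\<dots> \<le> enat N" using card_le[OF S(1)] by simp
  finally show ?thesis .
qed

section \<open>Binomial coefficients in characteristic \<open>p\<close>\<close>

text \<open>Compare coefficients in (1 + X)^(pn + i) = (1 + X^p)^n (1 + X)^i. As \<open>i\<close>
  and \<open>j\<close> are below \<open>p\<close>, the exponent \<open>p * m + j\<close> can only
  arise from the term \<open>k = m\<close> of the first factor.\<close>

lemma lucas_step:
  fixes n m i j p :: nat
  assumes p: "prime p" "CHAR('k::field) = p" and ij: "i < p" "j < p"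
  shows "(of_nat ((p * n + i) choose (p * m + j)) :: 'k) = of_nat (n choose m) * of_nat (i choose j)"
proof -
  have cp: "CHAR('k poly) = p" using p(2) by simp
  let ?X = "[:0, 1:] :: 'k poly"
  have lin: "coeff ([:1, 1:] ^ n) k = (of_nat (n choose k) :: 'k)" for n k
    by (cases "k \<le> n") (auto simp: coeff_linear_poly_power coeff_eq_0 degree_power_eq binomial_eq_0)
  have "([:1, 1:] :: 'k poly) ^ p = (1 + ?X) ^ p" by (simp add: one_pCons)
  also have "\<dots> = 1 ^ p + ?X ^ p"
  proof (rule freshmans_dream)
    show "prime CHAR('k poly)" using cp p(1) by argo
    show "p = CHAR('k poly)" using cp by argo
  qed
  also have "(1 :: 'k poly) ^ p = 1" by (rule power_one)
  finally have "([:1, 1:] :: 'k poly) ^ (p * n + i) = (1 + ?X ^ p) ^ n * [:1, 1:] ^ i"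
    by (simp only: power_add power_mult)
  also have "(1 + ?X ^ p) ^ n = (\<Sum>k\<le>n. monom (of_nat (n choose k)) (p * k))"
    by (subst add.commute, subst binomial_ring)
      (simp add: power_mult [symmetric] monom_altdef mult.commute of_nat_poly)
  finally have eq: "([:1, 1:] :: 'k poly) ^ (p * n + i) =
      (\<Sum>k\<le>n. monom (of_nat (n choose k)) (p * k) * [:1, 1:] ^ i)" by (simp add: sum_distrib_right)
  have "(of_nat ((p * n + i) choose (p * m + j)) :: 'k) = coeff ([:1, 1:] ^ (p * n + i)) (p * m + j)"
    by (simp add: lin)
  also have "\<dots> = (\<Sum>k\<le>n. if k = m then of_nat (n choose m) * of_nat (i choose j) else 0)"
    unfolding eq coeff_sum
  proof (rule sum.cong, simp)
    fix k
    show "coeff (monom (of_nat (n choose k)) (p * k) * [:1, 1:] ^ i) (p * m + j) =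
        (if k = m then of_nat (n choose m) * (of_nat (i choose j) :: 'k) else 0)"
    proof (cases k m rule: linorder_cases)
      case less
      then obtain l where l: "m = k + Suc l" using less_iff_Suc_add by auto
      have "p * m + j - p * k = p * Suc l + j" by (simp add: l algebra_simps)
      moreover have "i < p * Suc l + j" using ij by (simp add: algebra_simps)
      ultimately show ?thesis using less by (simp add: coeff_monom_mult lin binomial_eq_0)
    next
      case greater
      then obtain l where l: "k = m + Suc l" using less_iff_Suc_add by auto
      have "p * k > p * m + j" using ij by (simp add: l algebra_simps)
      thus ?thesis using greater by (simp add: coeff_monom_mult)
    qed (simp add: coeff_monom_mult lin)
  qed
  also have "\<dots> = of_nat (n choose m) * of_nat (i choose j)"
    by (cases "m \<le> n") (auto simp: sum.delta binomial_eq_0)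
  finally show ?thesis .
qed

text \<open>The lower index has at most one non-zero digit, at position \<open>s\<close>, so all
  other factors in the theorem of Lucas are 1.\<close>

lemma lucas_digit:
  assumes p: "prime p" "CHAR('k::field) = p" and j: "j < p"
  shows "(of_nat (t choose (j * p ^ s)) :: 'k) = of_nat ((t div p ^ s mod p) choose j)"
proof (induction s arbitrary: t)
  have p0: "p > 0" using p prime_gt_0_nat by auto
  case 0
  have "(of_nat (t choose j) :: 'k) = of_nat ((p * (t div p) + t mod p) choose (p * 0 + j))" by simp
  also have "\<dots> = of_nat ((t mod p) choose j)"
    using lucas_step[OF p, of "t mod p" j "t div p" 0] j p0 by simp
  finally show ?case by simp
next
  have p0: "p > 0" using p prime_gt_0_nat by auto
  case (Suc s)
  have "(of_nat (t choose (j * p ^ Suc s)) :: 'k) =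
      of_nat ((p * (t div p) + t mod p) choose (p * (j * p ^ s) + 0))" by (simp add: mult_ac)
  also have "\<dots> = of_nat ((t div p) choose (j * p ^ s))"
    using lucas_step[OF p, of "t mod p" 0 "t div p" "j * p ^ s"] p0 by simp
  also have "\<dots> = of_nat ((t div p div p ^ s mod p) choose j)" by (rule Suc)
  finally show ?case by (simp add: div_mult2_eq)
qed

text \<open>The binomial coefficient divides \<open>fact d\<close>, which is prime to
  \<open>p\<close>.\<close>

lemma of_nat_choose_less_prime_ne_0:
  assumes p: "prime p" "CHAR('k::field) = p" and "d < p" and "j \<le> d"
  shows "(of_nat (d choose j) :: 'k) \<noteq> 0"
proof
  assume "(of_nat (d choose j) :: 'k) = 0"
  hence "p dvd (d choose j)" using p of_nat_eq_0_iff_char_dvd by blast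
  hence "p dvd fact d"
    using assms(4) by (metis binomial_fact_lemma dvd_mult)
  thus False using p(1) assms(3) by (simp add: prime_dvd_fact_iff)
qed

lemma of_nat_choose_digit_eq_0_iff:
  assumes p: "prime p" "CHAR('k::field) = p" and j: "j < p"
  shows "(of_nat (t choose (j * p ^ s)) :: 'k) = 0 \<longleftrightarrow> t div p ^ s mod p < j"
proof -
  have "t div p ^ s mod p < p" using p prime_gt_0_nat by auto
  thus ?thesis
    using lucas_digit[OF assms, of t s] of_nat_choose_less_prime_ne_0[OF p, of "t div p ^ s mod p" j]
    by (metis binomial_eq_0 not_le of_nat_0)
qed

section \<open>Counting cells\<close>

text \<open>The degree of the \<open>k\<close>-th map, counted from 1, in the periodic resolution
  over k[X]/(X^p) with X of degree \<open>p ^ s\<close>: the maps are alternately X and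
  X^(p-1).\<close>

definition step_wt :: "nat \<Rightarrow> nat \<Rightarrow> nat \<Rightarrow> nat" where
  "step_wt p s k = (if odd k then p ^ s else (p - 1) * p ^ s)"

text \<open>The sum of all \<open>step_wt\<close> leading to the cell, in closed form: two
  successive steps at \<open>s\<close> add up to a block \<open>p * p ^ s\<close>.\<close>

definition cell_wt :: "nat \<Rightarrow> nat multiset \<Rightarrow> nat" where
  "cell_wt p c = (\<Sum>s\<in>set_mset c. p ^ s * (p * (count c s div 2) + count c s mod 2))"

lemma cell_wt_sum:
  assumes "finite T" and "set_mset c \<subseteq> T"
  shows "cell_wt p c = (\<Sum>s\<in>T. p ^ s * (p * (count c s div 2) + count c s mod 2))"
  unfolding cell_wt_def
  by (rule sum.mono_neutral_left) (use assms in \<open>auto simp: not_in_iff\<close>)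

lemma cell_wt_empty [simp]: "cell_wt p {#} = 0"
  by (simp add: cell_wt_def)

lemma cell_wt_add_mset:
  assumes "p > 0"
  shows "cell_wt p (add_mset s c) = cell_wt p c + step_wt p s (Suc (count c s))"
proof -
  let ?f = "\<lambda>s k. p ^ s * (p * (k div 2) + k mod 2)"
  let ?T = "insert s (set_mset c)"
  \<comment> \<open>An odd step leaves \<open>p ^ s\<close> as a remainder; the even step after it
    completes the block \<open>p * p ^ s\<close>.\<close>
  have step: "?f s (Suc k) = ?f s k + step_wt p s (Suc k)" for k
  proof (cases "even k")
    case True
    thus ?thesis by (auto simp: step_wt_def elim!: evenE)
  next
    case False
    then obtain l where l: "k = 2 * l + 1" by (rule oddE)
    have "p * p ^ s = p ^ s + (p - 1) * p ^ s" using assms by (simp flip: mult_Suc)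
    moreover have "Suc k div 2 = Suc l" "Suc k mod 2 = 0" "k div 2 = l" "k mod 2 = 1"
      by (simp_all add: l)
    hence "p ^ s * (p * (Suc k div 2) + Suc k mod 2) = p ^ s * (p * l) + p * p ^ s"
      "p ^ s * (p * (k div 2) + k mod 2) = p ^ s * (p * l) + p ^ s"
      by (simp_all add: algebra_simps)
    ultimately show ?thesis by (simp add: l step_wt_def)
  qed
  have "cell_wt p (add_mset s c) = (\<Sum>i\<in>?T. ?f i (count (add_mset s c) i))"
    by (rule cell_wt_sum) auto
  also have "\<dots> = ?f s (Suc (count c s)) + (\<Sum>i\<in>?T - {s}. ?f i (count (add_mset s c) i))"
    by (subst sum.remove[of _ s]) auto
  also have "(\<Sum>i\<in>?T - {s}. ?f i (count (add_mset s c) i)) = (\<Sum>i\<in>?T - {s}. ?f i (count c i))"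
    by (rule sum.cong) auto
  also have "?f s (Suc (count c s)) + \<dots> = step_wt p s (Suc (count c s)) + (\<Sum>i\<in>?T. ?f i (count c i))"
    by (subst (2) sum.remove[of _ s]) (auto simp: step)
  also have "(\<Sum>i\<in>?T. ?f i (count c i)) = cell_wt p c"
    by (rule cell_wt_sum[symmetric]) auto
  finally show ?thesis by simp
qed

lemma cell_wt_remove:
  assumes "p > 0" and "s \<in># c"
  shows "cell_wt p c = cell_wt p (c - {#s#}) + step_wt p s (count c s)"
proof -
  obtain c' where c: "c = add_mset s c'" using assms(2) by (blast dest: multi_member_split)
  show ?thesis using cell_wt_add_mset[OF assms(1), of s c'] by (simp add: c)
qed

lemma step_wt_pos: "p > 1 \<Longrightarrow> step_wt p s k > 0"
  by (simp add: step_wt_def)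

lemma cell_wt_pos:
  assumes "p > 1" and "c \<noteq> {#}"
  shows "cell_wt p c > 0"
proof -
  obtain s where "s \<in># c" using assms(2) by blast
  thus ?thesis using cell_wt_remove[of p s c] step_wt_pos[of p s "count c s"] assms(1) by simp
qed

lemma le_cell_wt:
  assumes "p > 1" and "s \<in># c"
  shows "p ^ s \<le> cell_wt p c"
proof -
  have "p ^ s \<le> step_wt p s k" for k using assms(1) by (auto simp: step_wt_def)
  thus ?thesis using cell_wt_remove[of p s c] assms by (simp add: trans_le_add2)
qed

text \<open>An index \<open>s\<close> of a cell satisfies \<open>s < p ^ s\<close> and
  \<open>p ^ s\<close> is at most the weight, so the weight bounds the indices and the size bounds
  their number.\<close>

lemma finite_cells:
  assumes "p > 1"
  shows "finite {c. size c = n \<and> cell_wt p c \<le> g}"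
proof -
  have "{c. size c = n \<and> cell_wt p c \<le> g} \<subseteq> mset ` {xs. set xs \<subseteq> {..g} \<and> length xs = n}"
  proof
    fix c assume c: "c \<in> {c. size c = n \<and> cell_wt p c \<le> g}"
    obtain xs where xs: "c = mset xs" by (metis ex_mset)
    have "s \<le> g" if "s \<in># c" for s
    proof -
      have "s < p ^ s" using assms by (intro power_gt_expt) simp
      also have "\<dots> \<le> g" using le_cell_wt[OF assms that] c by simp
      finally show ?thesis by simp
    qed
    thus "c \<in> mset ` {xs. set xs \<subseteq> {..g} \<and> length xs = n}" using c xs by auto
  qed
  thus ?thesis by (rule finite_subset) (simp add: finite_lists_length_eq)
qed

lemma count_image_mset_shift: "count (image_mset (\<lambda>i. i + s) c) (x + s) = count c (x :: nat)"
  by (induction c) auto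

lemma cell_wt_shift:
  assumes "p > 0"
  shows "cell_wt p (image_mset (\<lambda>i. i + s) c) = p ^ s * cell_wt p c"
proof (induction c)
  case (add x c)
  have "step_wt p (x + s) k = p ^ s * step_wt p x k" for k by (simp add: step_wt_def power_add)
  thus ?case using add assms
    by (simp add: cell_wt_add_mset count_image_mset_shift distrib_left)
qed simp

section \<open>Splitting off the index 0: cells and the digits of their weight\<close>

definition lower :: "nat multiset \<Rightarrow> nat multiset" where
  "lower c = image_mset (\<lambda>i. i - 1) (filter_mset (\<lambda>i. i \<noteq> 0) c)"

lemma lower_decomp: "c = replicate_mset (count c 0) 0 + image_mset Suc (lower c)"
proof -
  have "image_mset Suc (lower c) = image_mset (\<lambda>i. i) (filter_mset (\<lambda>i. i \<noteq> 0) c)"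
    unfolding lower_def image_mset.compositionality by (rule image_mset_cong) auto
  moreover have "c = filter_mset (\<lambda>i. i = 0) c + filter_mset (\<lambda>i. i \<noteq> 0) c"
    by (rule multiset_partition)
  moreover have "filter_mset (\<lambda>i. i = 0) c = replicate_mset (count c 0) 0"
    using filter_eq_replicate_mset[of 0 c] by (simp add: eq_commute)
  ultimately show ?thesis by simp
qed

lemma size_lower: "size c = count c 0 + size (lower c)"
proof -
  have "size c = size (replicate_mset (count c 0) 0 + image_mset Suc (lower c))"
    by (rule arg_cong[OF lower_decomp])
  thus ?thesis by simp
qed

lemma cell_wt_lower:
  assumes "p > 0"
  shows "cell_wt p c = p * (count c 0 div 2) + count c 0 mod 2 + p * cell_wt p (lower c)"
proof -
  let ?d = "image_mset Suc (lower c)"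
  have cnt: "count c (Suc i) = count ?d (Suc i)" for i
    using arg_cong[OF lower_decomp[of c], of "\<lambda>c. count c (Suc i)"] by (simp add: count_replicate_mset)
  have "cell_wt p c = (\<Sum>s\<in>insert 0 (set_mset c). p ^ s * (p * (count c s div 2) + count c s mod 2))"
    by (rule cell_wt_sum) auto
  also have "\<dots> = p * (count c 0 div 2) + count c 0 mod 2 +
      (\<Sum>s\<in>set_mset c - {0}. p ^ s * (p * (count c s div 2) + count c s mod 2))"
    by (subst sum.insert_remove) auto
  also have "(\<Sum>s\<in>set_mset c - {0}. p ^ s * (p * (count c s div 2) + count c s mod 2)) = cell_wt p ?d"
    unfolding cell_wt_def
  proof (rule sum.cong)
    show "set_mset c - {0} = set_mset ?d"
      by (force simp: lower_def image_iff Bex_def)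
    fix s assume "s \<in> set_mset ?d"
    then obtain i where "s = Suc i" by auto
    thus "p ^ s * (p * (count c s div 2) + count c s mod 2) =
        p ^ s * (p * (count ?d s div 2) + count ?d s mod 2)" using cnt by simp
  qed
  also have "cell_wt p ?d = p * cell_wt p (lower c)"
    using cell_wt_shift[OF assms, of 1 "lower c"] by simp
  finally show ?thesis .
qed

text \<open>What critical cells become once their least admissible index is shifted to 0. Evenness
  at 0 makes the weight a multiple of \<open>p\<close>, so \<open>d\<close> is the weight with its
  last digit removed.\<close>

definition even_cells :: "nat \<Rightarrow> nat \<Rightarrow> nat \<Rightarrow> nat multiset set" where
  "even_cells p n d = {c. size c = n \<and> even (count c 0) \<and> cell_wt p c = p * d}"

context
  fixes p :: nat
  assumes p3: "p \<ge> 3"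
begin

lemma p_gt: "p > 1" "p > 0" using p3 by auto

lemma finite_even_cells: "finite (even_cells p n d)"
  by (rule finite_subset[OF _ finite_cells[OF p_gt(1), of n "p * d"]]) (auto simp: even_cells_def)

lemma cell_wt_even:
  assumes "even (count c 0)"
  shows "cell_wt p c = p * (count c 0 div 2 + cell_wt p (lower c))"
  using cell_wt_lower[OF p_gt(2), of c] assms by (simp add: algebra_simps)

lemma odd_count_remove:
  assumes "odd (count c 0)"
  shows "even (count (c - {#0#}) 0)" and "cell_wt p c = Suc (cell_wt p (c - {#0#}))"
    and "size c = Suc (size (c - {#0#}))" and "c = add_mset 0 (c - {#0#})"
proof -
  have "0 \<in># c" using assms by (metis even_zero not_in_iff)
  then obtain a where a: "c = add_mset 0 a" by (blast dest: multi_member_split)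
  show "size c = Suc (size (c - {#0#}))" "c = add_mset 0 (c - {#0#})" by (simp_all add: a)
  show "even (count (c - {#0#}) 0)" using assms \<open>0 \<in># c\<close> by simp
  show "cell_wt p c = Suc (cell_wt p (c - {#0#}))"
    using cell_wt_remove[OF p_gt(2) \<open>0 \<in># c\<close>] assms by (simp add: step_wt_def)
qed

text \<open>If 0 has multiplicity \<open>2 * t\<close>, then \<open>d\<close> is \<open>t\<close>
  plus the weight of the lowered cell, and that weight is 0 or 1 modulo \<open>p\<close> according
  to the parity of its own zeros. So the last digit of \<open>d\<close> is \<open>t\<close> or
  \<open>t + 1\<close>, which gives the two summands; in the second case one more zero is removed to
  restore evenness.\<close>

lemma card_even_cells_rec:
  fixes d :: nat
  assumes n: "n \<le> 2 * p - 3"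
  defines "t0 \<equiv> d mod p" and "d' \<equiv> d div p"
  shows "card (even_cells p n d) \<le>
     (if 2 * t0 \<le> n then card (even_cells p (n - 2 * t0) d') else 0) +
     (if 1 \<le> t0 \<and> 2 * t0 \<le> n + 1 then card (even_cells p (n + 1 - 2 * t0) d') else 0)"
proof -
  let ?f = "\<lambda>c. replicate_mset (2 * t0) 0 + image_mset Suc c"
  let ?g = "\<lambda>c. replicate_mset (2 * (t0 - 1)) 0 + image_mset Suc (add_mset 0 c)"
  let ?A = "if 2 * t0 \<le> n then even_cells p (n - 2 * t0) d' else {}"
  let ?B = "if 1 \<le> t0 \<and> 2 * t0 \<le> n + 1 then even_cells p (n + 1 - 2 * t0) d' else {}"
  have "even_cells p n d \<subseteq> ?f ` ?A \<union> ?g ` ?B"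
  proof
    fix c assume "c \<in> even_cells p n d"
    hence c: "size c = n" "even (count c 0)" "cell_wt p c = p * d" by (auto simp: even_cells_def)
    then obtain t where t: "count c 0 = 2 * t" by (auto elim: evenE)
    define b where "b = lower c"
    have cb: "c = replicate_mset (2 * t) 0 + image_mset Suc b"
      using lower_decomp[of c] by (simp add: b_def t)
    have sz: "n = 2 * t + size b" using size_lower[of c] c t by (simp add: b_def)
    have d: "d = t + cell_wt p b" using cell_wt_even[OF c(2)] c(3) t p_gt by (simp add: b_def)
    \<comment> \<open>The bound on \<open>n\<close> excludes a carry: neither \<open>t\<close> nor
      \<open>t + 1\<close> reaches \<open>p\<close>.\<close>
    have tp: "t + 1 < p" using sz n p3 by linarith
    show "c \<in> ?f ` ?A \<union> ?g ` ?B"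
    proof (cases "even (count b 0)")
      case True
      obtain q where q: "cell_wt p b = p * q" using cell_wt_even[OF True] by blast
      have "t0 = t" "d' = q" using d q tp by (simp_all add: t0_def d'_def)
      moreover have "b \<in> even_cells p (n - 2 * t) q" using True q sz by (simp add: even_cells_def)
      ultimately show ?thesis using sz cb by auto
    next
      case False
      define a where "a = b - {#0#}"
      note o = odd_count_remove[OF False, folded a_def]
      obtain q where q: "cell_wt p a = p * q" using cell_wt_even[OF o(1)] by blast
      have "d = p * q + (t + 1)" using d o(2) q by simp
      hence "t0 = t + 1" "d' = q" using tp by (simp_all add: t0_def d'_def del: add_Suc_right)
      moreover have "n = 2 * t + 1 + size a" using sz o(3) by simp
      moreover have "a \<in> even_cells p (size a) q" using o(1) q by (simp add: even_cells_def)
      moreover have "c = replicate_mset (2 * t) 0 + image_mset Suc (add_mset 0 a)"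
        using cb o(4) by simp
      ultimately show ?thesis by auto
    qed
  qed
  hence "card (even_cells p n d) \<le> card (?f ` ?A \<union> ?g ` ?B)"
    by (intro card_mono) (auto simp: finite_even_cells)
  also have "\<dots> \<le> card (?f ` ?A) + card (?g ` ?B)" by (rule card_Un_le)
  also have "\<dots> \<le> card ?A + card ?B"
    by (intro add_mono card_image_le) (auto simp: finite_even_cells)
  finally show ?thesis by (simp split: if_splits)
qed

lemma even_cells_0_subset: "even_cells p 0 d \<subseteq> (if d = 0 then {{#}} else {})"
  using p_gt by (auto simp: even_cells_def)

lemma card_even_cells_0: "card (even_cells p 0 d) \<le> (if d = 0 then 1 else 0)"
  using card_mono[OF _ even_cells_0_subset[of d]] by (auto split: if_splits)

lemma even_cells_n_0:
  assumes "n \<ge> 1"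
  shows "even_cells p n 0 = {}"
proof -
  have "cell_wt p c \<noteq> 0" if "size c = n" for c
    using cell_wt_pos[OF p_gt(1), of c] that assms by (cases "c = {#}") auto
  thus ?thesis by (simp add: even_cells_def)
qed

text \<open>A last digit 0 shortens \<open>d\<close> and keeps \<open>n\<close>. Any other last
  digit leads to two consecutive sizes \<open>m - 1\<close> and \<open>m\<close> with
  \<open>m < n\<close>, whose bounds add up to the next Fibonacci number. Hence an outer induction
  on \<open>n\<close> and an inner one on \<open>d\<close>.\<close>

lemma card_even_cells_le_fib:
  assumes "1 \<le> n" and "n \<le> 2 * p - 3"
  shows "card (even_cells p n d) \<le> fib n"
  using assms
proof (induction n arbitrary: d rule: less_induct)
  case (less n)
  note IHn = less.IH and n = less.prems
  \<comment> \<open>For \<open>m = 1\<close> the size 0 lies outside the induction hypothesis, but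
    there only \<open>e = 0\<close> contributes, and then size 1 contributes nothing.\<close>
  have pair: "card (even_cells p (m - 1) e) + card (even_cells p m e) \<le> fib (m + 1)"
    if "1 \<le> m" "m < n" for m e
  proof (cases "m = 1")
    case True
    have "card (even_cells p 1 e) \<le> 1" using IHn[of 1 e] that n True by simp
    thus ?thesis using card_even_cells_0[of e] even_cells_n_0[of 1] True by (cases "e = 0") auto
  next
    case False
    define l where "l = m - 2"
    have l: "m = Suc (Suc l)" using that False by (simp add: l_def)
    show ?thesis using IHn[of "Suc l" e] IHn[of m e] that n by (simp add: l)
  qed
  show ?case
  proof (induction d rule: less_induct)
    case (less d)
    show ?case
    proof (cases "d = 0")
      case True
      thus ?thesis using even_cells_n_0 n by simp
    next
      case d0: False
      define t0 where "t0 = d mod p"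
      note rec = card_even_cells_rec[OF n(2), of d, folded t0_def]
      show ?thesis
      proof (cases "t0 = 0")
        case True
        have "card (even_cells p n (d div p)) \<le> fib n"
          using less.IH[of "d div p"] d0 p_gt by simp
        thus ?thesis using rec True by simp
      next
        case False
        show ?thesis
        proof (cases "2 * t0 \<le> n + 1")
          case True
          define m where "m = n + 1 - 2 * t0"
          have m: "m < n" using False True n by (simp add: m_def)
          show ?thesis
          proof (cases "m = 0")
            case True
            \<comment> \<open>Here \<open>2 * t0 = n + 1\<close>, so the first summand of the
              recursion is absent and only the empty cell can remain.\<close>
            have "card (even_cells p 0 (d div p)) \<le> 1" using card_even_cells_0[of "d div p"] by (simp split: if_splits)
            moreover have "fib n \<ge> 1" using n fib_neq_0_nat[of n] by simp
            ultimately show ?thesis using rec True \<open>2 * t0 \<le> n + 1\<close> by (simp add: m_def split: if_splits)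
          next
            case False
            have "n - 2 * t0 = m - 1" "2 * t0 \<le> n" using False by (simp_all add: m_def)
            hence "card (even_cells p n d) \<le> card (even_cells p (m - 1) (d div p)) + card (even_cells p m (d div p))"
              using rec \<open>t0 \<noteq> 0\<close> by (simp add: m_def)
            also have "\<dots> \<le> fib (m + 1)" using pair m False by simp
            also have "\<dots> \<le> fib n" using m by (intro fib_mono) simp
            finally show ?thesis .
          qed
        next
          case False
          hence "\<not> 2 * t0 \<le> n" by simp
          with False rec have "card (even_cells p n d) = 0" by simp
          thus ?thesis by simp
        qed
      qed
    qed
  qed
qed

text \<open>The addition rule of the induction for the full range of \<open>n\<close>; it is the
  source of the term \<open>fib (n + 1)\<close> in the final bound.\<close>

lemma card_even_cells_pair:
  assumes "1 \<le> n" and "n \<le> 2 * p - 3"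
  shows "card (even_cells p (n - 1) d) + card (even_cells p n d) \<le> fib (n + 1)"
proof (cases "n = 1")
  case True
  have "card (even_cells p 1 d) \<le> 1" using card_even_cells_le_fib[of 1 d] assms True by simp
  thus ?thesis using card_even_cells_0[of d] even_cells_n_0[of 1] True by (cases "d = 0") auto
next
  case False
  define l where "l = n - 2"
  have l: "n = Suc (Suc l)" using assms False by (simp add: l_def)
  show ?thesis using card_even_cells_le_fib[of "Suc l" d] card_even_cells_le_fib[of n d] assms by (simp add: l)
qed

lemma card_even_cells_pred_le_fib:
  assumes "1 \<le> n" and "n \<le> 2 * p - 3"
  shows "card (even_cells p (n - 1) d) \<le> fib n"
proof (cases "n = 1")
  case True
  thus ?thesis using card_even_cells_0[of d] by (simp split: if_splits)
next
  case False
  thus ?thesis using card_even_cells_le_fib[of "n - 1" d] assms fib_mono[of "n - 1" n] by linarith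
qed

text \<open>By the recursion a last digit \<open>p - 1\<close> requires
  \<open>2 * (p - 1) \<le> n + 1\<close>, hence at least \<open>2 * p - 3\<close> elements.\<close>

lemma card_even_cells_top_digit:
  assumes "d mod p = p - 1" and "n \<le> 2 * p - 4"
  shows "card (even_cells p n d) = 0"
proof -
  have "n \<le> 2 * p - 3" "\<not> 2 * (d mod p) \<le> n" "\<not> 2 * (d mod p) \<le> n + 1"
    using assms p3 by linarith+
  thus ?thesis using card_even_cells_rec[of n d] by simp
qed

lemma shift_decomp:
  fixes c :: "nat multiset"
  assumes "\<And>i. i \<in># c \<Longrightarrow> s \<le> i"
  obtains b where "c = image_mset (\<lambda>i. i + s) b" and "size b = size c"
    and "count b 0 = count c s" and "cell_wt p c = p ^ s * cell_wt p b"
proof -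
  define b where "b = image_mset (\<lambda>i. i - s) c"
  have "image_mset (\<lambda>i. i + s) b = image_mset (\<lambda>i. i) c"
    unfolding b_def image_mset.compositionality by (rule image_mset_cong) (use assms in auto)
  hence c: "c = image_mset (\<lambda>i. i + s) b" by simp
  have "count b 0 = count c s" using count_image_mset_shift[of s b 0] c by simp
  moreover have "cell_wt p c = p ^ s * cell_wt p b" using cell_wt_shift[OF p_gt(2), of s b] c by simp
  ultimately show ?thesis using that[OF c] by (simp add: b_def)
qed

text \<open>The inequalities place \<open>g\<close> in an interval of length \<open>p ^ s\<close>
  starting at the weight of the cell, so the shifted cell has weight exactly
  \<open>g div p ^ s\<close>.\<close>

lemma card_low_cells:
  "card {c. size c = n \<and> cell_wt p c \<le> g \<and> (\<forall>i\<in>#c. s \<le> i) \<and> even (count c s) \<and> g < cell_wt p c + p ^ s}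
     \<le> (if p dvd g div p ^ s then card (even_cells p n (g div p ^ s div p)) else 0)"
  (is "card ?L \<le> _")
proof -
  let ?E = "if p dvd g div p ^ s then even_cells p n (g div p ^ s div p) else {}"
  have "?L \<subseteq> image_mset (\<lambda>i. i + s) ` ?E"
  proof
    fix c assume c: "c \<in> ?L"
    then obtain b where b: "c = image_mset (\<lambda>i. i + s) b" "size b = size c"
      "count b 0 = count c s" "cell_wt p c = p ^ s * cell_wt p b"
      using shift_decomp[of c s] by auto
    have "p ^ s * cell_wt p b \<le> g" "g < p ^ s * Suc (cell_wt p b)" using c b(4) by simp_all
    hence g: "g div p ^ s = cell_wt p b" by (intro div_nat_eqI) (simp_all add: mult.commute)
    have ev: "even (count b 0)" using c b(3) by simp
    have "cell_wt p b = p * (count b 0 div 2 + cell_wt p (lower b))" by (rule cell_wt_even[OF ev])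
    hence "p dvd cell_wt p b" by simp
    hence "b \<in> ?E" using g ev b(2) c by (auto simp: even_cells_def)
    thus "c \<in> image_mset (\<lambda>i. i + s) ` ?E" using b(1) by blast
  qed
  hence "card ?L \<le> card (image_mset (\<lambda>i. i + s) ` ?E)" by (intro card_mono) (auto simp: finite_even_cells)
  also have "\<dots> \<le> card ?E" by (intro card_image_le) (auto simp: finite_even_cells)
  finally show ?thesis by (simp split: if_splits)
qed

text \<open>One copy of \<open>s\<close> is removed to restore evenness. The step
  \<open>p ^ s\<close> it has used and the missing step \<open>(p - 1) * p ^ s\<close> make up a
  whole block, so \<open>g\<close> lies in an interval of length \<open>p ^ Suc s\<close>.\<close>

lemma card_top_cells:
  "card {c. size c = n \<and> cell_wt p c \<le> g \<and> s \<in># c \<and> (\<forall>i\<in>#c. s \<le> i) \<and> odd (count c s) \<and>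
       g < cell_wt p c + (p - 1) * p ^ s}
     \<le> (if n = 0 then 0 else card (even_cells p (n - 1) (g div p ^ Suc s)))"
  (is "card ?L \<le> _")
proof -
  let ?E = "if n = 0 then {} else even_cells p (n - 1) (g div p ^ Suc s)"
  have "?L \<subseteq> (\<lambda>c. image_mset (\<lambda>i. i + s) (add_mset 0 c)) ` ?E"
  proof
    fix c assume c: "c \<in> ?L"
    then obtain b where b: "c = image_mset (\<lambda>i. i + s) b" "size b = size c"
      "count b 0 = count c s" "cell_wt p c = p ^ s * cell_wt p b"
      using shift_decomp[of c s] by auto
    have "odd (count b 0)" using c b(3) by simp
    note o = odd_count_remove[OF this]
    define a where "a = b - {#0#}"
    have "cell_wt p a = p * (count a 0 div 2 + cell_wt p (lower a))"
      using o(1) unfolding a_def by (rule cell_wt_even)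
    then obtain q where q: "cell_wt p a = p * q" by blast
    have "p ^ s * Suc (p * q) \<le> g" "g < p ^ s * (Suc (p * q) + (p - 1))"
      using c b(4) o(2) q by (simp_all add: a_def algebra_simps)
    moreover have "Suc (p * q) + (p - 1) = p * Suc q" using p_gt by simp
    ultimately have "p ^ Suc s * q \<le> g" "g < p ^ Suc s * Suc q" by (simp_all add: algebra_simps)
    hence "g div p ^ Suc s = q" by (intro div_nat_eqI) (simp_all add: mult.commute)
    hence "a \<in> ?E" using c b(2) o(1,3) q by (auto simp: even_cells_def a_def)
    moreover have "c = image_mset (\<lambda>i. i + s) (add_mset 0 a)" using b(1) o(4) by (simp add: a_def)
    ultimately show "c \<in> (\<lambda>c. image_mset (\<lambda>i. i + s) (add_mset 0 c)) ` ?E" by blast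
  qed
  hence "card ?L \<le> card ((\<lambda>c. image_mset (\<lambda>i. i + s) (add_mset 0 c)) ` ?E)"
    by (intro card_mono) (auto simp: finite_even_cells)
  also have "\<dots> \<le> card ?E" by (intro card_image_le) (auto simp: finite_even_cells)
  finally show ?thesis by (simp split: if_splits)
qed

end

section \<open>The critical cells and their number\<close>

definition low_critical :: "nat \<Rightarrow> nat \<Rightarrow> nat \<Rightarrow> nat multiset \<Rightarrow> bool" where
  "low_critical p g s c \<longleftrightarrow> (\<forall>i\<in>#c. s \<le> i) \<and> even (count c s) \<and> g < cell_wt p c + p ^ s"

text \<open>Here and in \<open>low_critical\<close> the inequality says that the partner in the
  matching would have weight above \<open>g\<close>, where the Weyl module has no vectors
  left.\<close>

definition top_critical :: "nat \<Rightarrow> nat \<Rightarrow> nat \<Rightarrow> nat multiset \<Rightarrow> bool" where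
  "top_critical p g s c \<longleftrightarrow>
     s \<in># c \<and> (\<forall>i\<in>#c. s \<le> i) \<and> odd (count c s) \<and> g < cell_wt p c + (p - 1) * p ^ s"

definition critical_cells :: "nat \<Rightarrow> nat \<Rightarrow> nat \<Rightarrow> nat \<Rightarrow> nat multiset set" where
  "critical_cells p \<sigma> g n =
     {c. size c = n \<and> cell_wt p c \<le> g \<and> (low_critical p g \<sigma> c \<or> (\<exists>s<\<sigma>. top_critical p g s c))}"

text \<open>The low cells and the top cells of level \<open>\<sigma> - 1\<close> share the bound
  \<open>fib (n + 1)\<close>. Every other level costs at most \<open>fib n\<close>, and those from
  \<open>r - 1\<close> on are empty.\<close>

lemma card_critical_cells:
  assumes p3: "p \<ge> 3" and n: "n \<le> 2 * p - 3" and r: "r \<ge> 1" and m: "m < p ^ r"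
    and dvd: "p ^ \<sigma> dvd Suc (m + g)"
  shows "card (critical_cells p \<sigma> g n) \<le> fib (n + 1) + (r - 1) * fib n"
proof -
  let ?A = "\<lambda>n d. card (even_cells p n d)"
  define L where "L = {c. size c = n \<and> cell_wt p c \<le> g \<and> low_critical p g \<sigma> c}"
  define T where "T s = {c. size c = n \<and> cell_wt p c \<le> g \<and> top_critical p g s c}" for s
  have p1: "p > 1" "p > 0" using p3 by auto
  have fin: "finite (T s)" for s
    by (rule finite_subset[OF _ finite_cells[OF p1(1), of n g]]) (auto simp: T_def)
  have L: "card L \<le> (if p dvd g div p ^ \<sigma> then ?A n (g div p ^ \<sigma> div p) else 0)"
    using card_low_cells[OF p3, of n g \<sigma>] by (simp add: L_def low_critical_def)
  have T: "card (T s) \<le> (if n = 0 then 0 else ?A (n - 1) (g div p ^ Suc s))" for s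
    using card_top_cells[OF p3, of n g s] by (simp add: T_def top_critical_def)
  have "critical_cells p \<sigma> g n = L \<union> (\<Union>s\<in>{..<\<sigma>}. T s)"
    by (auto simp: critical_cells_def L_def T_def)
  hence "card (critical_cells p \<sigma> g n) \<le> card L + card (\<Union>s\<in>{..<\<sigma>}. T s)"
    by (simp add: card_Un_le)
  also have "card (\<Union>s\<in>{..<\<sigma>}. T s) \<le> (\<Sum>s<\<sigma>. card (T s))" by (rule card_UN_le) simp
  finally have total: "card (critical_cells p \<sigma> g n) \<le> card L + (\<Sum>s<\<sigma>. card (T s))" by simp
  show ?thesis
  proof (cases "n = 0")
    case True
    have "card L \<le> 1" using L card_even_cells_0[OF p3, of "g div p ^ \<sigma> div p"] True by (auto split: if_splits)
    moreover have "(\<Sum>s<\<sigma>. card (T s)) = 0" using T True by simp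
    ultimately show ?thesis using total True by simp
  next
    case False
    hence n1: "1 \<le> n" by simp
    have Tfib: "card (T s) \<le> fib n" for s
      using T[of s] card_even_cells_pred_le_fib[OF p3 n1 n, of "g div p ^ Suc s"] False by simp
    show ?thesis
    proof (cases \<sigma>)
      case 0
      have "card L \<le> fib n" using L card_even_cells_le_fib[OF p3 n1 n] by (auto split: if_splits intro: order_trans)
      also have "\<dots> \<le> fib (n + 1)" by (intro fib_mono) simp
      finally show ?thesis using total 0 by simp
    next
      case (Suc \<tau>)
      define G where "G = g div p ^ \<sigma>"
      \<comment> \<open>Low cells exist only if \<open>G\<close> ends in the digit 0. In that case
        the recursion drops this digit for the top cells too, so both kinds are counted with the
        same \<open>q\<close>, in sizes \<open>n\<close> and \<open>n - 1\<close>.\<close>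
      have last: "card L + card (T \<tau>) \<le> fib (n + 1)"
      proof (cases "p dvd G")
        case True
        then obtain q where q: "G = p * q" by blast
        have "card (T \<tau>) \<le> ?A (n - 1) G" using T[of \<tau>] False Suc by (simp add: G_def)
        also have "\<dots> \<le> ?A (n - 1) q"
          using card_even_cells_rec[OF p3, of "n - 1" G] n p1 by (simp add: q)
        finally have "card (T \<tau>) \<le> ?A (n - 1) q" .
        moreover have "card L \<le> ?A n q" using L True p1 by (simp add: G_def[symmetric] q)
        ultimately show ?thesis using card_even_cells_pair[OF p3 n1 n, of q] by linarith
      next
        case False
        hence "card L = 0" using L by (simp add: G_def)
        moreover have "fib n \<le> fib (n + 1)" by (intro fib_mono) simp
        ultimately show ?thesis using Tfib[of \<tau>] by simp
      qed
      \<comment> \<open>Subtracting \<open>Suc m\<close>, which is at most \<open>p ^ j\<close>,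
        from a multiple of \<open>p ^ Suc j\<close> leaves the digit \<open>p - 1\<close> at
        position \<open>j\<close>. As \<open>n - 1\<close> is at most \<open>2 * p - 4\<close>, no
        cell produces this digit.\<close>
      have vanish: "card (T s) = 0" if s: "r \<le> Suc s" "s < \<tau>" for s
      proof -
        define j where "j = Suc s"
        have "m < p ^ j" using m power_increasing[of r j p] s p1 by (simp add: j_def)
        have "p ^ Suc j dvd p ^ \<sigma>" using s Suc by (intro le_imp_power_dvd) (simp add: j_def)
        hence "p ^ Suc j dvd Suc (m + g)" using dvd dvd_trans by blast
        then obtain K where "Suc (m + g) = p ^ Suc j * K" by (rule dvdE)
        hence K: "Suc (m + g) = p ^ j * (p * K)" by (simp add: mult_ac)
        hence "K \<noteq> 0" by (cases K) auto
        then obtain K' where K': "p * K = Suc K'" using p1 by (cases "p * K") auto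
        have "g + Suc m = p ^ j * K' + p ^ j" using K K' by simp
        hence "p ^ j * K' \<le> g" "g < p ^ j * Suc K'" using \<open>m < p ^ j\<close> by auto
        hence "g div p ^ j = K'" by (intro div_nat_eqI) (simp_all add: mult.commute)
        moreover have "K' mod p = p - 1"
        proof -
          obtain K'' where "K = Suc K''" using \<open>K \<noteq> 0\<close> by (cases K) auto
          hence "K' = p * K'' + (p - 1)" using K' p1 by simp
          hence "K' mod p = (p - 1) mod p" by (simp only: mod_mult_self4)
          thus ?thesis using p1 by simp
        qed
        ultimately have "?A (n - 1) (g div p ^ j) = 0"
          using n by (intro card_even_cells_top_digit[OF p3]) auto
        thus ?thesis using T[of s] by (simp add: j_def split: if_splits)
      qed
      have "(\<Sum>s<\<tau>. card (T s)) \<le> (\<Sum>s<\<tau>. if s < r - 1 then fib n else 0)"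
        by (rule sum_mono) (use vanish Tfib in auto)
      also have "\<dots> = (\<Sum>s\<in>{..<\<tau>} \<inter> {..<r - 1}. fib n)"
        by (subst sum.inter_restrict) auto
      also have "\<dots> = card ({..<\<tau>} \<inter> {..<r - 1}) * fib n" by simp
      also have "\<dots> \<le> (r - 1) * fib n"
        by (intro mult_right_mono) (use card_mono[of "{..<r - 1}" "{..<\<tau>} \<inter> {..<r - 1}"] in auto)
      finally show ?thesis using total last Suc by simp
    qed
  qed
qed

section \<open>The cochain complex of the hyperalgebra of the unipotent radical\<close>

text \<open>
  \<open>W y\<close> are the weight spaces and \<open>E t\<close> is the \<open>t\<close>-th divided power of the positive root vector.
\<close>

locale graded_module = vector_space scale
  for scale :: "'k::field \<Rightarrow> 'v::ab_group_add \<Rightarrow> 'v" (infixr "*s" 75) +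
  fixes W :: "int \<Rightarrow> 'v set" and E :: "nat \<Rightarrow> 'v \<Rightarrow> 'v" and p :: nat
  assumes prime_p: "prime p" and odd_p: "odd p" and CHAR_p: "CHAR('k) = p"
    and W_subspace: "subspace (W y)"
    and E_add: "v \<in> W y \<Longrightarrow> w \<in> W y \<Longrightarrow> E t (v + w) = E t v + E t w"
    and E_scale: "v \<in> W y \<Longrightarrow> E t (c *s v) = c *s E t v"
    and E_W: "v \<in> W y \<Longrightarrow> E t v \<in> W (y + 2 * int t)"
    and E_0: "v \<in> W y \<Longrightarrow> E 0 v = v"
    and E_E: "v \<in> W y \<Longrightarrow> E s (E t v) = of_nat ((s + t) choose s) *s E (s + t) v"
    and E_nilpotent: "v \<in> W y \<Longrightarrow> \<exists>T. \<forall>t\<ge>T. E t v = 0"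
begin

lemma p_ge_3: "p \<ge> 3"
  using prime_p odd_p prime_ge_2_nat[of p] by (cases "p = 2") auto

lemma p_gt_1: "p > 1" and p_pos: "p > 0"
  using p_ge_3 by auto

lemmas W_zero = subspace_0[OF W_subspace]
  and W_add = subspace_add[OF W_subspace]
  and W_scale = subspace_scale[OF W_subspace]
  and W_sum = subspace_sum[OF W_subspace]
  and W_diff = subspace_diff[OF W_subspace]
  and W_neg = subspace_neg[OF W_subspace]

lemma E_zero [simp]: "E t 0 = 0"
  using E_scale[OF W_zero, where t = t and c = 0] by simp

lemma E_sum: "finite A \<Longrightarrow> (\<And>i. i \<in> A \<Longrightarrow> f i \<in> W y) \<Longrightarrow> E t (sum f A) = (\<Sum>i\<in>A. E t (f i))"
proof (induction A rule: finite_induct)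
  case (insert i A)
  have "sum f A \<in> W y" using insert.prems by (intro W_sum) simp
  thus ?case using insert E_add[of "f i" y "sum f A" t] by simp
qed simp

lemma E_diff: "v \<in> W y \<Longrightarrow> w \<in> W y \<Longrightarrow> E t (v - w) = E t v - E t w"
  using E_add[of v y "- w"] E_scale[of w y t "- 1"] W_neg[of w y] by simp

lemma E_commute: "v \<in> W y \<Longrightarrow> E s (E t v) = E t (E s v)"
  using binomial_symmetric[of s "s + t"] by (simp add: E_E add.commute)

text \<open>Two consecutive steps add up to \<open>p * p ^ s\<close>, whose digit at
  \<open>s\<close> is 0. This is the relation X^p = 0.\<close>

lemma of_nat_choose_step_eq_0: "(of_nat (step_wt p s k + step_wt p s (Suc k) choose step_wt p s k) :: 'k) = 0"
proof -
  have eq: "step_wt p s k + step_wt p s (Suc k) = p * p ^ s"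
  proof -
    have "p * p ^ s = p ^ s + (p - 1) * p ^ s" using p_pos by (simp flip: mult_Suc)
    thus ?thesis by (simp add: step_wt_def)
  qed
  have "p * p ^ s div p ^ s mod p = 0" using p_pos by simp
  thus ?thesis
    using of_nat_choose_digit_eq_0_iff[OF prime_p CHAR_p, of 1 "p * p ^ s" s]
      of_nat_choose_digit_eq_0_iff[OF prime_p CHAR_p, of "p - 1" "p * p ^ s" s] p_gt_1
    unfolding eq by (simp add: step_wt_def)
qed

lemma E_step_E_step:
  assumes "v \<in> W y"
  shows "E (step_wt p s (Suc k)) (E (step_wt p s k) v) = 0"
  by (subst E_commute[OF assms]) (simp add: E_E[OF assms] of_nat_choose_step_eq_0)

text \<open>The Koszul sign of a tensor product of complexes: the parity of the total degree in the
  factors before \<open>s\<close>.\<close>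

definition dsign :: "nat \<Rightarrow> nat multiset \<Rightarrow> 'k" where
  "dsign s c = (- 1) ^ size (filter_mset (\<lambda>i. i < s) c)"

text \<open>The shift by \<open>cell_wt\<close> makes the differential preserve the weight
  \<open>x\<close>. Finite support ensures that a single cochain involves only finitely many tensor
  factors.\<close>

definition cochains :: "int \<Rightarrow> nat \<Rightarrow> (nat multiset \<Rightarrow> 'v) set" where
  "cochains x n = {\<phi>. finite {c. \<phi> c \<noteq> 0} \<and> (\<forall>c. \<phi> c \<in> W (x + 2 * int (cell_wt p c))) \<and>
     (\<forall>c. size c \<noteq> n \<longrightarrow> \<phi> c = 0)}"

definition diff :: "(nat multiset \<Rightarrow> 'v) \<Rightarrow> nat multiset \<Rightarrow> 'v" where
  "diff \<phi> c = (\<Sum>s\<in>set_mset c. dsign s c *s E (step_wt p s (count c s)) (\<phi> (c - {#s#})))"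

definition cocycles :: "int \<Rightarrow> nat \<Rightarrow> (nat multiset \<Rightarrow> 'v) set" where
  "cocycles x n = {\<phi> \<in> cochains x n. diff \<phi> = (\<lambda>_. 0)}"

definition coboundaries :: "int \<Rightarrow> nat \<Rightarrow> (nat multiset \<Rightarrow> 'v) set" where
  "coboundaries x n = (case n of 0 \<Rightarrow> {\<lambda>_. 0} | Suc m \<Rightarrow> diff ` cochains x m)"

lemma cochainsD:
  assumes "\<phi> \<in> cochains x n"
  shows "finite {c. \<phi> c \<noteq> 0}" and "\<phi> c \<in> W (x + 2 * int (cell_wt p c))" and "size c \<noteq> n \<Longrightarrow> \<phi> c = 0"
  using assms by (auto simp: cochains_def)

lemma face_W:
  assumes "\<phi> \<in> cochains x n" and "s \<in># c"
  shows "E (step_wt p s (count c s)) (\<phi> (c - {#s#})) \<in> W (x + 2 * int (cell_wt p c))"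
  using E_W[OF cochainsD(2)[OF assms(1), of "c - {#s#}"], of "step_wt p s (count c s)"]
  by (simp add: cell_wt_remove[OF p_pos assms(2)] algebra_simps)

lemma zero_cochain [simp]: "(\<lambda>_. 0) \<in> cochains x n"
  by (simp add: cochains_def W_zero)

lemma add_cochain:
  assumes "\<phi> \<in> cochains x n" and "\<psi> \<in> cochains x n"
  shows "(\<lambda>c. \<phi> c + \<psi> c) \<in> cochains x n"
proof -
  have "finite {c. \<phi> c + \<psi> c \<noteq> 0}"
    by (rule finite_subset[of _ "{c. \<phi> c \<noteq> 0} \<union> {c. \<psi> c \<noteq> 0}"]) (use assms in \<open>auto simp: cochains_def\<close>)
  thus ?thesis using assms by (simp add: cochains_def W_add)
qed

lemma scale_cochain:
  assumes "\<phi> \<in> cochains x n"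
  shows "(\<lambda>c. a *s \<phi> c) \<in> cochains x n"
proof -
  have "finite {c. a *s \<phi> c \<noteq> 0}"
    by (rule finite_subset[of _ "{c. \<phi> c \<noteq> 0}"]) (use assms in \<open>auto simp: cochains_def\<close>)
  thus ?thesis using assms by (simp add: cochains_def W_scale)
qed

lemma diff_cochain:
  assumes "\<phi> \<in> cochains x n" and "\<psi> \<in> cochains x n"
  shows "(\<lambda>c. \<phi> c - \<psi> c) \<in> cochains x n"
  using add_cochain[OF assms(1) scale_cochain[OF assms(2), of "- 1"]] by simp

lemma sum_cochain:
  "finite A \<Longrightarrow> (\<And>i. i \<in> A \<Longrightarrow> f i \<in> cochains x n) \<Longrightarrow> (\<lambda>c. \<Sum>i\<in>A. f i c) \<in> cochains x n"
proof (induction A rule: finite_induct)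
  case (insert i A)
  have "(\<lambda>c. f i c + (\<Sum>i\<in>A. f i c)) \<in> cochains x n"
    by (rule add_cochain) (use insert in auto)
  thus ?case using insert.hyps by simp
qed simp

lemma diff_zero [simp]: "diff (\<lambda>_. 0) = (\<lambda>_. 0)"
  by (simp add: diff_def fun_eq_iff)

lemma diff_add:
  assumes "\<phi> \<in> cochains x n" and "\<psi> \<in> cochains x n"
  shows "diff (\<lambda>c. \<phi> c + \<psi> c) c = diff \<phi> c + diff \<psi> c"
  unfolding diff_def
  by (subst E_add[OF cochainsD(2)[OF assms(1)] cochainsD(2)[OF assms(2)]])
    (simp add: scale_right_distrib sum.distrib)

lemma diff_scale:
  assumes "\<phi> \<in> cochains x n"
  shows "diff (\<lambda>c. a *s \<phi> c) c = a *s diff \<phi> c"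
  unfolding diff_def
  by (subst E_scale[OF cochainsD(2)[OF assms(1)]]) (simp add: scale_sum_right mult.commute)

lemma diff_diff_cochain:
  assumes "\<phi> \<in> cochains x n" and "\<psi> \<in> cochains x n"
  shows "diff (\<lambda>c. \<phi> c - \<psi> c) c = diff \<phi> c - diff \<psi> c"
  using diff_add[OF assms(1) scale_cochain[OF assms(2), of "- 1"]] diff_scale[OF assms(2), of "- 1"] by simp

lemma diff_sum:
  "finite A \<Longrightarrow> (\<And>i. i \<in> A \<Longrightarrow> f i \<in> cochains x n) \<Longrightarrow> diff (\<lambda>c. \<Sum>i\<in>A. f i c) c = (\<Sum>i\<in>A. diff (f i) c)"
proof (induction A rule: finite_induct)
  case (insert i A)
  have "(\<lambda>c. \<Sum>i\<in>A. f i c) \<in> cochains x n" by (rule sum_cochain) (use insert in auto)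
  hence "diff (\<lambda>c. f i c + (\<Sum>i\<in>A. f i c)) c = diff (f i) c + diff (\<lambda>c. \<Sum>i\<in>A. f i c) c"
    by (intro diff_add) (use insert in auto)
  thus ?case using insert by simp
qed simp

text \<open>Only finiteness of the support is at stake. Each of the finitely many values is killed
  by \<open>E t\<close> for large \<open>t\<close>, and a step at index \<open>s\<close> has weight
  above \<open>s\<close>, so large indices add nothing.\<close>

lemma diff_in_cochains:
  assumes \<phi>: "\<phi> \<in> cochains x n"
  shows "diff \<phi> \<in> cochains x (Suc n)"
proof -
  have "\<exists>T. \<forall>b. \<forall>s\<ge>T. \<forall>k. E (step_wt p s k) (\<phi> b) = 0"
  proof -
    define t where "t b = (SOME T. \<forall>t\<ge>T. E t (\<phi> b) = 0)" for b
    have t: "E j (\<phi> b) = 0" if "j \<ge> t b" for j b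
      using someI_ex[OF E_nilpotent[OF cochainsD(2)[OF \<phi>, of b]]] that by (simp add: t_def)
    define T where "T = (\<Sum>b\<in>{c. \<phi> c \<noteq> 0}. t b)"
    have "E (step_wt p s k) (\<phi> b) = 0" if "s \<ge> T" for b s k
    proof (cases "\<phi> b = 0")
      case False
      hence "t b \<le> T"
        using cochainsD(1)[OF \<phi>] member_le_sum[of b "{c. \<phi> c \<noteq> 0}" t] by (simp add: T_def)
      also have "\<dots> \<le> s" by fact
      also have "s < p ^ s" using p_gt_1 by (intro power_gt_expt) simp
      also have "p ^ s \<le> step_wt p s k"
      proof -
        have "1 \<le> p - 1" using p_ge_3 by linarith
        thus ?thesis using mult_right_mono[of 1 "p - 1" "p ^ s"] by (simp add: step_wt_def)
      qed
      finally show ?thesis using t by simp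
    qed simp
    thus ?thesis by blast
  qed
  then obtain T where T: "\<And>b s k. s \<ge> T \<Longrightarrow> E (step_wt p s k) (\<phi> b) = 0" by blast
  have "{c. diff \<phi> c \<noteq> 0} \<subseteq> (\<lambda>(s, b). add_mset s b) ` ({..<T} \<times> {c. \<phi> c \<noteq> 0})"
  proof
    fix c assume "c \<in> {c. diff \<phi> c \<noteq> 0}"
    then obtain s where s: "s \<in># c" "E (step_wt p s (count c s)) (\<phi> (c - {#s#})) \<noteq> 0"
      unfolding diff_def by (metis (mono_tags, lifting) mem_Collect_eq scale_zero_right sum.neutral)
    have "s < T" using T s(2) by (metis not_le)
    moreover have "\<phi> (c - {#s#}) \<noteq> 0" using s(2) by auto
    moreover have "c = add_mset s (c - {#s#})" using s(1) by simp
    ultimately show "c \<in> (\<lambda>(s, b). add_mset s b) ` ({..<T} \<times> {c. \<phi> c \<noteq> 0})" by (intro image_eqI[of _ _ "(s, c - {#s#})"]) auto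
  qed
  hence "finite {c. diff \<phi> c \<noteq> 0}"
    by (rule finite_subset) (intro finite_imageI finite_SigmaI, use cochainsD(1)[OF \<phi>] in auto)
  moreover have "diff \<phi> c \<in> W (x + 2 * int (cell_wt p c))" for c
    unfolding diff_def by (intro W_sum W_scale face_W[OF \<phi>])
  moreover have "diff \<phi> c = 0" if "size c \<noteq> Suc n" for c
    unfolding diff_def
  proof (rule sum.neutral, rule ballI)
    fix s assume s: "s \<in># c"
    hence "size (c - {#s#}) \<noteq> n" using that by (metis insert_DiffM size_add_mset)
    thus "dsign s c *s E (step_wt p s (count c s)) (\<phi> (c - {#s#})) = 0" using cochainsD(3)[OF \<phi>] by simp
  qed
  ultimately show ?thesis by (simp add: cochains_def)
qed

text \<open>Removing the smaller of the two indices flips the sign attached to the larger one;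
  removing the larger changes nothing.\<close>

lemma dsign_anticommute:
  assumes "s \<in># c" and "t \<in># c" and "s \<noteq> t"
  shows "dsign s c * dsign t (c - {#s#}) = - (dsign t c * dsign s (c - {#t#}))"
proof -
  have *: "dsign t c = (if i < t then - 1 else 1) * dsign t (c - {#i#})" if "i \<in># c" for i t
  proof -
    obtain b where "c = add_mset i b" using \<open>i \<in># c\<close> by (blast dest: multi_member_split)
    thus ?thesis by (simp add: dsign_def)
  qed
  show ?thesis
  proof (cases "s < t")
    case True
    thus ?thesis using *[OF assms(1), of t] *[OF assms(2), of s] by simp
  next
    case False
    hence "t < s" using assms(3) by simp
    thus ?thesis using *[OF assms(1), of t] *[OF assms(2), of s] by simp
  qed
qed

lemma dsign_sq [simp]: "dsign s c * dsign s c = 1"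
  by (simp add: dsign_def flip: power_add)

lemma dsign_ne_0 [simp]: "dsign s c \<noteq> 0"
  by (simp add: dsign_def)

text \<open>With 2 invertible, an antisymmetric double sum vanishes without any ordering of the
  index pairs.\<close>

lemma double_eq_0: "(v::'v) + v = 0 \<Longrightarrow> v = 0"
proof -
  assume "v + v = 0"
  hence "(1 + 1 :: 'k) *s v = 0" by (simp only: scale_left_distrib scale_one)
  moreover have "(1 + 1 :: 'k) \<noteq> 0"
  proof
    assume "(1 + 1 :: 'k) = 0"
    hence "(of_nat 2 :: 'k) = 0" by simp
    hence "p dvd 2" using CHAR_p of_nat_eq_0_iff_char_dvd by blast
    thus False using p_ge_3 by (auto dest: dvd_imp_le)
  qed
  ultimately show ?thesis using scale_eq_0_iff by blast
qed

text \<open>Removing two different indices in either order gives opposite signs and commuting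
  operators; removing the same index twice gives X^p = 0.\<close>

lemma diff_diff:
  assumes \<phi>: "\<phi> \<in> cochains x n"
  shows "diff (diff \<phi>) = (\<lambda>_. 0)"
proof
  fix c
  let ?op = "\<lambda>s. E (step_wt p s (count c s))"
  \<comment> \<open>The term that removes \<open>s\<close> first and \<open>t\<close> second. The
    diagonal is set to 0, its value by \<open>E_step_E_step\<close>, so that both indices can range
    over all of \<open>c\<close>.\<close>
  define X where "X s t = (if s = t then 0 else (dsign s c * dsign t (c - {#s#})) *s ?op s (?op t (\<phi> (c - {#s#} - {#t#}))))" for s t
  have X: "dsign s c *s ?op s (diff \<phi> (c - {#s#})) = (\<Sum>t\<in>set_mset c. X s t)" if s: "s \<in># c" for s
  proof -
    let ?c = "c - {#s#}"
    have "?op s (diff \<phi> ?c) =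
        (\<Sum>t\<in>set_mset ?c. ?op s (dsign t ?c *s E (step_wt p t (count ?c t)) (\<phi> (?c - {#t#}))))"
      unfolding diff_def
      by (rule E_sum[where y = "x + 2 * int (cell_wt p ?c)"]) (intro finite_set_mset, intro W_scale face_W[OF \<phi>])
    also have "\<dots> = (\<Sum>t\<in>set_mset ?c. dsign t ?c *s ?op s (E (step_wt p t (count ?c t)) (\<phi> (?c - {#t#}))))"
      by (intro sum.cong refl E_scale[OF face_W[OF \<phi>]])
    finally have "dsign s c *s ?op s (diff \<phi> ?c) =
        (\<Sum>t\<in>set_mset ?c. (dsign s c * dsign t ?c) *s ?op s (E (step_wt p t (count ?c t)) (\<phi> (?c - {#t#}))))"
      by (simp add: scale_sum_right)
    also have "\<dots> = (\<Sum>t\<in>set_mset ?c. X s t)"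
    proof (rule sum.cong)
      fix t assume t: "t \<in> set_mset ?c"
      show "(dsign s c * dsign t ?c) *s ?op s (E (step_wt p t (count ?c t)) (\<phi> (?c - {#t#}))) = X s t"
      proof (cases "s = t")
        case True
        obtain k where "count c s = Suc k" using s by (metis count_eq_zero_iff not0_implies_Suc)
        hence "?op s (E (step_wt p t (count ?c t)) (\<phi> (?c - {#t#}))) = 0"
          using E_step_E_step[OF cochainsD(2)[OF \<phi>]] True by simp
        thus ?thesis using True by (simp add: X_def)
      qed (simp add: X_def)
    qed simp
    also have "\<dots> = (\<Sum>t\<in>set_mset c. X s t)"
    proof (rule sum.mono_neutral_left)
      show "\<forall>t\<in>set_mset c - set_mset ?c. X s t = 0"
      proof
        fix t assume t: "t \<in> set_mset c - set_mset ?c"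
        show "X s t = 0"
        proof (cases "s = t")
          case False
          hence "count ?c t = count c t" by simp
          moreover have "count c t > 0" using t by (simp only: count_greater_zero_iff) blast
          ultimately have "t \<in># ?c" by (simp only: count_greater_zero_iff [symmetric])
          thus ?thesis using t by simp
        qed (simp add: X_def)
      qed
    qed (auto dest: in_diffD)
    finally show ?thesis .
  qed
  have anti: "X s t = - X t s" if "s \<in># c" "t \<in># c" for s t
  proof (cases "s = t")
    case False
    have "?op s (?op t (\<phi> (c - {#s#} - {#t#}))) = ?op t (?op s (\<phi> (c - {#t#} - {#s#})))"
      using E_commute[OF cochainsD(2)[OF \<phi>]] by (simp add: diff_diff_add_mset add_mset_commute)
    thus ?thesis using dsign_anticommute[OF that False] False by (simp add: X_def)
  qed (simp add: X_def)
  let ?D = "\<Sum>s\<in>set_mset c. \<Sum>t\<in>set_mset c. X s t"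
  have "?D = (\<Sum>s\<in>set_mset c. \<Sum>t\<in>set_mset c. - X t s)"
    by (intro sum.cong refl anti)
  also have "\<dots> = - (\<Sum>s\<in>set_mset c. \<Sum>t\<in>set_mset c. X t s)" by (simp add: sum_negf)
  also have "(\<Sum>s\<in>set_mset c. \<Sum>t\<in>set_mset c. X t s) = ?D" by (rule sum.swap)
  finally have "?D + ?D = 0" by (simp only: eq_neg_iff_add_eq_0)
  hence "?D = 0" by (rule double_eq_0)
  thus "diff (diff \<phi>) c = 0" using X by (simp add: diff_def[of "diff \<phi>"])
qed

end

lemma prime_power_dvd_iff_digits:
  assumes "(p::nat) > 0"
  shows "p ^ S dvd t \<longleftrightarrow> (\<forall>s<S. t div p ^ s mod p = 0)"
proof (induction S)
  case (Suc S)
  have "p ^ Suc S dvd t \<longleftrightarrow> p ^ S dvd t \<and> p dvd t div p ^ S"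
  proof
    assume "p ^ Suc S dvd t"
    then obtain k where "t = p ^ Suc S * k" by (rule dvdE)
    hence "t = p ^ S * (p * k)" by (simp add: mult_ac)
    thus "p ^ S dvd t \<and> p dvd t div p ^ S" using assms by simp
  next
    assume *: "p ^ S dvd t \<and> p dvd t div p ^ S"
    then obtain l where "t div p ^ S = p * l" by (blast elim: dvdE)
    moreover have "t = p ^ S * (t div p ^ S)" using * by simp
    ultimately have "t = p ^ Suc S * l" by (simp add: mult_ac)
    thus "p ^ Suc S dvd t" by simp
  qed
  thus ?case using Suc by (auto simp: less_Suc_eq mod_eq_0_iff_dvd)
qed simp

lemma eq_0_if_digits_eq_0:
  assumes "(p::nat) > 1" and "\<And>s. t div p ^ s mod p = 0"
  shows "t = 0"
proof (rule ccontr)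
  assume "t \<noteq> 0"
  moreover have "p ^ t dvd t" using prime_power_dvd_iff_digits[of p t t] assms by simp
  moreover have "t < p ^ t" using assms(1) by (intro power_gt_expt) simp
  ultimately show False by (auto dest: dvd_imp_le)
qed

section \<open>Acyclicity in non-negative weights\<close>

context graded_module
begin

text \<open>
  A graded form of injectivity for the algebra of divided powers, restricted to non-negative weights:
  every socle vector lies in a truncated cofree module.
\<close>

definition socle_extension :: bool where
  "socle_extension \<longleftrightarrow>
     (\<forall>y t w. w \<in> W y \<longrightarrow> (\<forall>j\<ge>1. E j w = 0) \<longrightarrow> 2 * int t \<le> y \<longrightarrow>
        (\<exists>u\<in>W (y - 2 * int t). E t u = w \<and> (\<forall>j. (of_nat (t choose j) :: 'k) = 0 \<longrightarrow> E j u = 0)))"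

text \<open>Up to the non-zero scalar \<open>t choose a\<close>, \<open>E t\<close> is
  \<open>E (t - a)\<close> applied after \<open>E a\<close>.\<close>

lemma E_eq_0_of_factor:
  assumes v: "v \<in> W y" and a: "(of_nat (t choose a) :: 'k) \<noteq> 0" and "E a v = 0"
  shows "E t v = 0"
proof -
  have "a \<le> t" using a by (metis binomial_eq_0 not_le of_nat_0)
  hence "t choose (t - a) = t choose a" by (rule binomial_symmetric[symmetric])
  hence "of_nat (t choose a) *s E t v = E (t - a) (E a v)"
    using E_E[OF v, of "t - a" a] \<open>a \<le> t\<close> by simp
  thus ?thesis using assms(3) a by simp
qed

lemma digit_eq_0_of_E:
  assumes v: "v \<in> W y" and "E (p ^ s) v = 0" and "E t v \<noteq> 0"
  shows "t div p ^ s mod p = 0"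
proof (rule ccontr)
  assume "t div p ^ s mod p \<noteq> 0"
  hence "(of_nat (t choose p ^ s) :: 'k) \<noteq> 0"
    using of_nat_choose_digit_eq_0_iff[OF prime_p CHAR_p, of 1 t s] p_gt_1 by simp
  thus False using E_eq_0_of_factor[OF v _ assms(2)] assms(3) by blast
qed

lemma step_wt_cases:
  obtains j where "1 \<le> j" and "j < p" and "step_wt p s k = j * p ^ s"
    and "step_wt p s (Suc k) = (p - j) * p ^ s"
proof (cases "odd k")
  case True
  thus ?thesis using that[of 1] p_gt_1 by (simp add: step_wt_def)
next
  case False
  have "1 \<le> p - 1" "p - 1 < p" "p - (p - 1) = 1" using p_ge_3 by linarith+
  thus ?thesis using that[of "p - 1"] False by (simp add: step_wt_def)
qed

text \<open>Exactness of the periodic complex of one variable, on vectors killed by the variables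
  below \<open>S\<close> and from \<open>R\<close> on. The highest divided power that does not kill
  \<open>v\<close> yields a socle vector; lifting it by \<open>socle_extension\<close> and
  subtracting the resulting multiple of \<open>E ?a u0\<close> from \<open>v\<close> lowers that
  power.\<close>

lemma lift_along_E:
  assumes ext: socle_extension and SR: "S < R" and y: "2 * int (step_wt p S k) \<le> y"
    and "v \<in> W y" and "E (step_wt p S (Suc k)) v = 0"
    and "\<And>s. s < S \<or> R \<le> s \<Longrightarrow> E (p ^ s) v = 0"
  shows "\<exists>u\<in>W (y - 2 * int (step_wt p S k)). E (step_wt p S k) u = v \<and>
           (\<forall>s. s < S \<or> R \<le> s \<longrightarrow> E (p ^ s) u = 0)"
proof -
  let ?a = "step_wt p S k" and ?b = "step_wt p S (Suc k)"
  obtain j where j: "1 \<le> j" "j < p" "?a = j * p ^ S" "?b = (p - j) * p ^ S"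
    by (rule step_wt_cases)
  obtain B where "\<forall>t\<ge>B. E t v = 0" using E_nilpotent assms(4) by blast
  thus ?thesis using assms(4-6)
  proof (induction B arbitrary: v rule: less_induct)
    case (less B)
    note v = less.prems(2)
    show ?case
    proof (cases "v = 0")
      case True
      thus ?thesis by (intro bexI[of _ 0]) (auto simp: W_zero)
    next
      case False
      \<comment> \<open>By maximality every \<open>E i\<close> with \<open>i \<ge> 1\<close> kills
        \<open>E t v\<close>.\<close>
      define t where "t = Max {t. E t v \<noteq> 0}"
      have fin: "finite {t. E t v \<noteq> 0}"
        by (rule finite_subset[of _ "{..<B}"]) (use less.prems(1) not_le in auto)
      have "0 \<in> {t. E t v \<noteq> 0}" using False E_0[OF v] by simp
      hence ne: "{t. E t v \<noteq> 0} \<noteq> {}" by blast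
      have t: "E t v \<noteq> 0" using Max_in[OF fin ne] by (simp add: t_def)
      have t_max: "E i v = 0" if "t < i" for i
        using Max_ge[OF fin, of i] that by (auto simp: t_def)
      have "t < B" using t less.prems(1) by (metis not_le)
      have digits: "t div p ^ s mod p = 0" if "s < S \<or> R \<le> s" for s
        using digit_eq_0_of_E[OF v less.prems(4)[OF that] t] .
      define q where "q = t div p ^ S"
      have tq: "t = q * p ^ S"
        using prime_power_dvd_iff_digits[OF p_pos, of S t] digits by (auto simp: q_def)
      \<comment> \<open>Because X^(p-j) kills \<open>v\<close>, the digit of \<open>t\<close> at
        \<open>S\<close> leaves room for \<open>j\<close>. Adding \<open>?a\<close> to
        \<open>t\<close> therefore causes no carry and changes no other digit, and \<open>u0\<close>
        is still killed by the required variables.\<close>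
      have dj: "q mod p + j < p"
      proof (rule ccontr)
        assume "\<not> q mod p + j < p"
        hence "(of_nat (t choose ?b) :: 'k) \<noteq> 0"
          using of_nat_choose_digit_eq_0_iff[OF prime_p CHAR_p, of "p - j" t S] j by (simp add: q_def)
        thus False using E_eq_0_of_factor[OF v _ less.prems(3)] t by blast
      qed
      define t' where "t' = t + ?a"
      have t'q: "t' = (q + j) * p ^ S" using tq j by (simp add: t'_def algebra_simps)
      have qj: "(q + j) mod p = q mod p + j" "(q + j) div p = q div p"
      proof -
        have "q + j = p * (q div p) + (q mod p + j)" by simp
        thus "(q + j) mod p = q mod p + j" "(q + j) div p = q div p"
          using dj p_pos by (metis mod_mult_self4 mod_less, metis div_mult_self4 div_less add.right_neutral less_irrefl)
      qed
      have t'_digits: "t' div p ^ s mod p = 0" if "s < S \<or> R \<le> s" for s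
      proof (cases "s < S")
        case True
        thus ?thesis using prime_power_dvd_iff_digits[OF p_pos, of S t'] t'q by auto
      next
        case False
        hence "R \<le> s" using that by simp
        define l where "l = s - Suc S"
        have l: "p ^ s = p ^ S * (p * p ^ l)"
          using \<open>R \<le> s\<close> SR by (simp add: l_def flip: power_Suc power_add)
        have "t' div p ^ s = t div p ^ s"
          using p_pos qj(2) by (simp add: l div_mult2_eq t'q tq)
        thus ?thesis using digits that by simp
      qed
      have ca: "(of_nat (t' choose ?a) :: 'k) \<noteq> 0"
        using of_nat_choose_digit_eq_0_iff[OF prime_p CHAR_p, of j t' S] j qj(1) p_pos by (simp add: t'q)
      have w: "E t v \<in> W (y + 2 * int t)" by (rule E_W[OF v])
      have "E i (E t v) = 0" if "i \<ge> 1" for i using E_E[OF v, of i t] t_max[of "i + t"] that by simp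
      \<comment> \<open>This is where the weight has to be large enough: \<open>t\<close> adds the
        same amount to both sides, so the condition reduces to
        \<open>2 * ?a \<le> y\<close>.\<close>
      moreover have "2 * int t' \<le> y + 2 * int t" using y by (simp add: t'_def)
      ultimately obtain u0 where u0: "u0 \<in> W (y + 2 * int t - 2 * int t')" "E t' u0 = E t v"
        "\<And>i. (of_nat (t' choose i) :: 'k) = 0 \<Longrightarrow> E i u0 = 0"
        using ext w unfolding socle_extension_def by metis
      have u0W: "u0 \<in> W (y - 2 * int ?a)" using u0(1) by (simp add: t'_def)
      have u0_kill: "E (p ^ s) u0 = 0" if "s < S \<or> R \<le> s" for s
        using u0(3) of_nat_choose_digit_eq_0_iff[OF prime_p CHAR_p, of 1 t' s] t'_digits[OF that] p_gt_1 by simp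
      \<comment> \<open>The scalar for which \<open>E t\<close> takes the same value on
        \<open>c *s E ?a u0\<close> as on \<open>v\<close>.\<close>
      define c where "c = inverse (of_nat (t' choose ?a) :: 'k)"
      have aW: "E ?a u0 \<in> W y" using E_W[OF u0W, of ?a] by simp
      define v' where "v' = v - c *s E ?a u0"
      have v'W: "v' \<in> W y" using v aW by (simp add: v'_def W_diff W_scale)
      have Ev': "E i v' = E i v - c *s E i (E ?a u0)" for i
        unfolding v'_def using E_diff[OF v W_scale[OF aW]] E_scale[OF aW] by simp
      have "E i v' = 0" if "i \<ge> t" for i
      proof (cases "i = t")
        case True
        have "t' choose t = t' choose ?a"
          using binomial_symmetric[of ?a t'] by (simp add: t'_def)
        hence "E t (E ?a u0) = of_nat (t' choose ?a) *s E t v"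
          using E_E[OF u0W, of t ?a] u0(2) by (simp add: t'_def)
        thus ?thesis using Ev'[of i] True ca by (simp add: c_def)
      next
        case False
        hence "t' < i + ?a" using that by (simp add: t'_def)
        hence "E (i + ?a) u0 = 0" using u0(3) by (simp add: binomial_eq_0)
        hence "E i (E ?a u0) = 0" using E_E[OF u0W, of i ?a] by simp
        thus ?thesis using Ev'[of i] t_max[of i] that False by simp
      qed
      moreover have "E ?b v' = 0"
        using Ev'[of ?b] less.prems(3) E_step_E_step[OF u0W, of S k] by simp
      moreover have "E (p ^ s) v' = 0" if "s < S \<or> R \<le> s" for s
        using Ev'[of "p ^ s"] less.prems(4)[OF that] E_commute[OF u0W, of "p ^ s" ?a] u0_kill[OF that] by simp
      ultimately obtain u1 where u1: "u1 \<in> W (y - 2 * int ?a)" "E ?a u1 = v'"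
        "\<And>s. s < S \<or> R \<le> s \<Longrightarrow> E (p ^ s) u1 = 0"
        using less.IH[OF \<open>t < B\<close>, of v'] v'W by blast
      define u where "u = u1 + c *s u0"
      have Eu: "E i u = E i u1 + c *s E i u0" for i
        unfolding u_def using E_add[OF u1(1) W_scale[OF u0W]] E_scale[OF u0W] by simp
      have "u \<in> W (y - 2 * int ?a)" using u1(1) u0W by (simp add: u_def W_add W_scale)
      moreover have "E ?a u = v" using Eu u1(2) by (simp add: v'_def)
      moreover have "E (p ^ s) u = 0" if "s < S \<or> R \<le> s" for s using Eu u1(3)[OF that] u0_kill[OF that] by simp
      ultimately show ?thesis by blast
    qed
  qed
qed

text \<open>\<open>S\<close> is the number of tensor factors in use. Variables from \<open>R\<close>
  on act by zero on the values; those from \<open>S\<close> to \<open>R\<close> are unrestricted, as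
  they become factors later in the induction.\<close>

definition tame :: "nat \<Rightarrow> nat \<Rightarrow> int \<Rightarrow> nat \<Rightarrow> (nat multiset \<Rightarrow> 'v) set" where
  "tame S R x n = {\<phi> \<in> cochains x n. (\<forall>c. \<not> set_mset c \<subseteq> {..<S} \<longrightarrow> \<phi> c = 0) \<and>
     (\<forall>c. \<forall>s\<ge>R. E (p ^ s) (\<phi> c) = 0)}"

text \<open>Together with \<open>place\<close> this separates off the last tensor factor: the part
  with exactly \<open>i\<close> copies of \<open>S\<close>, viewed as a cochain for the factors
  below \<open>S\<close>.\<close>

definition slice :: "nat \<Rightarrow> nat \<Rightarrow> (nat multiset \<Rightarrow> 'v) \<Rightarrow> nat multiset \<Rightarrow> 'v" where
  "slice S i \<phi> c = (if set_mset c \<subseteq> {..<S} then \<phi> (c + replicate_mset i S) else 0)"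

definition place :: "nat \<Rightarrow> nat \<Rightarrow> (nat multiset \<Rightarrow> 'v) \<Rightarrow> nat multiset \<Rightarrow> 'v" where
  "place S i \<psi> c = (if set_mset c \<subseteq> {..<Suc S} \<and> count c S = i then \<psi> (filter_mset (\<lambda>j. j \<noteq> S) c) else 0)"

lemma cell_split: "c = filter_mset (\<lambda>j. j \<noteq> S) c + replicate_mset (count c S) S"
  by (rule multiset_eqI) (simp add: count_replicate_mset)

lemma count_replicate_top:
  fixes c :: "nat multiset"
  assumes "set_mset c \<subseteq> {..<S}"
  shows "count c S = 0" and "filter_mset (\<lambda>j. j \<noteq> S) (c + replicate_mset i S) = c"
proof -
  have "S \<notin># c"
  proof
    assume "S \<in># c"
    hence "S \<in> {..<S}" by (rule subsetD[OF assms])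
    thus False by simp
  qed
  thus c: "count c S = 0" by (rule not_in_iff[THEN iffD1])
  show "filter_mset (\<lambda>j. j \<noteq> S) (c + replicate_mset i S) = c"
    by (rule multiset_eqI) (simp add: count_replicate_mset c)
qed

lemma cell_wt_replicate_top:
  assumes "set_mset c \<subseteq> {..<S}"
  shows "cell_wt p (c + replicate_mset i S) = cell_wt p c + cell_wt p (replicate_mset i S)"
proof (induction i)
  case (Suc i)
  thus ?case using count_replicate_top(1)[OF assms] by (simp add: cell_wt_add_mset[OF p_pos])
qed simp

lemma tameD:
  assumes "\<phi> \<in> tame S R x n"
  shows "\<phi> \<in> cochains x n" and "\<not> set_mset c \<subseteq> {..<S} \<Longrightarrow> \<phi> c = 0" and "s \<ge> R \<Longrightarrow> E (p ^ s) (\<phi> c) = 0"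
  using assms by (auto simp: tame_def)

lemma slice_tame:
  assumes \<phi>: "\<phi> \<in> tame (Suc S) R x n" and "i \<le> n"
  shows "slice S i \<phi> \<in> tame S R (x + 2 * int (cell_wt p (replicate_mset i S))) (n - i)"
proof -
  note \<phi>' = tameD(1)[OF \<phi>]
  have "{c. slice S i \<phi> c \<noteq> 0} \<subseteq> (\<lambda>c. c + replicate_mset i S) -` {c. \<phi> c \<noteq> 0}"
    by (auto simp: slice_def split: if_splits)
  moreover have "finite ((\<lambda>c. c + replicate_mset i S) -` {c. \<phi> c \<noteq> 0})"
    by (intro finite_vimageI cochainsD(1)[OF \<phi>']) (auto intro: injI)
  ultimately have "finite {c. slice S i \<phi> c \<noteq> 0}" by (rule finite_subset)
  moreover have "slice S i \<phi> c \<in> W (x + 2 * int (cell_wt p (replicate_mset i S)) + 2 * int (cell_wt p c))" for c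
  proof (cases "set_mset c \<subseteq> {..<S}")
    case True
    thus ?thesis using cochainsD(2)[OF \<phi>', of "c + replicate_mset i S"] cell_wt_replicate_top[OF True, of i]
      by (simp add: slice_def algebra_simps)
  next
    case False
    thus ?thesis by (simp add: slice_def W_zero)
  qed
  moreover have "slice S i \<phi> c = 0" if "size c \<noteq> n - i" for c
    using cochainsD(3)[OF \<phi>', of "c + replicate_mset i S"] that assms(2) by (auto simp: slice_def)
  ultimately show ?thesis using tameD(3)[OF \<phi>] by (auto simp: tame_def cochains_def slice_def)
qed

lemma place_tame:
  assumes \<psi>: "\<psi> \<in> tame S R (x + 2 * int (cell_wt p (replicate_mset i S))) n"
  shows "place S i \<psi> \<in> tame (Suc S) R x (n + i)"
proof -
  note \<psi>' = tameD(1)[OF \<psi>]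
  let ?f = "filter_mset (\<lambda>j. j \<noteq> S)"
  have "{c. place S i \<psi> c \<noteq> 0} \<subseteq> (\<lambda>c. c + replicate_mset i S) ` {c. \<psi> c \<noteq> 0}"
  proof
    fix c assume "c \<in> {c. place S i \<psi> c \<noteq> 0}"
    hence "count c S = i" "\<psi> (?f c) \<noteq> 0" by (auto simp: place_def split: if_splits)
    thus "c \<in> (\<lambda>c. c + replicate_mset i S) ` {c. \<psi> c \<noteq> 0}"
      using cell_split[of c S] by (intro image_eqI[of _ _ "?f c"]) auto
  qed
  hence "finite {c. place S i \<psi> c \<noteq> 0}"
    by (rule finite_subset) (intro finite_imageI cochainsD(1)[OF \<psi>'])
  moreover have "place S i \<psi> c \<in> W (x + 2 * int (cell_wt p c))" for c
  proof (cases "set_mset c \<subseteq> {..<Suc S} \<and> count c S = i")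
    case True
    hence "set_mset (?f c) \<subseteq> {..<S}" by auto
    from cell_wt_replicate_top[OF this, of i] have "cell_wt p c = cell_wt p (?f c) + cell_wt p (replicate_mset i S)"
      using True cell_split[of c S] by simp
    thus ?thesis using cochainsD(2)[OF \<psi>', of "?f c"] True by (simp add: place_def algebra_simps)
  next
    case False
    thus ?thesis by (auto simp: place_def W_zero)
  qed
  moreover have "place S i \<psi> c = 0" if "size c \<noteq> n + i" for c
  proof (cases "count c S = i")
    case True
    have "size c = size (?f c) + i" using arg_cong[OF cell_split[of c S], of size] True by simp
    thus ?thesis using that cochainsD(3)[OF \<psi>', of "?f c"] by (simp add: place_def)
  qed (simp add: place_def)
  ultimately show ?thesis using tameD(3)[OF \<psi>] by (auto simp: tame_def cochains_def place_def)
qed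

lemma slice_place:
  assumes "\<psi> \<in> tame S R x n" and "set_mset c \<subseteq> {..<S}"
  shows "slice S j (place S i \<psi>) c = (if i = j then \<psi> c else 0)"
proof -
  have "set_mset (c + replicate_mset j S) \<subseteq> {..<Suc S}" using assms(2) by (auto split: if_splits)
  thus ?thesis using assms(2) count_replicate_top[OF assms(2)] by (simp add: slice_def place_def)
qed

lemma dsign_add_replicate:
  assumes "s \<le> S"
  shows "dsign s (c + replicate_mset i S) = dsign s c"
proof -
  have none: "filter_mset (\<lambda>i. i < s) (replicate_mset i S) = {#}"
    using assms by (intro multiset_eqI) (auto simp: count_replicate_mset)
  show ?thesis unfolding dsign_def filter_union_mset none by simp
qed

text \<open>The total differential as that of a double complex: the differential of the lower
  factors plus one step in the factor \<open>S\<close>. Adding copies of \<open>S\<close> leaves the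
  signs alone, since they count smaller indices only.\<close>

lemma diff_slice:
  assumes c: "set_mset c \<subseteq> {..<S}"
  shows "diff \<phi> (c + replicate_mset i S) = diff (slice S i \<phi>) c +
    (if i = 0 then 0 else dsign S c *s E (step_wt p S i) (slice S (i - 1) \<phi> c))"
proof -
  let ?b = "c + replicate_mset i S"
  have nS: "S \<notin># c" using c by auto
  have face: "dsign s ?b *s E (step_wt p s (count ?b s)) (\<phi> (?b - {#s#})) =
      dsign s c *s E (step_wt p s (count c s)) (slice S i \<phi> (c - {#s#}))" if s: "s \<in># c" for s
  proof -
    have "s < S" using s c by auto
    hence "dsign s ?b = dsign s c" by (intro dsign_add_replicate) simp
    moreover have "count ?b s = count c s" using \<open>s < S\<close> by (simp add: count_replicate_mset)
    moreover have "?b - {#s#} = (c - {#s#}) + replicate_mset i S" using s by (simp add: multiset_diff_union_assoc)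
    moreover have "set_mset (c - {#s#}) \<subseteq> {..<S}" using c by (auto dest: in_diffD)
    ultimately show ?thesis by (simp add: slice_def)
  qed
  show ?thesis
  proof (cases i)
    case 0
    thus ?thesis unfolding diff_def using face by (simp cong: sum.cong)
  next
    case (Suc k)
    have "set_mset ?b = insert S (set_mset c)" by (auto simp: Suc)
    hence "diff \<phi> ?b = dsign S ?b *s E (step_wt p S (count ?b S)) (\<phi> (?b - {#S#})) +
        (\<Sum>s\<in>set_mset c. dsign s ?b *s E (step_wt p s (count ?b s)) (\<phi> (?b - {#s#})))"
      unfolding diff_def using nS by simp
    also have "(\<Sum>s\<in>set_mset c. dsign s ?b *s E (step_wt p s (count ?b s)) (\<phi> (?b - {#s#}))) = diff (slice S i \<phi>) c"
      unfolding diff_def by (rule sum.cong[OF refl]) (rule face)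
    also have "dsign S ?b = dsign S c" by (rule dsign_add_replicate) simp
    also have "count ?b S = i" using count_replicate_top(1)[OF c] by simp
    also have "?b - {#S#} = c + replicate_mset (i - 1) S" by (simp add: Suc)
    finally have "diff \<phi> ?b = dsign S c *s E (step_wt p S i) (\<phi> (c + replicate_mset (i - 1) S)) + diff (slice S i \<phi>) c" .
    moreover have "slice S (i - 1) \<phi> c = \<phi> (c + replicate_mset (i - 1) S)" using c by (simp add: slice_def)
    ultimately show ?thesis using Suc by (simp add: add.commute)
  qed
qed

lemma diff_cong_faces:
  assumes "\<And>s. s \<in># c \<Longrightarrow> \<phi> (c - {#s#}) = \<psi> (c - {#s#})"
  shows "diff \<phi> c = diff \<psi> c"
  unfolding diff_def by (rule sum.cong) (use assms in auto)

lemma tame_add: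
  assumes "\<phi> \<in> tame S R x n" and "\<psi> \<in> tame S R x n"
  shows "(\<lambda>c. \<phi> c + \<psi> c) \<in> tame S R x n"
  using assms E_add[OF cochainsD(2)[OF tameD(1)[OF assms(1)]] cochainsD(2)[OF tameD(1)[OF assms(2)]]]
  by (auto simp: tame_def add_cochain)

lemma zero_tame [simp]: "(\<lambda>_. 0) \<in> tame S R x n"
  by (simp add: tame_def)

text \<open>Faces of a cell with indices below \<open>S\<close> again have indices below
  \<open>S\<close>, so the error of a partial solution can be cut off to such cells and stays closed
  there.\<close>

lemma tame_residual:
  assumes \<phi>: "\<phi> \<in> tame S R x (Suc n)" and \<psi>: "\<psi> \<in> tame S R x n"
    and closed: "\<forall>c. set_mset c \<subseteq> {..<S} \<longrightarrow> diff \<phi> c = 0"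
  defines "\<rho> \<equiv> \<lambda>c. if set_mset c \<subseteq> {..<S} then \<phi> c - diff \<psi> c else 0"
  shows "\<rho> \<in> tame S R x (Suc n)" and "set_mset c \<subseteq> {..<S} \<Longrightarrow> diff \<rho> c = 0"
proof -
  note \<phi>' = tameD(1)[OF \<phi>] and \<psi>' = tameD(1)[OF \<psi>]
  note d\<psi> = diff_in_cochains[OF \<psi>']
  have \<delta>: "(\<lambda>c. \<phi> c - diff \<psi> c) \<in> cochains x (Suc n)" by (rule diff_cochain[OF \<phi>' d\<psi>])
  have "finite {c. \<rho> c \<noteq> 0}"
    by (rule finite_subset[OF _ cochainsD(1)[OF \<delta>]]) (auto simp: \<rho>_def)
  hence \<rho>: "\<rho> \<in> cochains x (Suc n)"
    using cochainsD(2,3)[OF \<delta>] by (auto simp: cochains_def \<rho>_def W_zero)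
  have "E (p ^ s) (diff \<psi> c) = 0" if "s \<ge> R" for s c
  proof -
    have "E (p ^ s) (diff \<psi> c) =
        (\<Sum>i\<in>set_mset c. E (p ^ s) (dsign i c *s E (step_wt p i (count c i)) (\<psi> (c - {#i#}))))"
      unfolding diff_def
      by (rule E_sum[where y = "x + 2 * int (cell_wt p c)"]) (intro finite_set_mset, intro W_scale face_W[OF \<psi>'])
    also have "\<dots> = 0"
    proof (rule sum.neutral, rule ballI)
      fix i assume i: "i \<in> set_mset c"
      have "E (p ^ s) (E (step_wt p i (count c i)) (\<psi> (c - {#i#}))) = 0"
        using E_commute[OF cochainsD(2)[OF \<psi>'], of "p ^ s"] tameD(3)[OF \<psi> that] by simp
      thus "E (p ^ s) (dsign i c *s E (step_wt p i (count c i)) (\<psi> (c - {#i#}))) = 0"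
        using E_scale[OF face_W[OF \<psi>' i]] by simp
    qed
    finally show ?thesis .
  qed
  hence "E (p ^ s) (\<rho> c) = 0" if "s \<ge> R" for s c
    using E_diff[OF cochainsD(2)[OF \<phi>'] cochainsD(2)[OF d\<psi>]] tameD(3)[OF \<phi> that] that by (simp add: \<rho>_def)
  thus "\<rho> \<in> tame S R x (Suc n)" using \<rho> by (auto simp: tame_def \<rho>_def)
  assume c: "set_mset c \<subseteq> {..<S}"
  have "diff \<rho> c = diff (\<lambda>c. \<phi> c - diff \<psi> c) c"
  proof (rule diff_cong_faces)
    fix s
    have "set_mset (c - {#s#}) \<subseteq> {..<S}" using c by (auto dest: in_diffD)
    thus "\<rho> (c - {#s#}) = \<phi> (c - {#s#}) - diff \<psi> (c - {#s#})" by (simp add: \<rho>_def)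
  qed
  also have "\<dots> = diff \<phi> c - diff (diff \<psi>) c" by (rule diff_diff_cochain[OF \<phi>' d\<psi>])
  also have "\<dots> = 0" using closed c diff_diff[OF \<psi>'] by simp
  finally show "diff \<rho> c = 0" .
qed

lemma diff_place:
  assumes \<psi>: "\<psi> \<in> tame S R y n" and c: "set_mset c \<subseteq> {..<S}"
  shows "diff (place S i \<psi>) (c + replicate_mset j S) =
    (if j = i then diff \<psi> c else 0) + (if j = Suc i then dsign S c *s E (step_wt p S j) (\<psi> c) else 0)"
proof -
  have "slice S j (place S i \<psi>) = (if j = i then \<psi> else (\<lambda>_. 0))" for j
  proof
    fix b
    show "slice S j (place S i \<psi>) b = (if j = i then \<psi> else (\<lambda>_. 0)) b"
      using slice_place[OF \<psi>, of b j i] tameD(2)[OF \<psi>, of b]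
      by (cases "set_mset b \<subseteq> {..<S}") (auto simp: slice_def)
  qed
  thus ?thesis using diff_slice[OF c, of "place S i \<psi>" j] by (cases j) auto
qed

text \<open>A Kuenneth argument by induction on the number of factors. A slice with
  \<open>i \<le> k\<close> copies of \<open>S\<close> has positive degree in the lower factors and
  yields to the induction hypothesis. The slice with \<open>k + 1\<close> copies has degree 0 there;
  it is a single vector, and \<open>lift_along_E\<close> treats it.\<close>

lemma peel:
  assumes ext: socle_extension
  shows "S \<le> R \<Longrightarrow> 0 \<le> x \<Longrightarrow> \<phi> \<in> tame S R x (Suc k) \<Longrightarrow> \<forall>c. set_mset c \<subseteq> {..<S} \<longrightarrow> diff \<phi> c = 0 \<Longrightarrow>
    \<exists>\<psi>\<in>tame S R x k. \<forall>c. set_mset c \<subseteq> {..<S} \<longrightarrow> diff \<psi> c = \<phi> c"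
proof (induction S arbitrary: \<phi> k x)
  case 0
  have "\<phi> c = 0" if "set_mset c \<subseteq> {..<0}" for c
    using cochainsD(3)[OF tameD(1)[OF 0(3)], of c] that by simp
  thus ?case by (intro bexI[of _ "\<lambda>_. 0"]) auto
next
  case (Suc S)
  let ?cell = "\<lambda>c. set_mset c \<subseteq> {..<Suc S}"
  note IH = Suc.IH
  have SR: "S \<le> R" "S < R" using Suc.prems(1) by auto
  note x = Suc.prems(2) and \<phi> = Suc.prems(3) and closed = Suc.prems(4)
  define base where "base c = filter_mset (\<lambda>j. j \<noteq> S) c" for c :: "nat multiset"
  have split: "c = base c + replicate_mset (count c S) S" for c
    unfolding base_def by (rule cell_split)
  have base: "set_mset (base c) \<subseteq> {..<S}" if "?cell c" for c
    using that by (auto simp: base_def)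
  have cell_add: "?cell (b + replicate_mset j S)" if "set_mset b \<subseteq> {..<S}" for b j
    using that by (auto split: if_splits)
  \<comment> \<open>Slices are corrected in increasing order: a correction placed at
    \<open>i\<close> copies of \<open>S\<close> changes the differential only at \<open>i\<close>
    and \<open>i + 1\<close> copies, so earlier slices stay correct.\<close>
  have partial: "\<exists>\<psi>\<in>tame (Suc S) R x k. \<forall>c. ?cell c \<longrightarrow> count c S < i \<longrightarrow> diff \<psi> c = \<phi> c" if "i \<le> Suc k" for i
    using that
  proof (induction i)
    case 0
    show ?case by (intro bexI[of _ "\<lambda>_. 0"]) auto
  next
    case (Suc i)
    hence ik: "i \<le> k" by simp
    then obtain \<psi> where \<psi>: "\<psi> \<in> tame (Suc S) R x k" "\<And>c. ?cell c \<Longrightarrow> count c S < i \<Longrightarrow> diff \<psi> c = \<phi> c"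
      using Suc.IH by auto
    define \<rho> where "\<rho> = (\<lambda>c. if ?cell c then \<phi> c - diff \<psi> c else 0)"
    note res = tame_residual[OF \<phi> \<psi>(1) closed, folded \<rho>_def]
    let ?y = "x + 2 * int (cell_wt p (replicate_mset i S))"
    have y0: "0 \<le> ?y" using x by simp
    have "slice S i \<rho> \<in> tame S R ?y (Suc (k - i))"
      using slice_tame[OF res(1), of i] ik by (simp add: Suc_diff_le)
    moreover have "diff (slice S i \<rho>) c = 0" if c: "set_mset c \<subseteq> {..<S}" for c
    proof -
      have "slice S (i - 1) \<rho> c = 0" if "i \<noteq> 0"
        using \<psi>(2)[OF cell_add[OF c], of "i - 1"] that count_replicate_top(1)[OF c] by (simp add: slice_def \<rho>_def)
      thus ?thesis using diff_slice[OF c, of \<rho> i] res(2)[OF cell_add[OF c]] by (simp split: if_splits)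
    qed
    ultimately obtain \<psi>i where \<psi>i: "\<psi>i \<in> tame S R ?y (k - i)"
      "\<And>c. set_mset c \<subseteq> {..<S} \<Longrightarrow> diff \<psi>i c = slice S i \<rho> c"
      using IH[OF SR(1) y0, of "slice S i \<rho>" "k - i"] by blast
    have pl: "place S i \<psi>i \<in> tame (Suc S) R x k" using place_tame[OF \<psi>i(1)] ik by simp
    define \<psi>' where "\<psi>' = (\<lambda>c. \<psi> c + place S i \<psi>i c)"
    have "diff \<psi>' c = \<phi> c" if c: "?cell c" "count c S < Suc i" for c
    proof -
      define b where "b = base c"
      have b: "c = b + replicate_mset (count c S) S" "set_mset b \<subseteq> {..<S}"
        unfolding b_def by (rule split) (rule base[OF c(1)])
      have "diff \<psi>' c = diff \<psi> c + diff (place S i \<psi>i) c"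
        unfolding \<psi>'_def by (rule diff_add[OF tameD(1)[OF \<psi>(1)] tameD(1)[OF pl]])
      also have "diff (place S i \<psi>i) c = (if count c S = i then slice S i \<rho> b else 0)"
      proof -
        have "diff (place S i \<psi>i) c = diff (place S i \<psi>i) (b + replicate_mset (count c S) S)"
          by (rule arg_cong[OF b(1)])
        also have "\<dots> = (if count c S = i then slice S i \<rho> b else 0)"
          using diff_place[OF \<psi>i(1) b(2), of i "count c S"] c(2) \<psi>i(2)[OF b(2)] by simp
        finally show ?thesis .
      qed
      also have "diff \<psi> c + \<dots> = \<phi> c"
      proof (cases "count c S = i")
        case True
        have "slice S i \<rho> b = \<rho> (b + replicate_mset i S)" using b(2) by (simp add: slice_def)
        also have "b + replicate_mset i S = c" using b(1) True by simp
        finally have "slice S i \<rho> b = \<rho> c" .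
        thus ?thesis using True c(1) by (simp add: \<rho>_def)
      next
        case False
        thus ?thesis using \<psi>(2)[OF c(1)] c(2) by simp
      qed
      finally show ?thesis .
    qed
    moreover have "\<psi>' \<in> tame (Suc S) R x k" unfolding \<psi>'_def by (rule tame_add[OF \<psi>(1) pl])
    ultimately show ?case by blast
  qed
  then obtain \<psi> where \<psi>: "\<psi> \<in> tame (Suc S) R x k" "\<And>c. ?cell c \<Longrightarrow> count c S < Suc k \<Longrightarrow> diff \<psi> c = \<phi> c"
    by blast
  define \<rho> where "\<rho> = (\<lambda>c. if ?cell c then \<phi> c - diff \<psi> c else 0)"
  note res = tame_residual[OF \<phi> \<psi>(1) closed, folded \<rho>_def]
  define top where "top = replicate_mset (Suc k) S"
  define v where "v = \<rho> top"
  have cell0: "set_mset {#} \<subseteq> {..<S}" by simp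
  have \<rho>_low: "\<rho> c = 0" if "count c S < Suc k" for c
    using \<psi>(2)[of c] that by (simp add: \<rho>_def)
  have \<rho>_top: "\<rho> c = (if c = top then v else 0)" for c
  proof (cases "c = top")
    case False
    show ?thesis
    proof (cases "count c S < Suc k")
      case False
      have sz: "size c = size (base c) + count c S"
        using arg_cong[OF split[of c], of size] by simp
      have "size c \<noteq> Suc k"
      proof
        assume "size c = Suc k"
        hence "size (base c) = 0" and cnt: "count c S = Suc k" using sz False by linarith+
        hence "base c = {#}" by (simp only: size_eq_0_iff_empty)
        hence "c = top" using split[of c] cnt by (simp add: top_def)
        thus False using \<open>c \<noteq> top\<close> by simp
      qed
      thus ?thesis using cochainsD(3)[OF tameD(1)[OF res(1)]] \<open>c \<noteq> top\<close> by simp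
    qed (use \<rho>_low \<open>c \<noteq> top\<close> in simp)
  qed (simp add: v_def)
  let ?z = "x + 2 * int (cell_wt p (replicate_mset k S))"
  have wt_top: "cell_wt p top = cell_wt p (replicate_mset k S) + step_wt p S (Suc k)"
    by (simp add: top_def cell_wt_add_mset[OF p_pos])
  have vW: "v \<in> W (x + 2 * int (cell_wt p top))"
    unfolding v_def by (rule cochainsD(2)[OF tameD(1)[OF res(1)]])
  \<comment> \<open>Closedness at the cell with one more copy of \<open>S\<close>.\<close>
  have v1: "E (step_wt p S (Suc (Suc k))) v = 0"
  proof -
    have "diff \<rho> ({#} + replicate_mset (Suc (Suc k)) S) = 0" by (rule res(2)[OF cell_add[OF cell0]])
    thus ?thesis using diff_slice[OF cell0, of \<rho> "Suc (Suc k)"] by (simp add: slice_def v_def top_def diff_def dsign_def)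
  qed
  \<comment> \<open>For \<open>s < S\<close> this is closedness at the cell with one copy of
    \<open>s\<close> added; for \<open>R \<le> s\<close> it is tameness.\<close>
  have v2: "E (p ^ s) v = 0" if "s < S \<or> R \<le> s" for s
  proof (cases "s < S")
    case True
    hence cs: "set_mset {#s#} \<subseteq> {..<S}" by simp
    have "diff \<rho> ({#s#} + replicate_mset (Suc k) S) = 0" by (rule res(2)[OF cell_add[OF cs]])
    moreover have "slice S k \<rho> {#s#} = 0" using \<rho>_low[of "{#s#} + replicate_mset k S"] True by (simp add: slice_def)
    ultimately have "diff (slice S (Suc k) \<rho>) {#s#} = 0" using diff_slice[OF cs, of \<rho> "Suc k"] by simp
    thus ?thesis using dsign_ne_0[of s "{#s#}"] by (simp add: diff_def slice_def v_def top_def step_wt_def del: dsign_ne_0)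
  next
    case False
    thus ?thesis using that tameD(3)[OF res(1)] by (simp add: v_def)
  qed
  have "2 * int (step_wt p S (Suc k)) \<le> x + 2 * int (cell_wt p top)" using Suc.prems(2) wt_top by simp
  from lift_along_E[OF ext SR(2) this vW v1 v2] obtain u where
    u: "u \<in> W ?z" "E (step_wt p S (Suc k)) u = v" "\<And>s. s < S \<or> R \<le> s \<Longrightarrow> E (p ^ s) u = 0"
    by (auto simp: wt_top)
  define \<mu> where "\<mu> = (\<lambda>c::nat multiset. if c = {#} then u else 0)"
  have "finite {c. \<mu> c \<noteq> 0}" by (rule finite_subset[of _ "{{#}}"]) (auto simp: \<mu>_def)
  hence \<mu>: "\<mu> \<in> tame S R ?z 0" using u by (auto simp: tame_def cochains_def \<mu>_def W_zero)
  have d\<mu>: "diff \<mu> b = 0" if b: "set_mset b \<subseteq> {..<S}" for b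
    unfolding diff_def
  proof (rule sum.neutral, rule ballI)
    fix s assume s: "s \<in> set_mset b"
    show "dsign s b *s E (step_wt p s (count b s)) (\<mu> (b - {#s#})) = 0"
    proof (cases "b - {#s#} = {#}")
      case True
      hence bs: "b = {#s#}" using s by (metis insert_DiffM)
      have "s < S" using b s by auto
      thus ?thesis using u(3) by (simp add: bs \<mu>_def step_wt_def)
    qed (simp add: \<mu>_def)
  qed
  have pl: "place S k \<mu> \<in> tame (Suc S) R x k" using place_tame[OF \<mu>] by simp
  define \<psi>' where "\<psi>' = (\<lambda>c. \<psi> c + place S k \<mu> c)"
  have "diff \<psi>' c = \<phi> c" if c: "?cell c" for c
  proof -
    define b where "b = base c"
    have b: "c = b + replicate_mset (count c S) S" "set_mset b \<subseteq> {..<S}"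
      unfolding b_def by (rule split) (rule base[OF c])
    have "diff (place S k \<mu>) c = (if count c S = Suc k \<and> b = {#} then v else 0)"
    proof -
      have "diff (place S k \<mu>) c = diff (place S k \<mu>) (b + replicate_mset (count c S) S)"
        by (rule arg_cong[OF b(1)])
      also have "\<dots> = (if count c S = Suc k \<and> b = {#} then v else 0)"
        using diff_place[OF \<mu> b(2), of k "count c S"] d\<mu>[OF b(2)] u(2) by (simp add: \<mu>_def dsign_def)
      finally show ?thesis .
    qed
    also have "\<dots> = \<rho> c"
    proof (cases "count c S = Suc k \<and> b = {#}")
      case True
      hence "c = top" using b(1) by (simp add: top_def)
      thus ?thesis using True \<rho>_top[of c] by simp
    next
      case False
      have "c \<noteq> top"
      proof
        assume "c = top"
        hence "count c S = Suc k" "size c = Suc k" by (simp_all add: top_def)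
        thus False using False arg_cong[OF b(1), of size] by simp
      qed
      hence "\<rho> c = 0" using \<rho>_top[of c] by simp
      thus ?thesis by (simp only: if_not_P[OF False])
    qed
    finally have "diff (place S k \<mu>) c = \<rho> c" .
    moreover have "diff \<psi>' c = diff \<psi> c + diff (place S k \<mu>) c"
      unfolding \<psi>'_def by (rule diff_add[OF tameD(1)[OF \<psi>(1)] tameD(1)[OF pl]])
    ultimately show ?thesis using c by (simp add: \<rho>_def)
  qed
  moreover have "\<psi>' \<in> tame (Suc S) R x k" unfolding \<psi>'_def by (rule tame_add[OF \<psi>(1) pl])
  ultimately show ?case by blast
qed

text \<open>Finite support provides an \<open>R\<close> beyond which no index occurs and no variable
  acts, so \<open>peel\<close> applies with \<open>S = R\<close>.\<close>

lemma cocycle_is_coboundary: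
  assumes ext: socle_extension and x: "0 \<le> x" and \<phi>: "\<phi> \<in> cocycles x (Suc k)"
  shows "\<phi> \<in> coboundaries x (Suc k)"
proof -
  have \<phi>': "\<phi> \<in> cochains x (Suc k)" "diff \<phi> = (\<lambda>_. 0)" using \<phi> by (auto simp: cocycles_def)
  let ?supp = "{c. \<phi> c \<noteq> 0}"
  have "\<exists>T. \<forall>t\<ge>T. E t (\<phi> c) = 0 \<and> t \<notin># c" for c
  proof -
    obtain T where "\<forall>t\<ge>T. E t (\<phi> c) = 0" using E_nilpotent[OF cochainsD(2)[OF \<phi>'(1), of c]] by blast
    moreover have "\<exists>T'. \<forall>t\<in>#c. t < T'" using finite_nat_set_iff_bounded[of "set_mset c"] by simp
    then obtain T' where "\<forall>t\<in>#c. t < T'" by blast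
    ultimately show ?thesis by (intro exI[of _ "max T T'"]) (metis max.bounded_iff not_le)
  qed
  then obtain T where T: "\<And>c t. t \<ge> T c \<Longrightarrow> E t (\<phi> c) = 0" "\<And>c t. t \<ge> T c \<Longrightarrow> t \<notin># c" by metis
  define R where "R = (\<Sum>c\<in>?supp. T c)"
  have TR: "T c \<le> R" if "c \<in> ?supp" for c
    using cochainsD(1)[OF \<phi>'(1)] member_le_sum[of c ?supp T] that by (simp add: R_def)
  have lt: "s \<le> p ^ s" for s
    using power_gt_expt[of p s] p_gt_1 by simp
  have "\<phi> \<in> tame R R x (Suc k)"
    unfolding tame_def
  proof (intro CollectI conjI allI impI)
    fix c assume "\<not> set_mset c \<subseteq> {..<R}"
    then obtain t where "t \<in># c" "R \<le> t" by (meson lessThan_iff not_le subsetI)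
    thus "\<phi> c = 0" using T(2) TR[of c] by (metis (mono_tags) mem_Collect_eq order_trans)
  next
    fix c s assume "R \<le> s"
    show "E (p ^ s) (\<phi> c) = 0"
    proof (cases "\<phi> c = 0")
      case False
      hence "T c \<le> R" using TR by simp
      thus ?thesis using T(1)[of c "p ^ s"] \<open>R \<le> s\<close> lt[of s] by linarith
    qed simp
  qed (rule \<phi>'(1))
  then obtain \<psi> where \<psi>: "\<psi> \<in> tame R R x k" "\<And>c. set_mset c \<subseteq> {..<R} \<Longrightarrow> diff \<psi> c = \<phi> c"
    using peel[OF ext order_refl x, of \<phi> R k] \<phi>'(2) by auto
  have "diff \<psi> c = \<phi> c" for c
  proof (cases "set_mset c \<subseteq> {..<R}")
    case False
    \<comment> \<open>A cell with an index \<open>s \<ge> R\<close> has a face below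
      \<open>R\<close> only if \<open>s\<close> occurs once, and the step along that face is
      \<open>E (p ^ s)\<close>, which kills the values of \<open>\<psi>\<close>.\<close>
    have "diff \<psi> c = 0"
      unfolding diff_def
    proof (rule sum.neutral, rule ballI)
      fix s assume s: "s \<in> set_mset c"
      show "dsign s c *s E (step_wt p s (count c s)) (\<psi> (c - {#s#})) = 0"
      proof (cases "set_mset (c - {#s#}) \<subseteq> {..<R}")
        case True
        moreover have "set_mset c = insert s (set_mset (c - {#s#}))" using s by (metis insert_DiffM set_mset_add_mset_insert)
        ultimately have "R \<le> s" using False by auto
        hence "s \<notin># c - {#s#}" using True by auto
        hence "count (c - {#s#}) s = 0" by (rule not_in_iff[THEN iffD1])
        hence "count c s \<le> 1" by simp
        moreover have "count c s > 0" using s by (rule count_greater_zero_iff[THEN iffD2])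
        ultimately have "count c s = 1" by linarith
        thus ?thesis using tameD(3)[OF \<psi>(1) \<open>R \<le> s\<close>] by (simp add: step_wt_def)
      next
        case False
        thus ?thesis using tameD(2)[OF \<psi>(1)] by simp
      qed
    qed
    moreover have "\<phi> c = 0" using \<open>\<phi> \<in> tame R R x (Suc k)\<close> False by (rule tameD(2))
    ultimately show ?thesis by simp
  qed (rule \<psi>(2))
  hence "\<phi> = diff \<psi>" by auto
  thus ?thesis using tameD(1)[OF \<psi>(1)] by (auto simp: coboundaries_def)
qed

end

section \<open>Dimension shifting\<close>

lemma sum_fun_apply: "(\<Sum>i\<in>A. f i) x = (\<Sum>i\<in>A. f i x)"
  by (induction A rule: infinite_finite_induct) simp_all

lemma dim_le_mono_B:
  assumes "dim_le s N Z B" and "B \<subseteq> B'"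
  shows "dim_le s N Z B'"
  unfolding dim_le_def
proof (intro allI impI)
  fix z assume "\<forall>i\<le>N. z i \<in> Z"
  then obtain a where "\<exists>i\<le>N. a i \<noteq> 0" "(\<Sum>i\<le>N. s (a i) (z i)) \<in> B"
    using assms(1)[unfolded dim_le_def, rule_format, of z] by auto
  thus "\<exists>a. (\<exists>i\<le>N. a i \<noteq> 0) \<and> (\<Sum>i\<le>N. s (a i) (z i)) \<in> B'" using assms(2) by blast
qed

lemma (in graded_module) kernel_graded_module:
  fixes d :: "'v \<Rightarrow> 'w::ab_group_add" and s2 :: "'k \<Rightarrow> 'w \<Rightarrow> 'w"
  assumes "vector_space s2"
    and add: "\<And>y v w. v \<in> W y \<Longrightarrow> w \<in> W y \<Longrightarrow> d (v + w) = d v + d w"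
    and scale: "\<And>y v c. v \<in> W y \<Longrightarrow> d (c *s v) = s2 c (d v)"
    and E2_0: "\<And>t. E2 t 0 = 0"
    and E: "\<And>y v t. v \<in> W y \<Longrightarrow> d (E t v) = E2 t (d v)"
  shows "graded_module scale (\<lambda>y. {v \<in> W y. d v = 0}) E p"
proof -
  interpret s2: vector_space s2 by fact
  have d0: "d 0 = 0" using scale[OF W_zero, of 0] by simp
  have "subspace {v \<in> W y. d v = 0}" for y
    by (rule subspaceI) (auto simp: W_zero W_add W_scale add scale d0)
  moreover have dE: "d (E t v) = 0" if "v \<in> W y" "d v = 0" for v y t
    using E[OF that(1)] that(2) E2_0 by simp
  ultimately show ?thesis
  proof (unfold_locales, goal_cases)
    case (5 v y w t)
    thus ?case using E_add by blast
  next
    case (6 v y t c)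
    thus ?case using E_scale by blast
  next
    case (7 v y t)
    thus ?case using E_W dE by blast
  next
    case (8 v y)
    thus ?case using E_0 by blast
  next
    case (9 v y s t)
    thus ?case using E_E by blast
  next
    case (10 v y)
    thus ?case using E_nilpotent by blast
  qed (use prime_p odd_p CHAR_p in auto)
qed

section \<open>The connecting map of a surjection, in terms of linear relations\<close>

locale graded_module_surjection =
  A: graded_module sA WA EA p + B: graded_module sB WB EB p
  for sA :: "'k::field \<Rightarrow> 'v::ab_group_add \<Rightarrow> 'v" and WA EA
    and sB :: "'k \<Rightarrow> 'w::ab_group_add \<Rightarrow> 'w" and WB EB and p +
  fixes d :: "'v \<Rightarrow> 'w"
  assumes d_add: "v \<in> WA y \<Longrightarrow> w \<in> WA y \<Longrightarrow> d (v + w) = d v + d w"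
    and d_scale: "v \<in> WA y \<Longrightarrow> d (sA c v) = sB c (d v)"
    and d_E: "v \<in> WA y \<Longrightarrow> d (EA t v) = EB t (d v)"
    and d_surj: "d ` WA y = WB y"
begin

lemma d_zero [simp]: "d 0 = 0"
  using d_scale[OF A.W_zero, where c = 0] by simp

lemma d_W: "v \<in> WA y \<Longrightarrow> d v \<in> WB y"
  using d_surj by blast

lemma d_sum: "finite S \<Longrightarrow> (\<And>i. i \<in> S \<Longrightarrow> f i \<in> WA y) \<Longrightarrow> d (sum f S) = (\<Sum>i\<in>S. d (f i))"
proof (induction S rule: finite_induct)
  case (insert i S)
  have "sum f S \<in> WA y" using insert.prems by (intro A.W_sum) simp
  thus ?case using insert d_add[of "f i" y "sum f S"] by simp
qed simp

sublocale K: graded_module sA "\<lambda>y. {v \<in> WA y. d v = 0}" EA p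
  by (rule A.kernel_graded_module[of sB d EB]) (fact B.vector_space_axioms d_add d_scale d_E B.E_zero)+

lemma d_cochain:
  assumes "\<phi> \<in> A.cochains x n"
  shows "(\<lambda>c. d (\<phi> c)) \<in> B.cochains x n"
proof -
  have "finite {c. d (\<phi> c) \<noteq> 0}"
    by (rule finite_subset[OF _ A.cochainsD(1)[OF assms]]) auto
  thus ?thesis using A.cochainsD(3)[OF assms] d_W[OF A.cochainsD(2)[OF assms]]
    by (auto simp: B.cochains_def)
qed

lemma d_diff:
  assumes "\<phi> \<in> A.cochains x n"
  shows "d (A.diff \<phi> c) = B.diff (\<lambda>c. d (\<phi> c)) c"
proof -
  have "d (A.diff \<phi> c) =
      (\<Sum>s\<in>set_mset c. d (sA (A.dsign s c) (EA (step_wt p s (count c s)) (\<phi> (c - {#s#})))))"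
    unfolding A.diff_def
    by (rule d_sum[where y = "x + 2 * int (cell_wt p c)"])
      (intro finite_set_mset, intro A.W_scale A.face_W[OF assms])
  also have "\<dots> = B.diff (\<lambda>c. d (\<phi> c)) c"
    unfolding B.diff_def
  proof (rule sum.cong[OF refl])
    fix s assume s: "s \<in> set_mset c"
    show "d (sA (A.dsign s c) (EA (step_wt p s (count c s)) (\<phi> (c - {#s#})))) =
        sB (B.dsign s c) (EB (step_wt p s (count c s)) (d (\<phi> (c - {#s#}))))"
      using d_scale[OF A.face_W[OF assms s]] d_E[OF A.cochainsD(2)[OF assms]]
      by (simp add: A.dsign_def B.dsign_def)
  qed
  finally show ?thesis .
qed

lemma cochain_lift:
  assumes "\<zeta> \<in> B.cochains x n"
  obtains \<phi> where "\<phi> \<in> A.cochains x n" and "\<And>c. d (\<phi> c) = \<zeta> c"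
proof -
  \<comment> \<open>Zero is lifted to zero, so that the lift has finite support.\<close>
  define \<phi> where "\<phi> c = (if \<zeta> c = 0 then 0 else SOME v. v \<in> WA (x + 2 * int (cell_wt p c)) \<and> d v = \<zeta> c)" for c
  have *: "\<phi> c \<in> WA (x + 2 * int (cell_wt p c)) \<and> d (\<phi> c) = \<zeta> c" for c
  proof (cases "\<zeta> c = 0")
    case False
    have "\<exists>v. v \<in> WA (x + 2 * int (cell_wt p c)) \<and> d v = \<zeta> c"
      using B.cochainsD(2)[OF assms, of c] d_surj by (metis imageE)
    from someI_ex[OF this] show ?thesis using False by (simp add: \<phi>_def)
  qed (simp add: \<phi>_def A.W_zero)
  have "finite {c. \<phi> c \<noteq> 0}"
    by (rule finite_subset[OF _ B.cochainsD(1)[OF assms]]) (auto simp: \<phi>_def)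
  hence "\<phi> \<in> A.cochains x n"
    using * B.cochainsD(3)[OF assms] by (auto simp: A.cochains_def \<phi>_def)
  thus ?thesis using that * by blast
qed

text \<open>The connecting homomorphism: the differentials of lifts of cocycles are cocycles of the
  kernel. A relation among them modulo the differential of some \<open>\<nu>\<close> in the kernel
  becomes a relation among the given cocycles, because the combined lift minus \<open>\<nu>\<close>
  is closed.\<close>

lemma dim_le_shift:
  assumes le: "dim_le (\<lambda>a \<phi> c. sA a (\<phi> c)) N (K.cocycles x (Suc k)) (K.coboundaries x (Suc k))"
  shows "dim_le (\<lambda>a \<phi> c. sB a (\<phi> c)) N (B.cocycles x k) ((\<lambda>\<phi> c. d (\<phi> c)) ` A.cocycles x k)"
  unfolding dim_le_def
proof (intro allI impI)
  fix z assume z: "\<forall>i\<le>N. z i \<in> B.cocycles x k"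
  hence "\<forall>i. \<exists>\<phi>. i \<le> N \<longrightarrow> \<phi> \<in> A.cochains x k \<and> (\<forall>c. d (\<phi> c) = z i c)"
    using cochain_lift by (metis (no_types, lifting) B.cocycles_def mem_Collect_eq)
  then obtain w where w: "\<And>i. i \<le> N \<Longrightarrow> w i \<in> A.cochains x k" "\<And>i c. i \<le> N \<Longrightarrow> d (w i c) = z i c"
    by metis
  have dw: "A.diff (w i) \<in> K.cocycles x (Suc k)" if "i \<le> N" for i
  proof -
    have "(\<lambda>c. d (w i c)) = z i" using w(2)[OF that] by auto
    hence "d (A.diff (w i) c) = 0" for c
      using d_diff[OF w(1)[OF that]] z that by (simp add: B.cocycles_def)
    moreover have "A.diff (w i) \<in> A.cochains x (Suc k)" by (rule A.diff_in_cochains[OF w(1)[OF that]])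
    ultimately show ?thesis using A.diff_diff[OF w(1)[OF that]]
      by (simp add: K.cocycles_def A.cochains_def K.cochains_def)
  qed
  obtain a where a: "\<exists>i\<le>N. a i \<noteq> 0"
    "(\<Sum>i\<le>N. (\<lambda>c. sA (a i) (A.diff (w i) c))) \<in> K.coboundaries x (Suc k)"
    using le[unfolded dim_le_def, rule_format, of "\<lambda>i. A.diff (w i)"] dw by auto
  then obtain \<nu> where \<nu>: "\<nu> \<in> K.cochains x k" "(\<Sum>i\<le>N. (\<lambda>c. sA (a i) (A.diff (w i) c))) = A.diff \<nu>"
    by (auto simp: K.coboundaries_def)
  have \<nu>A: "\<nu> \<in> A.cochains x k" and d\<nu>: "d (\<nu> c) = 0" for c
    using \<nu>(1) by (auto simp: A.cochains_def K.cochains_def)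
  define \<omega> where "\<omega> c = (\<Sum>i\<le>N. sA (a i) (w i c)) - \<nu> c" for c
  have s: "(\<lambda>c. \<Sum>i\<le>N. sA (a i) (w i c)) \<in> A.cochains x k"
    by (rule A.sum_cochain) (auto intro!: A.scale_cochain w(1))
  have \<omega>: "\<omega> \<in> A.cochains x k" unfolding \<omega>_def by (rule A.diff_cochain[OF s \<nu>A])
  have "A.diff \<omega> c = 0" for c
  proof -
    have "A.diff \<omega> c = A.diff (\<lambda>c. \<Sum>i\<le>N. sA (a i) (w i c)) c - A.diff \<nu> c"
      unfolding \<omega>_def by (rule A.diff_diff_cochain[OF s \<nu>A])
    also have "A.diff (\<lambda>c. \<Sum>i\<le>N. sA (a i) (w i c)) c = (\<Sum>i\<le>N. A.diff (\<lambda>c. sA (a i) (w i c)) c)"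
      by (rule A.diff_sum) (auto intro!: A.scale_cochain w(1))
    also have "\<dots> = (\<Sum>i\<le>N. sA (a i) (A.diff (w i) c))"
      by (rule sum.cong) (auto intro: A.diff_scale w(1))
    also have "\<dots> = A.diff \<nu> c" using fun_cong[OF \<nu>(2), of c] by (simp add: sum_fun_apply)
    finally show ?thesis by simp
  qed
  hence "\<omega> \<in> A.cocycles x k" using \<omega> by (auto simp: A.cocycles_def)
  moreover have "(\<Sum>i\<le>N. (\<lambda>c. sB (a i) (z i c))) = (\<lambda>c. d (\<omega> c))"
  proof
    fix c
    let ?y = "x + 2 * int (cell_wt p c)"
    have "d (\<omega> c + \<nu> c) = d (\<omega> c) + d (\<nu> c)"
      by (rule d_add[OF A.cochainsD(2)[OF \<omega>] A.cochainsD(2)[OF \<nu>A]])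
    hence "d (\<omega> c) = d (\<Sum>i\<le>N. sA (a i) (w i c))" by (simp add: d\<nu> \<omega>_def)
    also have "\<dots> = (\<Sum>i\<le>N. d (sA (a i) (w i c)))"
      by (rule d_sum[of _ _ ?y]) (auto intro!: A.W_scale A.cochainsD(2)[OF w(1)])
    also have "\<dots> = (\<Sum>i\<le>N. sB (a i) (z i c))"
      by (rule sum.cong) (auto simp: d_scale[OF A.cochainsD(2)[OF w(1)]] w(2))
    finally show "(\<Sum>i\<le>N. (\<lambda>c. sB (a i) (z i c))) c = d (\<omega> c)" by (simp add: sum_fun_apply)
  qed
  ultimately show "\<exists>a. (\<exists>i\<le>N. a i \<noteq> 0) \<and>
      (\<Sum>i\<le>N. (\<lambda>c. sB (a i) (z i c))) \<in> (\<lambda>\<phi> c. d (\<phi> c)) ` A.cocycles x k"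
    using a(1) by blast
qed

text \<open>In positive degree the middle module is acyclic, so images of its cocycles are
  coboundaries and the denominator becomes the usual one.\<close>

lemma dim_le_shift_Suc:
  assumes "A.socle_extension" and "0 \<le> x"
    and "dim_le (\<lambda>a \<phi> c. sA a (\<phi> c)) N (K.cocycles x (Suc (Suc k))) (K.coboundaries x (Suc (Suc k)))"
  shows "dim_le (\<lambda>a \<phi> c. sB a (\<phi> c)) N (B.cocycles x (Suc k)) (B.coboundaries x (Suc k))"
proof (rule dim_le_mono_B[OF dim_le_shift[OF assms(3)]])
  show "(\<lambda>\<phi> c. d (\<phi> c)) ` A.cocycles x (Suc k) \<subseteq> B.coboundaries x (Suc k)"
  proof
    fix \<zeta> assume "\<zeta> \<in> (\<lambda>\<phi> c. d (\<phi> c)) ` A.cocycles x (Suc k)"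
    then obtain \<phi> where "\<phi> \<in> A.cocycles x (Suc k)" "\<zeta> = (\<lambda>c. d (\<phi> c))" by blast
    moreover from this obtain \<psi> where "\<psi> \<in> A.cochains x k" "\<phi> = A.diff \<psi>"
      using A.cocycle_is_coboundary[OF assms(1,2)] by (auto simp: A.coboundaries_def)
    ultimately have "\<zeta> = B.diff (\<lambda>c. d (\<psi> c))" "(\<lambda>c. d (\<psi> c)) \<in> B.cochains x k"
      using d_diff d_cochain by auto
    thus "\<zeta> \<in> B.coboundaries x (Suc k)" by (auto simp: B.coboundaries_def)
  qed
qed

end

section \<open>Cohomology of a Weyl module\<close>

text \<open>The weight spaces of a Weyl module: one-dimensional, spanned by vectors
  \<open>b u\<close> with \<open>u\<close> counted from the lowest weight
  \<open>- m\<close>.\<close>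

locale weyl_graded_module = graded_module +
  fixes m :: nat and b :: "nat \<Rightarrow> 'b"
  assumes b_ne_0: "u \<le> m \<Longrightarrow> b u \<noteq> 0"
    and W_b: "v \<in> W y \<Longrightarrow> v \<noteq> 0 \<Longrightarrow> \<exists>u\<le>m. \<exists>c. y = 2 * int u - int m \<and> v = c *s b u"
    and b_W: "u \<le> m \<Longrightarrow> b u \<in> W (2 * int u - int m)"
    and E_b: "u \<le> m \<Longrightarrow> E t (b u) = (if u + t \<le> m then of_nat ((u + t) choose t) *s b (u + t) else 0)"
begin

lemma W_cases:
  assumes "v \<in> W (2 * int u - int m)"
  obtains c where "u \<le> m" and "v = c *s b u" | "v = 0"
proof (cases "v = 0")
  case False
  then obtain u' c where "u' \<le> m" "2 * int u - int m = 2 * int u' - int m" "v = c *s b u'"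
    using W_b[OF assms] by blast
  thus ?thesis using that(1) by auto
qed (use that(2) in blast)

lemma E_injective:
  assumes "v \<in> W (2 * int u - int m)" and "u + t \<le> m" and "(of_nat ((u + t) choose t) :: 'a) \<noteq> 0"
    and "E t v = 0"
  shows "v = 0"
  using assms(1)
proof (rule W_cases)
  fix c assume "u \<le> m" "v = c *s b u"
  hence "(c * of_nat ((u + t) choose t)) *s b (u + t) = 0"
    using assms(2,4) E_scale[OF b_W, of u t c] by (simp add: E_b)
  hence "c = 0" using assms(3) b_ne_0[OF assms(2)] by simp
  thus "v = 0" using \<open>v = c *s b u\<close> by simp
qed

lemma E_surjective:
  assumes "v \<in> W (2 * int (u + t) - int m)" and "(of_nat ((u + t) choose t) :: 'a) \<noteq> 0"
  shows "\<exists>v'\<in>W (2 * int u - int m). E t v' = v"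
  using assms(1)
proof (rule W_cases)
  fix c assume v: "u + t \<le> m" "v = c *s b (u + t)"
  let ?v = "(c / of_nat ((u + t) choose t)) *s b u"
  have "?v \<in> W (2 * int u - int m)" using v(1) by (intro W_scale b_W) simp
  moreover have "E t ?v = v" using E_scale[OF b_W, of u t] v assms(2) by (simp add: E_b)
  ultimately show ?thesis by blast
next
  assume "v = 0"
  thus ?thesis by (intro bexI[of _ 0]) (auto simp: W_zero)
qed

end

text \<open>
  The matching pairs \<open>c\<close> with \<open>add_mset s c\<close> where \<open>s\<close> is the pivot; \<open>upper_cell\<close> picks out the
  larger member of a pair, and unmatched cells are the critical ones.
\<close>

definition is_pivot :: "nat \<Rightarrow> nat multiset \<Rightarrow> nat \<Rightarrow> bool" where
  "is_pivot \<sigma> c s \<longleftrightarrow> (\<forall>i\<in>#c. s \<le> i) \<and> s \<le> \<sigma> \<and> (s = \<sigma> \<or> s \<in># c)"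

definition upper_cell :: "nat \<Rightarrow> nat multiset \<Rightarrow> nat \<Rightarrow> bool" where
  "upper_cell \<sigma> c s \<longleftrightarrow> (odd (count c s) \<longleftrightarrow> s = \<sigma>)"

text \<open>The pivot is the smallest among \<open>\<sigma>\<close> and the indices of the
  cell.\<close>

lemma ex_pivot: "\<exists>s. is_pivot \<sigma> c s"
proof (cases "\<forall>i\<in>#c. \<sigma> \<le> i")
  case True
  thus ?thesis by (auto simp: is_pivot_def)
next
  case False
  then obtain i where i: "i \<in># c" "i < \<sigma>" by auto
  have "Min (set_mset c) \<in># c" using i(1) by (intro Min_in) auto
  moreover have "\<forall>j\<in>#c. Min (set_mset c) \<le> j" by simp
  moreover from this have "Min (set_mset c) < \<sigma>" using i by (meson le_less_trans)
  ultimately show ?thesis unfolding is_pivot_def by (metis less_imp_le)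
qed

lemma pivot_unique:
  assumes "is_pivot \<sigma> c s" and "is_pivot \<sigma> c t"
  shows "s = t"
  using assms unfolding is_pivot_def by (meson le_antisym)

lemma pivot_add: "is_pivot \<sigma> c s \<Longrightarrow> is_pivot \<sigma> (add_mset s c) s"
  by (auto simp: is_pivot_def)

lemma upper_cell_add: "upper_cell \<sigma> (add_mset s c) s \<longleftrightarrow> \<not> upper_cell \<sigma> c s"
  by (auto simp: upper_cell_def)

text \<open>Among the faces of an upper cell only the one that drops the pivot can be a lower cell,
  so the differential from lower to upper cells is diagonal with respect to the matching.\<close>

lemma upper_face:
  assumes "is_pivot \<sigma> c s" and "upper_cell \<sigma> c s" and "t \<noteq> s"
  shows "is_pivot \<sigma> (c - {#t#}) s" and "upper_cell \<sigma> (c - {#t#}) s"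
proof -
  have cnt: "count (c - {#t#}) s = count c s" using assms(3) by simp
  thus "upper_cell \<sigma> (c - {#t#}) s" using assms(2) by (simp add: upper_cell_def)
  have "s \<in># c \<longleftrightarrow> s \<in># c - {#t#}" using cnt by (metis not_in_iff)
  thus "is_pivot \<sigma> (c - {#t#}) s" using assms(1) by (auto simp: is_pivot_def dest: in_diffD)
qed

text \<open>Below \<open>\<sigma>\<close> an upper cell has an even and positive number of copies of
  its pivot. One copy survives the removal, so the pivot does not move.\<close>

lemma upper_remove_pivot:
  assumes "is_pivot \<sigma> c s" and "upper_cell \<sigma> c s" and "s \<in># c"
  shows "is_pivot \<sigma> (c - {#s#}) s" and "\<not> upper_cell \<sigma> (c - {#s#}) s"
proof -
  obtain a where a: "c = add_mset s a" using assms(3) by (blast dest: multi_member_split)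
  show "\<not> upper_cell \<sigma> (c - {#s#}) s" using assms(2) by (simp add: a upper_cell_add)
  have "s \<in># a" if "s \<noteq> \<sigma>"
  proof -
    have "odd (count a s)" using assms(2) that by (simp add: upper_cell_def a)
    thus ?thesis by (metis even_zero not_in_iff)
  qed
  thus "is_pivot \<sigma> (c - {#s#}) s" using assms(1) by (auto simp: is_pivot_def a)
qed

text \<open>An even number of copies of \<open>s\<close> consists of whole blocks
  \<open>p ^ Suc s\<close>, and larger indices contribute multiples of it anyway.\<close>

lemma power_dvd_cell_wt:
  assumes "\<forall>i\<in>#c. s \<le> i" and "even (count c s)"
  shows "p ^ Suc s dvd cell_wt p c"
  unfolding cell_wt_def
proof (rule dvd_sum)
  fix i assume "i \<in> set_mset c"
  show "p ^ Suc s dvd p ^ i * (p * (count c i div 2) + count c i mod 2)"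
  proof (cases "i = s")
    case True
    thus ?thesis using assms(2) by (simp add: mult.assoc[symmetric])
  next
    case False
    hence "Suc s \<le> i" using assms(1) \<open>i \<in> set_mset c\<close> by (metis Suc_leI le_neq_implies_less)
    thus ?thesis by (intro dvd_mult2 le_imp_power_dvd)
  qed
qed

lemma div_eq_if_Suc_eq:
  assumes "(P::nat) > 0" and "Suc t = P * Q + P"
  shows "t div P = Q"
proof -
  have "P * Q \<le> t" "t < P * Q + P" using assms by linarith+
  thus ?thesis by (intro div_nat_eqI) (simp_all add: mult.commute)
qed

text \<open>The predecessor of a multiple of \<open>p ^ Suc s\<close> ends in digits
  \<open>p - 1\<close> up to position \<open>s\<close>.\<close>

lemma top_digit:
  assumes "p > (0::nat)" and "Suc t = p ^ Suc s * Q"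
  shows "t div p ^ s mod p = p - 1"
proof -
  have "Q \<noteq> 0" using assms(2) by (cases Q) auto
  then obtain Q' where Q: "Q = Suc Q'" by (cases Q) auto
  have "Suc t = p ^ s * (p * Q' + (p - 1)) + p ^ s"
  proof -
    have "p * Q = (p * Q' + (p - 1)) + 1" using assms(1) by (simp add: Q)
    hence "p ^ s * (p * Q) = p ^ s * (p * Q' + (p - 1)) + p ^ s" by (simp only: distrib_left mult_1_right)
    thus ?thesis using assms(2) by (simp add: mult_ac)
  qed
  hence "t div p ^ s = p * Q' + (p - 1)"
    using assms(1) by (intro div_eq_if_Suc_eq) auto
  hence "t div p ^ s mod p = (p - 1) mod p" by (simp only: mod_mult_self4)
  thus ?thesis using assms(1) by simp
qed

context graded_module
begin

lemma coboundaries_subset_cocycles: "coboundaries x n \<subseteq> cocycles x n"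
  by (auto simp: coboundaries_def cocycles_def diff_in_cochains diff_diff split: nat.splits)

lemma zero_coboundary: "(\<lambda>_. 0) \<in> coboundaries x n"
  unfolding coboundaries_def
  by (cases n) (auto intro!: image_eqI[of _ _ "\<lambda>_. 0"])

lemma coboundaries_sum:
  assumes "\<And>i. i \<le> (N::nat) \<Longrightarrow> \<beta> i \<in> coboundaries x n"
  shows "(\<lambda>c. \<Sum>i\<le>N. a i *s \<beta> i c) \<in> coboundaries x n"
proof (cases n)
  case 0
  hence "\<beta> i = (\<lambda>_. 0)" if "i \<le> N" for i using assms[OF that] by (simp add: coboundaries_def)
  thus ?thesis using 0 by (simp add: coboundaries_def)
next
  case (Suc k)
  hence "\<forall>i. \<exists>\<psi>. i \<le> N \<longrightarrow> \<psi> \<in> cochains x k \<and> \<beta> i = diff \<psi>" using assms by (fastforce simp: coboundaries_def)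
  then obtain \<psi> where \<psi>: "\<And>i. i \<le> N \<Longrightarrow> \<psi> i \<in> cochains x k" "\<And>i. i \<le> N \<Longrightarrow> \<beta> i = diff (\<psi> i)" by metis
  have "diff (\<lambda>c. \<Sum>i\<le>N. a i *s \<psi> i c) c = (\<Sum>i\<le>N. a i *s \<beta> i c)" for c
  proof -
    have "diff (\<lambda>c. \<Sum>i\<le>N. a i *s \<psi> i c) c = (\<Sum>i\<le>N. diff (\<lambda>c. a i *s \<psi> i c) c)"
      by (rule diff_sum) (auto intro!: scale_cochain \<psi>(1))
    also have "\<dots> = (\<Sum>i\<le>N. a i *s \<beta> i c)"
      by (rule sum.cong) (auto simp: \<psi>(2) intro: diff_scale \<psi>(1))
    finally show ?thesis .
  qed
  hence "(\<lambda>c. \<Sum>i\<le>N. a i *s \<beta> i c) = diff (\<lambda>c. \<Sum>i\<le>N. a i *s \<psi> i c)" by auto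
  moreover have "(\<lambda>c. \<Sum>i\<le>N. a i *s \<psi> i c) \<in> cochains x k"
    by (rule sum_cochain) (auto intro!: scale_cochain \<psi>(1))
  ultimately show ?thesis using Suc by (auto simp: coboundaries_def)
qed

end

context weyl_graded_module
begin

context
  fixes m2 g \<sigma> :: nat
  assumes m: "m = m2 + 2 * g"
    and dvd: "p ^ \<sigma> dvd Suc (m2 + g)" and ndvd: "\<not> p ^ Suc \<sigma> dvd Suc (m2 + g)"
begin

text \<open>By Lucas only the digit at the pivot \<open>s\<close> matters. At
  \<open>s = \<sigma>\<close> it is \<open>q mod p\<close> with \<open>q\<close> prime to
  \<open>p\<close>, and X asks for a non-zero digit. Below \<open>\<sigma>\<close> the upper index
  is one less than a multiple of \<open>p ^ Suc s\<close>, so its digit is \<open>p - 1\<close>, as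
  X^(p-1) demands.\<close>

lemma lower_binomial_ne_0:
  assumes piv: "is_pivot \<sigma> c s" and low: "\<not> upper_cell \<sigma> c s"
  defines "a \<equiv> step_wt p s (Suc (count c s))"
  shows "(of_nat ((m2 + g + cell_wt p c + a) choose a) :: 'a) \<noteq> 0"
proof (cases "s = \<sigma>")
  case True
  have even: "even (count c s)" using low True by (simp add: upper_cell_def)
  hence a: "a = 1 * p ^ s" by (simp add: a_def step_wt_def)
  obtain K where K: "cell_wt p c = p ^ Suc s * K"
    using power_dvd_cell_wt[OF _ even, of p] piv by (auto simp: is_pivot_def elim: dvdE)
  obtain q where q: "Suc (m2 + g) = p ^ s * q" using dvd True by (auto elim: dvdE)
  have "\<not> p dvd q"
  proof
    assume "p dvd q"
    hence "p ^ Suc s dvd p ^ s * q" by (simp add: mult_dvd_mono mult.commute)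
    thus False using ndvd True q by simp
  qed
  have "Suc (m2 + g + cell_wt p c + a) = p ^ s * (q + p * K) + p ^ s"
    using q K a by (simp add: algebra_simps)
  hence "(m2 + g + cell_wt p c + a) div p ^ s = q + p * K"
    using p_pos by (intro div_eq_if_Suc_eq) auto
  hence "(m2 + g + cell_wt p c + a) div p ^ s mod p = q mod p" by simp
  moreover have "q mod p \<noteq> 0" using \<open>\<not> p dvd q\<close> by (simp add: mod_eq_0_iff_dvd)
  ultimately show ?thesis
    using of_nat_choose_digit_eq_0_iff[OF prime_p CHAR_p, of 1 "m2 + g + cell_wt p c + a" s] p_gt_1
    by (simp add: a)
next
  case False
  hence s: "s < \<sigma>" "s \<in># c" and mn: "\<forall>i\<in>#c. s \<le> i" using piv by (auto simp: is_pivot_def)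
  have odd: "odd (count c s)" using low False by (simp add: upper_cell_def)
  hence a: "a = (p - 1) * p ^ s" by (simp add: a_def step_wt_def)
  have "p ^ Suc s dvd cell_wt p (c - {#s#})"
    by (rule power_dvd_cell_wt) (use mn odd in \<open>auto dest: in_diffD\<close>)
  then obtain K where K: "cell_wt p (c - {#s#}) = p ^ Suc s * K" by (auto elim: dvdE)
  have "p ^ Suc s dvd p ^ \<sigma>" using s(1) by (intro le_imp_power_dvd) simp
  then obtain q where q: "Suc (m2 + g) = p ^ Suc s * q" using dvd dvd_trans by (blast elim: dvdE)
  have wt: "cell_wt p c = p ^ Suc s * K + p ^ s"
    using cell_wt_remove[OF p_pos s(2)] odd K by (simp add: step_wt_def)
  have "p ^ s + (p - 1) * p ^ s = p ^ Suc s" using p_pos by (simp flip: mult_Suc)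
  hence "Suc (m2 + g + cell_wt p c + a) = p ^ Suc s * (q + K + 1)"
    using q wt a by (simp add: distrib_left)
  from top_digit[OF p_pos this]
  show ?thesis
    using of_nat_choose_digit_eq_0_iff[OF prime_p CHAR_p, of "p - 1" "m2 + g + cell_wt p c + a" s] p_gt_1
    by (simp add: a)
qed

lemma weight_eq: "int m2 + 2 * int k = 2 * int (m2 + g + k) - int m"
  using m by simp

lemma W_above:
  assumes "v \<in> W (int m2 + 2 * int k)" and "g < k"
  shows "v = 0"
  using assms(1) unfolding weight_eq by (rule W_cases) (use assms(2) m in auto)

lemma not_upper_imp_critical:
  assumes "size c = n" and "cell_wt p c \<le> g" and piv: "is_pivot \<sigma> c s" and low: "\<not> upper_cell \<sigma> c s"
    and top: "g < cell_wt p c + step_wt p s (Suc (count c s))"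
  shows "c \<in> critical_cells p \<sigma> g n"
proof (cases "s = \<sigma>")
  case True
  hence "low_critical p g \<sigma> c" using piv low top
    by (auto simp: low_critical_def is_pivot_def upper_cell_def step_wt_def)
  thus ?thesis using assms(1,2) by (simp add: critical_cells_def)
next
  case False
  hence "s < \<sigma>" "top_critical p g s c" using piv low top
    by (auto simp: top_critical_def is_pivot_def upper_cell_def step_wt_def)
  thus ?thesis using assms(1,2) by (auto simp: critical_cells_def)
qed

text \<open>At the partner of a lower cell the cocycle condition has a single term left, since all
  other faces are upper cells. The step in it is injective unless the partner lies beyond the
  highest weight, and then the cell is critical.\<close>

lemma vanishes_off_critical:
  assumes \<phi>: "\<phi> \<in> cocycles (int m2) n"
    and up: "\<And>c s. is_pivot \<sigma> c s \<Longrightarrow> upper_cell \<sigma> c s \<Longrightarrow> \<phi> c = 0"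
    and ne: "\<phi> c \<noteq> 0"
  shows "c \<in> critical_cells p \<sigma> g n"
proof -
  have \<phi>': "\<phi> \<in> cochains (int m2) n" "\<And>c. diff \<phi> c = 0" using \<phi> by (auto simp: cocycles_def)
  have sz: "size c = n" using cochainsD(3)[OF \<phi>'(1), of c] ne by blast
  have g: "cell_wt p c \<le> g" using W_above[OF cochainsD(2)[OF \<phi>'(1), of c]] ne by (metis not_le)
  obtain s where piv: "is_pivot \<sigma> c s" using ex_pivot by blast
  have low: "\<not> upper_cell \<sigma> c s" using up[OF piv] ne by blast
  define a where "a = step_wt p s (Suc (count c s))"
  show ?thesis
  proof (cases "cell_wt p c + a \<le> g")
    case True
    let ?b = "add_mset s c"
    have "0 = diff \<phi> ?b" using \<phi>'(2) by simp
    also have "\<dots> = (\<Sum>t\<in>set_mset ?b. if t = s then dsign s ?b *s E a (\<phi> c) else 0)"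
      unfolding diff_def
    proof (rule sum.cong[OF refl])
      fix t assume "t \<in> set_mset ?b"
      show "dsign t ?b *s E (step_wt p t (count ?b t)) (\<phi> (?b - {#t#})) =
          (if t = s then dsign s ?b *s E a (\<phi> c) else 0)"
      proof (cases "t = s")
        case False
        have "upper_cell \<sigma> ?b s" using low by (simp add: upper_cell_add)
        from upper_face[OF pivot_add[OF piv] this False] have "\<phi> (?b - {#t#}) = 0" by (rule up)
        thus ?thesis using False by simp
      qed (simp add: a_def)
    qed
    also have "\<dots> = dsign s ?b *s E a (\<phi> c)" by (subst sum.delta) auto
    finally have "E a (\<phi> c) = 0" using dsign_ne_0[of s ?b] scale_eq_0_iff by metis
    moreover have "\<phi> c \<in> W (2 * int (m2 + g + cell_wt p c) - int m)"
      using cochainsD(2)[OF \<phi>'(1), of c] unfolding weight_eq .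
    moreover have "m2 + g + cell_wt p c + a \<le> m" using True m by simp
    ultimately have "\<phi> c = 0"
      using E_injective lower_binomial_ne_0[OF piv low] unfolding a_def by blast
    thus ?thesis using ne by simp
  next
    case False
    thus ?thesis using not_upper_imp_critical[OF sz g piv low] by (simp add: a_def)
  qed
qed

text \<open>A cochain on the lower cells can be chosen one pair at a time: its differential at an
  upper cell sees only the lower partner, where the step is surjective. No iteration along the
  matching is needed.\<close>

lemma eliminate_upper:
  assumes \<phi>: "\<phi> \<in> cochains (int m2) n"
  shows "\<exists>\<beta>\<in>coboundaries (int m2) n. \<forall>c s. is_pivot \<sigma> c s \<longrightarrow> upper_cell \<sigma> c s \<longrightarrow> \<phi> c = \<beta> c"
proof (cases n)
  case 0
  have "\<phi> c = 0" if "is_pivot \<sigma> c s" "upper_cell \<sigma> c s" for c s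
  proof -
    \<comment> \<open>The empty cell has pivot \<open>\<sigma>\<close> with an even number of
      copies, so it is a lower cell.\<close>
    have "c \<noteq> {#}" using that by (auto simp: is_pivot_def upper_cell_def)
    thus ?thesis using cochainsD(3)[OF \<phi>, of c] 0 by simp
  qed
  thus ?thesis using 0 by (auto simp: coboundaries_def)
next
  case (Suc k)
  define piv where "piv c = (SOME s. is_pivot \<sigma> c s)" for c
  have piv: "is_pivot \<sigma> c (piv c)" for c unfolding piv_def by (rule someI_ex[OF ex_pivot])
  define a where "a c = step_wt p (piv c) (Suc (count c (piv c)))" for c
  define up where "up c = add_mset (piv c) c" for c
  \<comment> \<open>The bound by \<open>g\<close> keeps the support of \<open>\<psi>\<close> finite;
    cells of larger weight carry only the zero vector.\<close>
  define L where "L = {c. size c = k \<and> \<not> upper_cell \<sigma> c (piv c) \<and> cell_wt p c \<le> g}"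
  have wt_up: "cell_wt p (up c) = cell_wt p c + a c" for c
    by (simp add: up_def a_def cell_wt_add_mset[OF p_pos])
  have ex: "\<exists>v. v \<in> W (int m2 + 2 * int (cell_wt p c)) \<and> E (a c) v = dsign (piv c) (up c) *s \<phi> (up c)"
    if c: "c \<in> L" for c
  proof -
    have "\<phi> (up c) \<in> W (2 * int (m2 + g + cell_wt p c + a c) - int m)"
      using cochainsD(2)[OF \<phi>, of "up c"] unfolding weight_eq wt_up by (simp add: add.assoc)
    hence "dsign (piv c) (up c) *s \<phi> (up c) \<in> W (2 * int (m2 + g + cell_wt p c + a c) - int m)" by (rule W_scale)
    moreover have "(of_nat ((m2 + g + cell_wt p c + a c) choose a c) :: 'a) \<noteq> 0"
      using lower_binomial_ne_0[OF piv] c unfolding a_def by (simp add: L_def)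
    ultimately show ?thesis using E_surjective unfolding weight_eq by blast
  qed
  \<comment> \<open>The sign \<open>dsign\<close> is its own inverse and cancels the one in
    \<open>diff\<close>.\<close>
  define \<psi> where "\<psi> c = (if c \<in> L then SOME v. v \<in> W (int m2 + 2 * int (cell_wt p c)) \<and>
      E (a c) v = dsign (piv c) (up c) *s \<phi> (up c) else 0)" for c
  have \<psi>L: "\<psi> c \<in> W (int m2 + 2 * int (cell_wt p c)) \<and> E (a c) (\<psi> c) = dsign (piv c) (up c) *s \<phi> (up c)"
    if "c \<in> L" for c
    using someI_ex[OF ex[OF that]] that by (simp add: \<psi>_def)
  have "finite {c. \<psi> c \<noteq> 0}"
    by (rule finite_subset[OF _ finite_cells[OF p_gt_1, of k g]]) (auto simp: \<psi>_def L_def)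
  moreover have "\<psi> c \<in> W (int m2 + 2 * int (cell_wt p c))" for c
    using \<psi>L[of c] by (cases "c \<in> L") (auto simp: \<psi>_def W_zero)
  moreover have "\<psi> c = 0" if "size c \<noteq> k" for c using that by (simp add: \<psi>_def L_def)
  ultimately have \<psi>: "\<psi> \<in> cochains (int m2) k" by (simp add: cochains_def)
  have "\<phi> c = diff \<psi> c" if ps: "is_pivot \<sigma> c s" and us: "upper_cell \<sigma> c s" for c s
  proof (cases "size c = Suc k \<and> cell_wt p c \<le> g")
    case True
    have s: "s \<in># c"
    proof (rule ccontr)
      assume "s \<notin># c"
      hence "s = \<sigma>" using ps by (simp add: is_pivot_def)
      moreover have "count c s = 0" using \<open>s \<notin># c\<close> by (rule not_in_iff[THEN iffD1])
      ultimately show False using us by (simp add: upper_cell_def)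
    qed
    define b where "b = c - {#s#}"
    have cb: "c = add_mset s b" using s by (simp add: b_def)
    note rb = upper_remove_pivot[OF ps us s, folded b_def]
    have pb: "piv b = s" using pivot_unique[OF piv rb(1)] .
    have upb: "up b = c" using cb by (simp add: up_def pb)
    have "b \<in> L" using True rb(2) cb wt_up[of b] by (simp add: L_def pb upb)
    have "diff \<psi> c = (\<Sum>t\<in>set_mset c. if t = s then dsign s c *s E (a b) (\<psi> b) else 0)"
      unfolding diff_def
    proof (rule sum.cong[OF refl])
      fix t assume "t \<in> set_mset c"
      show "dsign t c *s E (step_wt p t (count c t)) (\<psi> (c - {#t#})) =
          (if t = s then dsign s c *s E (a b) (\<psi> b) else 0)"
      proof (cases "t = s")
        case True
        thus ?thesis by (simp add: a_def pb cb)
      next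
        case False
        note uf = upper_face[OF ps us False]
        have "piv (c - {#t#}) = s" using pivot_unique[OF piv uf(1)] .
        hence "\<psi> (c - {#t#}) = 0" using uf(2) by (simp add: \<psi>_def L_def)
        thus ?thesis using False by simp
      qed
    qed
    also have "\<dots> = dsign s c *s E (a b) (\<psi> b)" using s by (subst sum.delta) auto
    also have "\<dots> = \<phi> c" using \<psi>L[OF \<open>b \<in> L\<close>] by (simp add: pb upb)
    finally show ?thesis by simp
  next
    case False
    hence "\<phi> c = 0" "diff \<psi> c = 0"
      using cochainsD(3)[OF \<phi>, of c] cochainsD(3)[OF diff_in_cochains[OF \<psi>], of c] Suc
        W_above[OF cochainsD(2)[OF \<phi>, of c]] W_above[OF cochainsD(2)[OF diff_in_cochains[OF \<psi>], of c]]
      by (auto simp: not_le)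
    thus ?thesis by simp
  qed
  moreover have "diff \<psi> \<in> coboundaries (int m2) n" using \<psi> Suc by (auto simp: coboundaries_def)
  ultimately show ?thesis by blast
qed

text \<open>Modulo coboundaries a cocycle is given by one scalar for each critical cell, so a family
  larger than the number of these cells is dependent.\<close>

lemma dim_le_critical_cells:
  assumes N: "card (critical_cells p \<sigma> g n) \<le> N"
  shows "dim_le (\<lambda>a \<phi> c. a *s \<phi> c) N (cocycles (int m2) n) (coboundaries (int m2) n)"
  unfolding dim_le_def
proof (intro allI impI)
  fix z assume z: "\<forall>i\<le>N. z i \<in> cocycles (int m2) n"
  let ?C = "critical_cells p \<sigma> g n"
  have finC: "finite ?C"
    by (rule finite_subset[OF _ finite_cells[OF p_gt_1, of n g]]) (auto simp: critical_cells_def)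
  have "\<exists>\<beta>\<in>coboundaries (int m2) n. \<forall>c. c \<notin> ?C \<longrightarrow> z i c = \<beta> c" if i: "i \<le> N" for i
  proof -
    have zi: "z i \<in> cochains (int m2) n" "diff (z i) = (\<lambda>_. 0)" using z i by (auto simp: cocycles_def)
    obtain \<beta> where \<beta>: "\<beta> \<in> coboundaries (int m2) n"
      "\<And>c s. is_pivot \<sigma> c s \<Longrightarrow> upper_cell \<sigma> c s \<Longrightarrow> z i c = \<beta> c"
      using eliminate_upper[OF zi(1)] by blast
    have \<beta>': "\<beta> \<in> cochains (int m2) n" "diff \<beta> = (\<lambda>_. 0)"
      using \<beta>(1) coboundaries_subset_cocycles by (auto simp: cocycles_def)
    have "(\<lambda>c. z i c - \<beta> c) \<in> cocycles (int m2) n"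
      using diff_cochain[OF zi(1) \<beta>'(1)] diff_diff_cochain[OF zi(1) \<beta>'(1)] zi(2) \<beta>'(2)
      by (auto simp: cocycles_def)
    from vanishes_off_critical[OF this] have "z i c - \<beta> c = 0" if "c \<notin> ?C" for c
      using that \<beta>(2) by auto
    thus ?thesis using \<beta>(1) by auto
  qed
  then obtain \<beta> where \<beta>: "\<And>i. i \<le> N \<Longrightarrow> \<beta> i \<in> coboundaries (int m2) n"
    "\<And>i c. i \<le> N \<Longrightarrow> c \<notin> ?C \<Longrightarrow> z i c = \<beta> i c" by metis
  have "\<exists>k. z i c - \<beta> i c = k *s b (m2 + g + cell_wt p c)" if i: "i \<le> N" for i c
  proof -
    have "z i c - \<beta> i c \<in> W (2 * int (m2 + g + cell_wt p c) - int m)"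
      unfolding weight_eq[symmetric]
      using z i \<beta>(1)[OF i] coboundaries_subset_cocycles by (intro W_diff cochainsD(2)) (auto simp: cocycles_def)
    thus ?thesis by (rule W_cases) (auto intro: exI[of _ 0])
  qed
  then obtain \<kappa> where \<kappa>: "\<And>i c. i \<le> N \<Longrightarrow> z i c - \<beta> i c = \<kappa> i c *s b (m2 + g + cell_wt p c)" by metis
  have "card ?C < card {..N}" using N by simp
  from homogeneous_system[OF finC _ this, of \<kappa>] obtain a where
    a: "\<exists>i\<in>{..N}. a i \<noteq> 0" "\<forall>c\<in>?C. (\<Sum>i\<le>N. a i * \<kappa> i c) = 0" by auto
  have "(\<Sum>i\<le>N. a i *s z i c) = (\<Sum>i\<le>N. a i *s \<beta> i c)" for c
  proof -
    have "(\<Sum>i\<le>N. a i *s z i c) - (\<Sum>i\<le>N. a i *s \<beta> i c) = (\<Sum>i\<le>N. a i *s (z i c - \<beta> i c))"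
      by (simp add: scale_right_diff_distrib sum_subtractf)
    also have "\<dots> = 0"
    proof (cases "c \<in> ?C")
      case True
      have "(\<Sum>i\<le>N. a i *s (z i c - \<beta> i c)) = (\<Sum>i\<le>N. (a i * \<kappa> i c) *s b (m2 + g + cell_wt p c))"
        by (rule sum.cong) (auto simp: \<kappa>)
      also have "\<dots> = (\<Sum>i\<le>N. a i * \<kappa> i c) *s b (m2 + g + cell_wt p c)" by (simp add: scale_sum_left)
      finally show ?thesis using a(2) True by simp
    next
      case False
      thus ?thesis using \<beta>(2) by (intro sum.neutral) auto
    qed
    finally show ?thesis by simp
  qed
  hence "(\<Sum>i\<le>N. (\<lambda>c. a i *s z i c)) = (\<lambda>c. \<Sum>i\<le>N. a i *s \<beta> i c)"
    by (auto simp: sum_fun_apply)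
  thus "\<exists>a. (\<exists>i\<le>N. a i \<noteq> 0) \<and> (\<Sum>i\<le>N. (\<lambda>c. a i *s z i c)) \<in> coboundaries (int m2) n"
    using a(1) coboundaries_sum[of N \<beta> "int m2" n a] \<beta>(1) by (intro exI[of _ a]) auto
qed

end

theorem dim_le_fib:
  assumes n: "n \<le> 2 * p - 3" and r: "r \<ge> 1" and m2: "m2 < p ^ r"
  shows "dim_le (\<lambda>a \<phi> c. a *s \<phi> c) (fib (n + 1) + (r - 1) * fib n) (cocycles (int m2) n) (coboundaries (int m2) n)"
proof (cases "m2 \<le> m \<and> even (m - m2)")
  case True
  hence "even (m - m2)" by (rule conjunct2)
  then obtain g where g: "m - m2 = 2 * g" by (rule evenE)
  hence m: "m = m2 + 2 * g" using True by simp
  define \<sigma> where "\<sigma> = multiplicity p (Suc (m2 + g))"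
  have "p ^ \<sigma> dvd Suc (m2 + g)" unfolding \<sigma>_def by (rule multiplicity_dvd)
  moreover have "\<not> p ^ Suc \<sigma> dvd Suc (m2 + g)"
  proof
    assume "p ^ Suc \<sigma> dvd Suc (m2 + g)"
    hence "Suc \<sigma> \<le> multiplicity p (Suc (m2 + g))"
      using p_gt_1 by (intro multiplicity_geI) auto
    thus False by (simp add: \<sigma>_def)
  qed
  ultimately show ?thesis
    using card_critical_cells[OF p_ge_3 n r m2, of \<sigma> g] by (intro dim_le_critical_cells[OF m])
next
  case False
  \<comment> \<open>All weights of the module have the parity of \<open>m\<close> and are at most
    \<open>m\<close>, so in this case every cochain of weight \<open>m2\<close> is zero.\<close>
  have W0: "v = 0" if "v \<in> W (int m2 + 2 * int k)" for v k
  proof (rule ccontr)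
    assume "v \<noteq> 0"
    then obtain u where u: "u \<le> m" "int m2 + 2 * int k = 2 * int u - int m" using W_b[OF \<open>v \<in> _\<close>] by blast
    hence "m2 \<le> m" by linarith
    moreover have "int (m - m2) = 2 * (int u - int m2 - int k)" using u \<open>m2 \<le> m\<close> by simp
    hence "even (int (m - m2))" by simp
    hence "even (m - m2)" by (simp only: even_of_nat)
    ultimately show False using False by simp
  qed
  let ?N = "fib (n + 1) + (r - 1) * fib n"
  show ?thesis
    unfolding dim_le_def
  proof (intro allI impI)
    fix z assume z: "\<forall>i\<le>?N. z i \<in> cocycles (int m2) n"
    have "z i c = 0" if "i \<le> ?N" for i c
      using z that W0 cochainsD(2)[of "z i" "int m2" n c] by (simp add: cocycles_def)
    hence "(\<Sum>i\<le>?N. (\<lambda>c. 1 *s z i c)) = (\<lambda>_. 0)" by (auto simp: sum_fun_apply)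
    thus "\<exists>a. (\<exists>i\<le>?N. a i \<noteq> 0) \<and> (\<Sum>i\<le>?N. (\<lambda>c. a i *s z i c)) \<in> coboundaries (int m2) n"
      using zero_coboundary by (intro exI[of _ "\<lambda>_. 1"]) auto
  qed
qed

end

section \<open>Rational modules as graded modules\<close>

definition mat2 :: "'k \<Rightarrow> 'k \<Rightarrow> 'k \<Rightarrow> 'k \<Rightarrow> 'k ^ 2 ^ 2" where
  "mat2 a b c d = (\<chi> i j. if i = 1 then (if j = 1 then a else b) else (if j = 1 then c else d))"

lemma mat2_nth [simp]:
  "mat2 a b c d $ 1 $ 1 = a" "mat2 a b c d $ 1 $ 2 = b" "mat2 a b c d $ 2 $ 1 = c" "mat2 a b c d $ 2 $ 2 = d"
  by (simp_all add: mat2_def)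

lemma mat2_eqI:
  fixes g h :: "'k ^ 2 ^ 2"
  assumes "g $ 1 $ 1 = h $ 1 $ 1" "g $ 1 $ 2 = h $ 1 $ 2" "g $ 2 $ 1 = h $ 2 $ 1" "g $ 2 $ 2 = h $ 2 $ 2"
  shows "g = h"
  using assms by (simp add: vec_eq_iff forall_2)

lemma mat2_mult:
  fixes g h :: "'k::semiring_1 ^ 2 ^ 2"
  shows "(g ** h) $ i $ j = g $ i $ 1 * h $ 1 $ j + g $ i $ 2 * h $ 2 $ j"
  by (simp add: matrix_matrix_mult_def sum_2)

lemma mem_SL2: "g \<in> SL2 \<longleftrightarrow> g $ 1 $ 1 * g $ 2 $ 2 - g $ 1 $ 2 * g $ 2 $ 1 = 1"
  by (simp add: SL2_def det_2)

lemma SL2_one [simp]: "mat 1 \<in> SL2"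
  by (simp add: SL2_def det_I)

lemma SL2_mult [simp]: "g \<in> SL2 \<Longrightarrow> h \<in> SL2 \<Longrightarrow> g ** h \<in> SL2"
  by (simp add: SL2_def det_mul)

definition upper :: "'k::field \<Rightarrow> 'k ^ 2 ^ 2" where "upper b = mat2 1 b 0 1"

definition torus :: "'k::field \<Rightarrow> 'k ^ 2 ^ 2" where "torus s = mat2 s 0 0 (inverse s)"

lemma upper_SL2 [simp]: "upper b \<in> SL2"
  by (simp add: mem_SL2 upper_def)

lemma torus_SL2 [simp]: "s \<noteq> 0 \<Longrightarrow> torus s \<in> SL2"
  by (simp add: mem_SL2 torus_def)

lemma upper_mult: "upper a ** upper b = upper (a + b)"
  by (rule mat2_eqI) (simp_all add: mat2_mult upper_def add.commute)

lemma torus_mult: "torus a ** torus b = torus (a * b)"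
  by (rule mat2_eqI) (simp_all add: mat2_mult torus_def)

lemma torus_upper: "s \<noteq> 0 \<Longrightarrow> torus s ** upper b = upper (s ^ 2 * b) ** torus s"
  by (rule mat2_eqI) (simp_all add: mat2_mult torus_def upper_def power2_eq_square)

lemma torus_one: "torus 1 = mat 1"
  by (rule mat2_eqI) (simp_all add: torus_def mat_def)

lemma poly_funs_curve:
  assumes "q \<in> poly_funs"
  shows "\<exists>P. \<forall>t. q (mat2 (poly a t) (poly b t) (poly c t) (poly d t)) = poly P t"
  using assms
proof induction
  case (const c)
  show ?case by (intro exI[of _ "[:c:]"]) simp
next
  case (entry i j)
  have "\<exists>P\<in>{a, b, c, d}. \<forall>t. mat2 (poly a t) (poly b t) (poly c t) (poly d t) $ i $ j = poly P t"
    using exhaust_2[of i] exhaust_2[of j] by auto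
  thus ?case by blast
next
  case (add f h)
  then obtain P Q where "\<And>t. f (mat2 (poly a t) (poly b t) (poly c t) (poly d t)) = poly P t"
    "\<And>t. h (mat2 (poly a t) (poly b t) (poly c t) (poly d t)) = poly Q t" by blast
  thus ?case by (intro exI[of _ "P + Q"]) simp
next
  case (mult f h)
  then obtain P Q where "\<And>t. f (mat2 (poly a t) (poly b t) (poly c t) (poly d t)) = poly P t"
    "\<And>t. h (mat2 (poly a t) (poly b t) (poly c t) (poly d t)) = poly Q t" by blast
  thus ?case by (intro exI[of _ "P * Q"]) simp
qed

lemma poly_funs_torus:
  assumes "q \<in> poly_funs"
  shows "\<exists>L P. \<forall>s. s \<noteq> 0 \<longrightarrow> q (torus s) * s ^ L = poly P s"
  using assms
proof induction
  case (const c)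
  show ?case by (intro exI[of _ 0] exI[of _ "[:c:]"]) simp
next
  case (entry i j)
  have *: "\<forall>s. s \<noteq> 0 \<longrightarrow> torus s $ i $ j * s ^ 1 =
      poly (if i = j then (if i = 1 then [:0, 0, 1:] else 1) else 0) s"
    using exhaust_2[of i] exhaust_2[of j] by (auto simp: torus_def)
  show ?case using * by blast
next
  case (add f h)
  then obtain L P L' P' where *: "\<And>s. s \<noteq> 0 \<Longrightarrow> f (torus s) * s ^ L = poly P s"
    "\<And>s. s \<noteq> 0 \<Longrightarrow> h (torus s) * s ^ L' = poly P' s" by blast
  have "(f (torus s) + h (torus s)) * s ^ (L + L') = poly (P * monom 1 L' + P' * monom 1 L) s" if "s \<noteq> 0" for s
    using *(1)[OF that] *(2)[OF that] by (simp add: poly_monom power_add algebra_simps flip: *)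
  thus ?case by blast
next
  case (mult f h)
  then obtain L P L' P' where *: "\<And>s. s \<noteq> 0 \<Longrightarrow> f (torus s) * s ^ L = poly P s"
    "\<And>s. s \<noteq> 0 \<Longrightarrow> h (torus s) * s ^ L' = poly P' s" by blast
  have "(f (torus s) * h (torus s)) * s ^ (L + L') = poly (P * P') s" if "s \<noteq> 0" for s
    using that by (simp add: power_add mult_ac flip: *)
  thus ?case by blast
qed

lemma coord_ring_upper:
  assumes "f \<in> coord_ring"
  shows "\<exists>P. \<forall>t. f (upper t) = poly P t"
proof -
  obtain q where q: "q \<in> poly_funs" "\<And>g. g \<in> SL2 \<Longrightarrow> f g = q g" using assms by (auto simp: coord_ring_def)
  obtain P where "\<And>t. q (mat2 (poly 1 t) (poly [:0, 1:] t) (poly 0 t) (poly 1 t)) = poly P t"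
    using poly_funs_curve[OF q(1)] by blast
  hence "f (upper t) = poly P t" for t using q(2)[OF upper_SL2] by (simp add: upper_def)
  thus ?thesis by blast
qed

lemma coord_ring_torus:
  assumes "f \<in> coord_ring"
  shows "\<exists>L P. \<forall>s. s \<noteq> 0 \<longrightarrow> f (torus s) * s ^ L = poly P s"
proof -
  obtain q where q: "q \<in> poly_funs" "\<And>g. g \<in> SL2 \<Longrightarrow> f g = q g" using assms by (auto simp: coord_ring_def)
  show ?thesis using poly_funs_torus[OF q(1)] q(2)[OF torus_SL2] by simp
qed

section \<open>Divided powers and weight spaces of a rational module\<close>

definition upper_coeffs :: "('k::field, 'v::ab_group_add) gmod \<Rightarrow> 'v \<Rightarrow> (nat \<Rightarrow> 'v) \<Rightarrow> bool" where
  "upper_coeffs M v m \<longleftrightarrow>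
     (\<exists>J. (\<forall>j\<ge>J. m j = 0) \<and> (\<forall>b. gact M (upper b) v = (\<Sum>j<J. gscale M (b ^ j) (m j))))"

text \<open>The divided power is the coefficient of \<open>b ^ j\<close> in the action of
  \<open>upper b\<close>; over an infinite field these coefficients are unique.\<close>

definition E_op :: "('k::field, 'v::ab_group_add) gmod \<Rightarrow> nat \<Rightarrow> 'v \<Rightarrow> 'v" where
  "E_op M j v = (SOME m. upper_coeffs M v m) j"

definition wt :: "('k::field, 'v::ab_group_add) gmod \<Rightarrow> int \<Rightarrow> 'v set" where
  "wt M y = {v \<in> gspace M. \<forall>s. s \<noteq> 0 \<longrightarrow> gact M (torus s) v = gscale M (s powi y) v}"

lemma (in vector_space) poly_coeffs_unique:
  assumes inf: "infinite (UNIV :: 'a set)"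
    and eq: "\<And>b. (\<Sum>j<J. scale (b ^ j) (m j)) = (\<Sum>j<J'. scale (b ^ j) (m' j))"
    and "\<And>j. j \<ge> J \<Longrightarrow> m j = 0" and "\<And>j. j \<ge> J' \<Longrightarrow> m' j = 0"
  shows "m = m'"
proof
  fix j
  define K where "K = Suc (j + J + J')"
  have ext: "(\<Sum>j<K. scale (b ^ j) (m j)) = (\<Sum>j<J. scale (b ^ j) (m j))"
    "(\<Sum>j<K. scale (b ^ j) (m' j)) = (\<Sum>j<J'. scale (b ^ j) (m' j))" for b
    by (rule sum.mono_neutral_right; use assms(3,4) in \<open>auto simp: K_def\<close>)+
  have "(\<Sum>j<K. scale (b ^ j) (m j - m' j)) \<in> {0}" for b
    using ext[of b] eq[of b] by (simp add: scale_right_diff_distrib sum_subtractf)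
  from poly_coeffs_mem[OF inf _ this, of j] have "m j - m' j \<in> {0}" by (simp add: K_def subspace_single_0)
  thus "m j = m' j" by simp
qed

locale rational_mod =
  fixes M :: "('k::alg_closed_field, 'v::ab_group_add) gmod"
  assumes rat: "rational_module M"
begin

sublocale vector_space "gscale M"
  using rat by (simp add: rational_module_def)

lemma gspace: "subspace (gspace M)"
  using rat by (simp add: rational_module_def)

lemma act_linear: "g \<in> SL2 \<Longrightarrow> gact M g ` gspace M \<subseteq> gspace M \<and> linear_on (gspace M) (gscale M) (gscale M) (gact M g)"
  using rat by (simp add: rational_module_def)

lemma act_mem: "g \<in> SL2 \<Longrightarrow> v \<in> gspace M \<Longrightarrow> gact M g v \<in> gspace M"
  using act_linear by blast

lemma act_add: "g \<in> SL2 \<Longrightarrow> v \<in> gspace M \<Longrightarrow> w \<in> gspace M \<Longrightarrow> gact M g (v + w) = gact M g v + gact M g w"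
  using act_linear by (simp add: linear_on_def)

lemma act_scale: "g \<in> SL2 \<Longrightarrow> v \<in> gspace M \<Longrightarrow> gact M g (gscale M c v) = gscale M c (gact M g v)"
  using act_linear by (simp add: linear_on_def)

lemma act_one: "v \<in> gspace M \<Longrightarrow> gact M (mat 1) v = v"
  using rat by (simp add: rational_module_def)

lemma act_mult: "g \<in> SL2 \<Longrightarrow> h \<in> SL2 \<Longrightarrow> v \<in> gspace M \<Longrightarrow> gact M (g ** h) v = gact M g (gact M h v)"
  using rat by (simp add: rational_module_def)

lemma act_zero: "g \<in> SL2 \<Longrightarrow> gact M g 0 = 0"
  using act_scale[of g 0 0] subspace_0[OF gspace] by simp

lemma act_sum:
  assumes "g \<in> SL2"
  shows "finite A \<Longrightarrow> (\<And>i. i \<in> A \<Longrightarrow> f i \<in> gspace M) \<Longrightarrow> gact M g (sum f A) = (\<Sum>i\<in>A. gact M g (f i))"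
proof (induction A rule: finite_induct)
  case empty
  show ?case using act_zero[OF assms] by simp
next
  case (insert i A)
  have "sum f A \<in> gspace M" using insert.prems by (intro subspace_sum[OF gspace]) simp
  thus ?case using insert act_add[OF assms, of "f i" "sum f A"] by simp
qed

lemma matrix_coeffs:
  assumes "v \<in> gspace M"
  shows "\<exists>(N::nat) w f. (\<forall>i<N. w i \<in> gspace M \<and> f i \<in> coord_ring) \<and>
    (\<forall>g\<in>SL2. gact M g v = (\<Sum>i<N. gscale M (f i g) (w i)))"
proof -
  have "\<forall>v\<in>gspace M. \<exists>(N::nat) w f.
        (\<forall>i<N. w i \<in> gspace M \<and> f i \<in> coord_ring) \<and>
        (\<forall>g\<in>SL2. gact M g v = (\<Sum>i<N. gscale M (f i g) (w i)))"
    using rat by (simp add: rational_module_def)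
  from bspec[OF this assms] show ?thesis .
qed

lemma infinite_k: "infinite (UNIV :: 'k set)"
  by (rule infinite_UNIV_alg_closed)

lemma upper_coeffs_unique:
  assumes "upper_coeffs M v m" and "upper_coeffs M v m'"
  shows "m = m'"
proof -
  obtain J J' where "\<And>j. j \<ge> J \<Longrightarrow> m j = 0" "\<And>b. gact M (upper b) v = (\<Sum>j<J. gscale M (b ^ j) (m j))"
    "\<And>j. j \<ge> J' \<Longrightarrow> m' j = 0" "\<And>b. gact M (upper b) v = (\<Sum>j<J'. gscale M (b ^ j) (m' j))"
    using assms unfolding upper_coeffs_def by blast
  thus ?thesis using poly_coeffs_unique[OF infinite_k, where J = J and J' = J' and m = m and m' = m'] by metis
qed

lemma E_op_eqI: "upper_coeffs M v m \<Longrightarrow> E_op M j v = m j"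
  unfolding E_op_def using upper_coeffs_unique someI[of "upper_coeffs M v"] by metis

lemma ex_upper_coeffs:
  assumes "v \<in> gspace M"
  shows "\<exists>m. upper_coeffs M v m \<and> (\<forall>j. m j \<in> gspace M)"
proof -
  obtain N :: nat and w f where wf0: "(\<forall>i<N. w i \<in> gspace M \<and> f i \<in> coord_ring) \<and>
      (\<forall>g\<in>SL2. gact M g v = (\<Sum>i<N. gscale M (f i g) (w i)))"
    using matrix_coeffs[OF assms] by (elim exE)
  note wf = wf0[THEN conjunct1, rule_format, THEN conjunct1] wf0[THEN conjunct1, rule_format, THEN conjunct2]
    wf0[THEN conjunct2, rule_format]
  define P where "P i = (SOME P. \<forall>t. f i (upper t) = poly P t)" for i
  have P: "f i (upper t) = poly (P i) t" if "i < N" for i t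
  proof -
    have "\<forall>t. f i (upper t) = poly (P i) t"
      unfolding P_def by (rule someI_ex[OF coord_ring_upper[OF wf(2)[OF that]]])
    thus ?thesis by (rule spec)
  qed
  define J where "J = Suc (\<Sum>i<N. degree (P i))"
  define m where "m j = (\<Sum>i<N. gscale M (coeff (P i) j) (w i))" for j
  have deg: "degree (P i) < J" if "i < N" for i
    using member_le_sum[of i "{..<N}" "\<lambda>i. degree (P i)"] that by (simp add: J_def)
  have "m j = 0" if "j \<ge> J" for j
    unfolding m_def
  proof (rule sum.neutral, rule ballI)
    fix i assume "i \<in> {..<N}"
    hence "coeff (P i) j = 0" using deg[of i] that by (intro coeff_eq_0) simp
    thus "gscale M (coeff (P i) j) (w i) = 0" by simp
  qed
  moreover have "gact M (upper b) v = (\<Sum>j<J. gscale M (b ^ j) (m j))" for b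
  proof -
    have "gact M (upper b) v = (\<Sum>i<N. gscale M (\<Sum>j<J. coeff (P i) j * b ^ j) (w i))"
      unfolding wf(3)[OF upper_SL2]
    proof (rule sum.cong[OF refl])
      fix i assume i: "i \<in> {..<N}"
      have "poly (P i) b = (\<Sum>j\<le>degree (P i). coeff (P i) j * b ^ j)" by (rule poly_altdef)
      also have "\<dots> = (\<Sum>j<J. coeff (P i) j * b ^ j)"
        using deg[of i] i by (intro sum.mono_neutral_left) (auto simp: coeff_eq_0)
      finally show "gscale M (f i (upper b)) (w i) = gscale M (\<Sum>j<J. coeff (P i) j * b ^ j) (w i)"
        using P i by simp
    qed
    also have "\<dots> = (\<Sum>j<J. \<Sum>i<N. gscale M (coeff (P i) j * b ^ j) (w i))"
      by (simp add: scale_sum_left) (rule sum.swap)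
    also have "\<dots> = (\<Sum>j<J. gscale M (b ^ j) (m j))"
      by (simp add: m_def scale_sum_right mult.commute)
    finally show ?thesis .
  qed
  moreover have "m j \<in> gspace M" for j
    unfolding m_def by (intro subspace_sum[OF gspace] subspace_scale[OF gspace]) (use wf(1) in auto)
  ultimately show ?thesis unfolding upper_coeffs_def by blast
qed

lemma upper_coeffs_E_op:
  assumes "v \<in> gspace M"
  shows "upper_coeffs M v (\<lambda>j. E_op M j v)" and "E_op M j v \<in> gspace M"
proof -
  obtain m where m: "upper_coeffs M v m" "\<And>j. m j \<in> gspace M" using ex_upper_coeffs[OF assms] by blast
  have "(\<lambda>j. E_op M j v) = m" using E_op_eqI[OF m(1)] by auto
  thus "upper_coeffs M v (\<lambda>j. E_op M j v)" "E_op M j v \<in> gspace M" using m by auto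
qed

lemma act_upper:
  assumes "v \<in> gspace M"
  obtains J where "\<And>K b. J \<le> K \<Longrightarrow> gact M (upper b) v = (\<Sum>j<K. gscale M (b ^ j) (E_op M j v))"
    and "\<And>j. J \<le> j \<Longrightarrow> E_op M j v = 0"
proof -
  obtain J where J: "\<And>j. J \<le> j \<Longrightarrow> E_op M j v = 0"
    "\<And>b. gact M (upper b) v = (\<Sum>j<J. gscale M (b ^ j) (E_op M j v))"
    using upper_coeffs_E_op(1)[OF assms] unfolding upper_coeffs_def by blast
  have "gact M (upper b) v = (\<Sum>j<K. gscale M (b ^ j) (E_op M j v))" if "J \<le> K" for K b
    unfolding J(2) by (rule sum.mono_neutral_left) (use that J(1) in auto)
  thus ?thesis using that J(1) by blast
qed

lemma E_op_eqI':
  assumes "\<And>b. gact M (upper b) v = (\<Sum>j<J. gscale M (b ^ j) (m j))" and "\<And>j. J \<le> j \<Longrightarrow> m j = 0"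
  shows "E_op M j v = m j"
  by (rule E_op_eqI) (use assms in \<open>auto simp: upper_coeffs_def\<close>)

lemma E_op_add:
  assumes "v \<in> gspace M" and "w \<in> gspace M"
  shows "E_op M t (v + w) = E_op M t v + E_op M t w"
proof -
  obtain J where J: "\<And>K b. J \<le> K \<Longrightarrow> gact M (upper b) v = (\<Sum>j<K. gscale M (b ^ j) (E_op M j v))"
    "\<And>j. J \<le> j \<Longrightarrow> E_op M j v = 0" using act_upper[OF assms(1)] by blast
  obtain J' where J': "\<And>K b. J' \<le> K \<Longrightarrow> gact M (upper b) w = (\<Sum>j<K. gscale M (b ^ j) (E_op M j w))"
    "\<And>j. J' \<le> j \<Longrightarrow> E_op M j w = 0" using act_upper[OF assms(2)] by blast
  show ?thesis
    by (rule E_op_eqI'[where J = "J + J'"])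
      (use assms J(2) J'(2) J(1)[of "J + J'"] J'(1)[of "J + J'"] in
        \<open>auto simp: act_add scale_right_distrib sum.distrib\<close>)
qed

lemma E_op_scale:
  assumes "v \<in> gspace M"
  shows "E_op M t (gscale M c v) = gscale M c (E_op M t v)"
proof -
  obtain J where J: "\<And>K b. J \<le> K \<Longrightarrow> gact M (upper b) v = (\<Sum>j<K. gscale M (b ^ j) (E_op M j v))"
    "\<And>j. J \<le> j \<Longrightarrow> E_op M j v = 0" using act_upper[OF assms(1)] by blast
  show ?thesis
    by (rule E_op_eqI'[where J = J])
      (use assms J(2) J(1)[of J] in \<open>auto simp: act_scale scale_sum_right mult.commute\<close>)
qed

lemma E_op_0:
  assumes "v \<in> gspace M"
  shows "E_op M 0 v = v"
proof -
  obtain J where J: "\<And>K b. J \<le> K \<Longrightarrow> gact M (upper b) v = (\<Sum>j<K. gscale M (b ^ j) (E_op M j v))"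
    "\<And>j. J \<le> j \<Longrightarrow> E_op M j v = 0" using act_upper[OF assms] by blast
  have "upper 0 = (mat 1 :: 'k ^ 2 ^ 2)" by (rule mat2_eqI) (simp_all add: upper_def mat_def)
  hence "v = (\<Sum>j<Suc J. gscale M (0 ^ j) (E_op M j v))"
    using J(1)[of "Suc J" 0] act_one[OF assms] by simp
  also have "\<dots> = (\<Sum>j<Suc J. if j = 0 then E_op M j v else 0)"
    by (rule sum.cong) (auto simp: power_0_left)
  also have "\<dots> = E_op M 0 v" by (subst sum.delta) auto
  finally show ?thesis by simp
qed

text \<open>Compare coefficients in \<open>upper a ** upper b = upper (a + b)\<close>, first in
  \<open>b\<close> and then in \<open>a\<close>.\<close>

lemma E_op_E_op:
  assumes v: "v \<in> gspace M"
  shows "E_op M i (E_op M j v) = gscale M (of_nat ((i + j) choose i)) (E_op M (i + j) v)"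
proof -
  obtain J where J: "\<And>K b. J \<le> K \<Longrightarrow> gact M (upper b) v = (\<Sum>j<K. gscale M (b ^ j) (E_op M j v))"
    "\<And>j. J \<le> j \<Longrightarrow> E_op M j v = 0" using act_upper[OF v] by blast
  let ?e = "\<lambda>j. E_op M j v"
  have "gact M (upper a) (?e j) = (\<Sum>i<J. gscale M (a ^ i) (gscale M (of_nat ((i + j) choose i)) (?e (i + j))))" for a j
  proof -
    let ?f = "\<lambda>i j. gscale M (of_nat ((i + j) choose i) * a ^ i) (?e (i + j))"
    have "(\<lambda>j. gact M (upper a) (?e j)) = (\<lambda>j. \<Sum>i<J. ?f i j)"
    proof (rule poly_coeffs_unique[OF infinite_k, where J = J and J' = J])
      fix b
      have "(\<Sum>j<J. gscale M (b ^ j) (gact M (upper a) (?e j))) = gact M (upper a) (gact M (upper b) v)"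
        using J(1)[of J b] upper_coeffs_E_op(2)[OF v]
        by (simp add: act_sum act_scale subspace_scale[OF gspace])
      also have "\<dots> = gact M (upper (a + b)) v" by (simp add: act_mult[OF _ _ v, symmetric] upper_mult)
      also have "\<dots> = (\<Sum>n<J. gscale M ((a + b) ^ n) (?e n))" by (rule J(1)) simp
      also have "\<dots> = (\<Sum>n<J. \<Sum>i\<le>n. gscale M (b ^ (n - i)) (?f i (n - i)))"
      proof (rule sum.cong[OF refl])
        fix n
        have "(a + b) ^ n = (\<Sum>i\<le>n. of_nat (n choose i) * a ^ i * b ^ (n - i))" by (rule binomial_ring)
        hence "gscale M ((a + b) ^ n) (?e n) = (\<Sum>i\<le>n. gscale M (of_nat (n choose i) * a ^ i * b ^ (n - i)) (?e n))"
          by (simp add: scale_sum_left)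
        thus "gscale M ((a + b) ^ n) (?e n) = (\<Sum>i\<le>n. gscale M (b ^ (n - i)) (?f i (n - i)))"
          by (simp add: mult_ac)
      qed
      also have "\<dots> = (\<Sum>(i, j)\<in>{(i, j). i + j < J}. gscale M (b ^ j) (?f i j))"
        by (rule sum.triangle_reindex[symmetric])
      \<comment> \<open>Terms with \<open>i + j \<ge> J\<close> vanish, so the triangle may be
        completed to a square and the powers of \<open>b\<close> separated.\<close>
      also have "\<dots> = (\<Sum>(i, j)\<in>{..<J} \<times> {..<J}. gscale M (b ^ j) (?f i j))"
      proof (rule sum.mono_neutral_left)
        show "\<forall>ij\<in>{..<J} \<times> {..<J} - {(i, j). i + j < J}. (case ij of (i, j) \<Rightarrow> gscale M (b ^ j) (?f i j)) = 0"
        proof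
          fix ij assume "ij \<in> {..<J} \<times> {..<J} - {(i, j). i + j < J}"
          moreover obtain i j where ij: "ij = (i, j)" by (cases ij)
          ultimately have "J \<le> i + j" by auto
        from J(2)[OF this] show "(case ij of (i, j) \<Rightarrow> gscale M (b ^ j) (?f i j)) = 0" by (simp add: ij)
        qed
      qed auto
      also have "\<dots> = (\<Sum>i<J. \<Sum>j<J. gscale M (b ^ j) (?f i j))" by (simp add: sum.cartesian_product)
      also have "\<dots> = (\<Sum>j<J. \<Sum>i<J. gscale M (b ^ j) (?f i j))" by (rule sum.swap)
      also have "\<dots> = (\<Sum>j<J. gscale M (b ^ j) (\<Sum>i<J. ?f i j))" by (simp only: scale_sum_right)
      finally show "(\<Sum>j<J. gscale M (b ^ j) (gact M (upper a) (?e j))) = (\<Sum>j<J. gscale M (b ^ j) (\<Sum>i<J. ?f i j))" .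
    qed (use J(2) act_zero[OF upper_SL2] in auto)
    from fun_cong[OF this, of j] show ?thesis by (simp add: mult.commute)
  qed
  thus ?thesis by (rule E_op_eqI') (use J(2) in auto)
qed

text \<open>Compare coefficients of \<open>b\<close> in
  \<open>torus s ** upper b = upper (s ^ 2 * b) ** torus s\<close>: the positive root has weight
  2.\<close>

lemma E_op_wt:
  assumes v: "v \<in> wt M y"
  shows "E_op M t v \<in> wt M (y + 2 * int t)"
proof -
  have vM: "v \<in> gspace M" and vs: "\<And>s. s \<noteq> 0 \<Longrightarrow> gact M (torus s) v = gscale M (s powi y) v"
    using v by (auto simp: wt_def)
  obtain J where J: "\<And>K b. J \<le> K \<Longrightarrow> gact M (upper b) v = (\<Sum>j<K. gscale M (b ^ j) (E_op M j v))"
    "\<And>j. J \<le> j \<Longrightarrow> E_op M j v = 0" using act_upper[OF vM] by blast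
  have "gact M (torus s) (E_op M t v) = gscale M (s powi (y + 2 * int t)) (E_op M t v)" if s: "s \<noteq> 0" for s
  proof -
    have "(\<lambda>j. gact M (torus s) (E_op M j v)) = (\<lambda>j. gscale M (s powi (y + 2 * int j)) (E_op M j v))"
    proof (rule poly_coeffs_unique[OF infinite_k, where J = J and J' = J])
      fix b
      have "(\<Sum>j<J. gscale M (b ^ j) (gact M (torus s) (E_op M j v))) = gact M (torus s) (gact M (upper b) v)"
        using J(1)[of J b] upper_coeffs_E_op(2)[OF vM] s
        by (simp add: act_sum act_scale subspace_scale[OF gspace])
      also have "\<dots> = gact M (upper (s ^ 2 * b)) (gact M (torus s) v)"
        using s vM by (simp add: torus_upper flip: act_mult)
      also have "\<dots> = gscale M (s powi y) (gact M (upper (s ^ 2 * b)) v)"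
        using vs[OF s] act_scale[OF upper_SL2 vM] by simp
      also have "\<dots> = (\<Sum>j<J. gscale M (s powi y * (s ^ 2 * b) ^ j) (E_op M j v))"
        using J(1)[of J "s ^ 2 * b"] by (simp add: scale_sum_right)
      also have "\<dots> = (\<Sum>j<J. gscale M (b ^ j) (gscale M (s powi (y + 2 * int j)) (E_op M j v)))"
      proof (rule sum.cong[OF refl])
        fix j
        have "s powi (y + 2 * int j) = s powi y * (s ^ 2) ^ j"
          using s by (simp add: power_int_add power_int_mult)
        thus "gscale M (s powi y * (s ^ 2 * b) ^ j) (E_op M j v) =
            gscale M (b ^ j) (gscale M (s powi (y + 2 * int j)) (E_op M j v))"
          by (simp add: power_mult_distrib mult_ac)
      qed
      finally show "(\<Sum>j<J. gscale M (b ^ j) (gact M (torus s) (E_op M j v))) =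
          (\<Sum>j<J. gscale M (b ^ j) (gscale M (s powi (y + 2 * int j)) (E_op M j v)))" .
    qed (use J(2) act_zero[OF torus_SL2[OF s]] in auto)
    from fun_cong[OF this, of t] show ?thesis .
  qed
  thus ?thesis using upper_coeffs_E_op(2)[OF vM] by (simp add: wt_def)
qed

lemma wt_gspace: "v \<in> wt M y \<Longrightarrow> v \<in> gspace M"
  by (simp add: wt_def)

lemma wt_subspace: "subspace (wt M y)"
  by (rule subspaceI)
    (auto simp: wt_def act_zero act_add act_scale scale_right_distrib mult.commute
      subspace_0[OF gspace] subspace_add[OF gspace] subspace_scale[OF gspace])

lemma graded_module:
  assumes "prime p" and "odd p" and "CHAR('k) = p"
  shows "graded_module (gscale M) (wt M) (E_op M) p"
proof (unfold_locales, goal_cases)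
  case (5 v y w t)
  show ?case by (rule E_op_add[OF wt_gspace[OF 5(1)] wt_gspace[OF 5(2)]])
next
  case (8 v y)
  show ?case by (rule E_op_0[OF wt_gspace[OF 8]])
next
  case (10 v y)
  obtain J where "\<And>K b. J \<le> K \<Longrightarrow> gact M (upper b) v = (\<Sum>j<K. gscale M (b ^ j) (E_op M j v))"
    "\<And>j. J \<le> j \<Longrightarrow> E_op M j v = 0" using act_upper[OF wt_gspace[OF 10]] by blast
  thus ?case by blast
qed (use assms in \<open>auto simp: wt_subspace E_op_wt E_op_E_op E_op_add E_op_scale dest: wt_gspace\<close>)

text \<open>Matrix coefficients are Laurent polynomials on the torus, and the coefficient of
  \<open>s powi n\<close> in the action of \<open>torus s\<close> is the component of weight
  \<open>n\<close>. It is a weight vector because the action of \<open>torus (r * s)\<close> can be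
  expanded in two ways.\<close>

lemma weight_decomposition:
  assumes v: "v \<in> gspace M"
  shows "\<exists>K \<mu>. finite (K :: int set) \<and> (\<forall>n. \<mu> n \<in> wt M n) \<and> v = (\<Sum>n\<in>K. \<mu> n)"
proof -
  obtain N :: nat and w f where wf0: "(\<forall>i<N. w i \<in> gspace M \<and> f i \<in> coord_ring) \<and>
      (\<forall>g\<in>SL2. gact M g v = (\<Sum>i<N. gscale M (f i g) (w i)))"
    using matrix_coeffs[OF v] by (elim exE)
  note wf = wf0[THEN conjunct1, rule_format, THEN conjunct1] wf0[THEN conjunct1, rule_format, THEN conjunct2]
    wf0[THEN conjunct2, rule_format]
  have "\<forall>i. \<exists>L P. i < N \<longrightarrow> (\<forall>s. s \<noteq> 0 \<longrightarrow> f i (torus s) * s ^ L = poly P s)"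
    using coord_ring_torus[OF wf(2)] by meson
  then obtain L P where P: "\<And>i s. i < N \<Longrightarrow> s \<noteq> 0 \<Longrightarrow> f i (torus s) * s ^ L i = poly (P i) s" by metis
  define J where "J = Suc (\<Sum>i<N. degree (P i))"
  have deg: "degree (P i) < J" if "i < N" for i
    using member_le_sum[of i "{..<N}" "\<lambda>i. degree (P i)"] that by (simp add: J_def)
  define \<Lambda> where "\<Lambda> = (\<Sum>i<N. L i)"
  define K where "K = {- int \<Lambda> ..< int J}"
  \<comment> \<open>The exponent \<open>L i\<close> clears the denominator of the
    \<open>i\<close>-th matrix coefficient, so \<open>s powi n\<close> corresponds to the
    coefficient \<open>n + L i\<close> of \<open>P i\<close>.\<close>
  define \<mu> where "\<mu> n = (if n \<in> K then \<Sum>i<N. if 0 \<le> n + int (L i) then gscale M (coeff (P i) (nat (n + int (L i)))) (w i) else 0 else 0)" for n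
  have \<mu>M: "\<mu> n \<in> gspace M" for n
    using wf(1) by (auto simp: \<mu>_def intro!: subspace_sum[OF gspace] subspace_scale[OF gspace] subspace_0[OF gspace])
  have torus_v: "gact M (torus s) v = (\<Sum>n\<in>K. gscale M (s powi n) (\<mu> n))" if s: "s \<noteq> 0" for s
  proof -
    have f: "f i (torus s) = (\<Sum>n\<in>K. if 0 \<le> n + int (L i) then s powi n * coeff (P i) (nat (n + int (L i))) else 0)"
      if i: "i < N" for i
    proof -
      have Li: "L i \<le> \<Lambda>" using member_le_sum[of i "{..<N}" L] i by (simp add: \<Lambda>_def)
      have "f i (torus s) = s powi (- int (L i)) * poly (P i) s"
        using P[OF i s] s by (simp add: power_int_minus field_simps)
      also have "\<dots> = s powi (- int (L i)) * (\<Sum>j<J. coeff (P i) j * s ^ j)"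
        unfolding poly_altdef using deg[OF i]
        by (intro arg_cong2[of _ _ _ _ "(*)"] refl sum.mono_neutral_left) (auto simp: coeff_eq_0)
      also have "\<dots> = (\<Sum>j<J. s powi (int j - int (L i)) * coeff (P i) j)"
        using s by (simp add: sum_distrib_left power_int_diff power_int_minus field_simps)
      also have "\<dots> = (\<Sum>n\<in>{- int (L i) ..< int J - int (L i)}. s powi n * coeff (P i) (nat (n + int (L i))))"
        by (rule sum.reindex_bij_witness[of _ "\<lambda>n. nat (n + int (L i))" "\<lambda>j. int j - int (L i)"]) auto
      also have "\<dots> = (\<Sum>n\<in>{- int (L i) ..< int J - int (L i)}. if 0 \<le> n + int (L i) then s powi n * coeff (P i) (nat (n + int (L i))) else 0)"
        by (rule sum.cong) auto
      also have "\<dots> = (\<Sum>n\<in>K. if 0 \<le> n + int (L i) then s powi n * coeff (P i) (nat (n + int (L i))) else 0)"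
      proof (rule sum.mono_neutral_left)
        show "{- int (L i) ..< int J - int (L i)} \<subseteq> K" using Li by (auto simp: K_def)
        show "\<forall>n\<in>K - {- int (L i) ..< int J - int (L i)}.
            (if 0 \<le> n + int (L i) then s powi n * coeff (P i) (nat (n + int (L i))) else 0) = 0"
          using deg[OF i] by (auto simp: coeff_eq_0 le_degree)
      qed (simp add: K_def)
      finally show ?thesis .
    qed
    have "gact M (torus s) v = (\<Sum>i<N. \<Sum>n\<in>K. if 0 \<le> n + int (L i) then gscale M (s powi n * coeff (P i) (nat (n + int (L i)))) (w i) else 0)"
      unfolding wf(3)[OF torus_SL2[OF s]]
      by (rule sum.cong) (auto simp: f scale_sum_left intro!: sum.cong)
    also have "\<dots> = (\<Sum>n\<in>K. \<Sum>i<N. if 0 \<le> n + int (L i) then gscale M (s powi n * coeff (P i) (nat (n + int (L i)))) (w i) else 0)"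
      by (rule sum.swap)
    also have "\<dots> = (\<Sum>n\<in>K. gscale M (s powi n) (\<mu> n))"
      by (rule sum.cong) (auto simp: \<mu>_def scale_sum_right intro!: sum.cong)
    finally show ?thesis .
  qed
  have "\<mu> n \<in> wt M n" for n
  proof (cases "n \<in> K")
    case True
    have "gact M (torus r) (\<mu> n) = gscale M (r powi n) (\<mu> n)" if r: "r \<noteq> 0" for r
    proof -
      have "(\<Sum>n\<in>K. gscale M (s powi n) (gact M (torus r) (\<mu> n) - gscale M (r powi n) (\<mu> n))) \<in> {0}" if s: "s \<noteq> 0" for s
      proof -
        have "(\<Sum>n\<in>K. gscale M (s powi n) (gact M (torus r) (\<mu> n))) = gact M (torus r) (gact M (torus s) v)"
          using r s \<mu>M by (simp add: torus_v act_sum act_scale subspace_scale[OF gspace] K_def)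
        also have "\<dots> = gact M (torus (r * s)) v" using r s v by (simp flip: act_mult add: torus_mult)
        also have "\<dots> = (\<Sum>n\<in>K. gscale M (s powi n) (gscale M (r powi n) (\<mu> n)))"
          using r s by (simp add: torus_v power_int_mult_distrib mult.commute)
        finally show ?thesis by (simp add: scale_right_diff_distrib sum_subtractf)
      qed
      from laurent_coeffs_mem[OF infinite_nonzero _ _ this True] show ?thesis
        by (simp add: K_def subspace_single_0)
    qed
    thus ?thesis using \<mu>M by (simp add: wt_def)
  next
    case False
    thus ?thesis using subspace_0[OF wt_subspace] by (simp add: \<mu>_def)
  qed
  moreover have "v = (\<Sum>n\<in>K. \<mu> n)" using torus_v[of 1] act_one[OF v] by (simp add: torus_one)
  moreover have "finite K" by (simp add: K_def)
  ultimately show ?thesis by blast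
qed

lemma weights_independent:
  assumes K: "finite (K :: int set)" and \<mu>: "\<And>n. n \<in> K \<Longrightarrow> \<mu> n \<in> wt M n" and z: "(\<Sum>n\<in>K. \<mu> n) \<in> wt M y"
  shows "(\<Sum>n\<in>K. \<mu> n) = (if y \<in> K then \<mu> y else 0)"
proof -
  let ?z = "\<Sum>n\<in>K. \<mu> n"
  define \<nu> where "\<nu> n = (if n \<in> K then \<mu> n else 0) - (if n = y then ?z else 0)" for n
  have "(\<Sum>n\<in>insert y K. gscale M (s powi n) (\<nu> n)) \<in> {0}" if s: "s \<noteq> 0" for s
  proof -
    have "(\<Sum>n\<in>insert y K. gscale M (s powi n) (\<nu> n)) =
        (\<Sum>n\<in>insert y K. gscale M (s powi n) (if n \<in> K then \<mu> n else 0)) - (\<Sum>n\<in>insert y K. if n = y then gscale M (s powi n) ?z else 0)"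
      unfolding sum_subtractf[symmetric] by (rule sum.cong) (auto simp: \<nu>_def scale_right_diff_distrib)
    also have "(\<Sum>n\<in>insert y K. if n = y then gscale M (s powi n) ?z else 0) = gscale M (s powi y) ?z"
      using K by (subst sum.delta) auto
    also have "(\<Sum>n\<in>insert y K. gscale M (s powi n) (if n \<in> K then \<mu> n else 0)) = (\<Sum>n\<in>K. gscale M (s powi n) (\<mu> n))"
      using K by (intro sum.mono_neutral_cong_right) auto
    also have "\<dots> = (\<Sum>n\<in>K. gact M (torus s) (\<mu> n))"
      by (rule sum.cong) (use \<mu> s in \<open>auto simp: wt_def\<close>)
    also have "\<dots> = gact M (torus s) ?z" by (rule act_sum[OF torus_SL2[OF s] K, symmetric]) (rule wt_gspace[OF \<mu>])
    also have "\<dots> = gscale M (s powi y) ?z" using z s by (simp add: wt_def)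
    finally show ?thesis by simp
  qed
  from laurent_coeffs_mem[OF infinite_nonzero _ _ this, of y] have "\<nu> y = 0"
    using K by (simp add: subspace_single_0)
  thus ?thesis by (simp add: \<nu>_def split: if_splits)
qed

end

section \<open>Homomorphisms, divided powers and weights\<close>

lemma G_homD:
  assumes "f \<in> G_hom M N"
  shows "v \<in> gspace M \<Longrightarrow> f v \<in> gspace N"
    and "v \<in> gspace M \<Longrightarrow> w \<in> gspace M \<Longrightarrow> f (v + w) = f v + f w"
    and "v \<in> gspace M \<Longrightarrow> f (gscale M c v) = gscale N c (f v)"
    and "g \<in> SL2 \<Longrightarrow> v \<in> gspace M \<Longrightarrow> f (gact M g v) = gact N g (f v)"
    and "v \<notin> gspace M \<Longrightarrow> f v = 0"
  using assms unfolding G_hom_def linear_on_def by blast+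

lemma G_hom_sum:
  fixes M :: "('k::alg_closed_field, 'v::ab_group_add) gmod" and N :: "('k, 'w::ab_group_add) gmod"
  assumes "rational_module M" and f: "f \<in> G_hom M N" and N: "vector_space (gscale N)"
  shows "finite A \<Longrightarrow> (\<And>i. i \<in> A \<Longrightarrow> h i \<in> gspace M) \<Longrightarrow> f (sum h A) = (\<Sum>i\<in>A. f (h i))"
proof (induction A rule: finite_induct)
  case empty
  interpret M: rational_mod M by standard fact
  interpret N: vector_space "gscale N" by fact
  show ?case using G_homD(3)[OF f M.subspace_0[OF M.gspace], of 0] by simp
next
  case (insert i A)
  interpret M: rational_mod M by standard fact
  have "sum h A \<in> gspace M" using insert.prems by (intro M.subspace_sum[OF M.gspace]) simp
  thus ?case using insert G_homD(2)[OF f, of "h i" "sum h A"] by simp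
qed

lemma G_hom_E_op:
  fixes M :: "('k::alg_closed_field, 'v::ab_group_add) gmod" and N :: "('k, 'w::ab_group_add) gmod"
  assumes M: "rational_module M" and N: "rational_module N" and f: "f \<in> G_hom M N" and v: "v \<in> gspace M"
  shows "f (E_op M t v) = E_op N t (f v)"
proof -
  interpret M: rational_mod M by standard fact
  interpret N: rational_mod N by standard fact
  obtain J where J: "\<And>K b. J \<le> K \<Longrightarrow> gact M (upper b) v = (\<Sum>j<K. gscale M (b ^ j) (E_op M j v))"
    "\<And>j. J \<le> j \<Longrightarrow> E_op M j v = 0" using M.act_upper[OF v] by blast
  have "E_op N t (f v) = f (E_op M t v)"
  proof (rule N.E_op_eqI')
    fix b
    have "gact N (upper b) (f v) = f (gact M (upper b) v)" using G_homD(4)[OF f upper_SL2 v] by simp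
    also have "\<dots> = f (\<Sum>j<J. gscale M (b ^ j) (E_op M j v))" using J(1)[of J b] by simp
    also have "\<dots> = (\<Sum>j<J. f (gscale M (b ^ j) (E_op M j v)))"
      by (rule G_hom_sum[OF M f N.vector_space_axioms]) (auto intro!: M.subspace_scale[OF M.gspace] M.upper_coeffs_E_op(2)[OF v])
    also have "\<dots> = (\<Sum>j<J. gscale N (b ^ j) (f (E_op M j v)))"
      by (rule sum.cong) (auto simp: G_homD(3)[OF f M.upper_coeffs_E_op(2)[OF v]])
    finally show "gact N (upper b) (f v) = (\<Sum>j<J. gscale N (b ^ j) (f (E_op M j v)))" .
  next
    fix j assume "J \<le> j"
    thus "f (E_op M j v) = 0"
      using J(2) G_homD(3)[OF f M.subspace_0[OF M.gspace], of 0] by simp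
  qed
  thus ?thesis by simp
qed

lemma G_hom_wt:
  fixes M :: "('k::alg_closed_field, 'v::ab_group_add) gmod" and N :: "('k, 'w::ab_group_add) gmod"
  assumes "f \<in> G_hom M N" and "v \<in> wt M y"
  shows "f v \<in> wt N y"
  using assms(2) G_homD(1,4)[OF assms(1)] G_homD(3)[OF assms(1)] by (auto simp: wt_def simp flip: G_homD(4)[OF assms(1)])

text \<open>Only the component of weight \<open>y\<close> of a preimage can contribute to an image
  of weight \<open>y\<close>; so exactness of a resolution passes to each weight space.\<close>

lemma G_hom_wt_surj:
  fixes M :: "('k::alg_closed_field, 'v::ab_group_add) gmod" and N :: "('k, 'w::ab_group_add) gmod"
  assumes M: "rational_module M" and N: "rational_module N" and f: "f \<in> G_hom M N"
    and v: "v \<in> gspace M" and z: "f v \<in> wt N y"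
  shows "f v \<in> f ` wt M y"
proof -
  interpret M: rational_mod M by standard fact
  interpret N: rational_mod N by standard fact
  obtain K \<mu> where K: "finite (K :: int set)" "\<And>n. \<mu> n \<in> wt M n" "v = (\<Sum>n\<in>K. \<mu> n)"
    using M.weight_decomposition[OF v] by blast
  have fv: "f v = (\<Sum>n\<in>K. f (\<mu> n))"
    unfolding K(3) by (rule G_hom_sum[OF M f N.vector_space_axioms K(1)]) (use K(2) M.wt_gspace in blast)
  have "f v = (if y \<in> K then f (\<mu> y) else 0)"
    unfolding fv
    by (rule N.weights_independent[OF K(1)]) (use K(2) G_hom_wt[OF f] z fv in auto)
  moreover have "0 \<in> f ` wt M y"
    using G_homD(3)[OF f M.subspace_0[OF M.gspace], of 0] M.subspace_0[OF M.wt_subspace] by (intro image_eqI[of _ _ 0]) auto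
  ultimately show ?thesis using K(2) by (auto split: if_splits)
qed

section \<open>Symmetric powers of the natural representation\<close>

lemma poly_funs_sum:
  "(\<And>i. i \<in> A \<Longrightarrow> f i \<in> poly_funs) \<Longrightarrow> (\<lambda>g. \<Sum>i\<in>A. f i g) \<in> poly_funs"
proof (induction A rule: infinite_finite_induct)
  case (insert i A)
  have "(\<lambda>g. f i g + (\<Sum>i\<in>A. f i g)) \<in> poly_funs"
    by (rule poly_funs.add) (use insert in auto)
  thus ?case using insert.hyps by simp
qed (simp_all add: poly_funs.const)

lemma poly_funs_power: "f \<in> poly_funs \<Longrightarrow> (\<lambda>g. f g ^ n) \<in> poly_funs"
  by (induction n) (simp_all add: poly_funs.const poly_funs.mult)

lemma poly_funs_right_mult: "q \<in> poly_funs \<Longrightarrow> (\<lambda>g. q (g ** h)) \<in> poly_funs"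
proof (induction rule: poly_funs.induct)
  case (entry i j)
  show ?case unfolding mat2_mult
    by (intro poly_funs.add poly_funs.mult poly_funs.entry poly_funs.const)
qed (simp_all add: poly_funs.intros)

text \<open>
  \<open>SL\<^sub>2\<close> acts transitively on non-zero first columns, so \<open>\<phi>\<close> is a function of the first column.
  On \<open>c \<noteq> 0\<close> it is \<open>c\<^sup>m P(a/c)\<close>, and regularity at \<open>c = 0\<close> forces \<open>deg P \<le> m\<close>.
\<close>

lemma first_column_function:
  fixes \<phi> :: "'k::alg_closed_field ^ 2 ^ 2 \<Rightarrow> 'k"
  assumes q: "q \<in> poly_funs" "\<And>g. g \<in> SL2 \<Longrightarrow> \<phi> g = q g"
    and up: "\<And>g t. g \<in> SL2 \<Longrightarrow> \<phi> (g ** upper t) = \<phi> g"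
    and tor: "\<And>g s. g \<in> SL2 \<Longrightarrow> s \<noteq> 0 \<Longrightarrow> \<phi> (g ** torus s) = s ^ m * \<phi> g"
  shows "\<exists>a. \<forall>g\<in>SL2. \<phi> g = (\<Sum>l\<le>m. a l * (g $ 1 $ 1 ^ l * g $ 2 $ 1 ^ (m - l)))"
proof -
  obtain P where "\<And>z. q (mat2 (poly [:0, 1:] z) (poly [:- 1:] z) (poly 1 z) (poly 0 z)) = poly P z"
    using poly_funs_curve[OF q(1)] by blast
  hence P: "q (mat2 z (- 1) 1 0) = poly P z" for z by simp
  obtain P' where "\<And>z. q (mat2 (poly 1 z) (poly 0 z) (poly [:0, 1:] z) (poly 1 z)) = poly P' z"
    using poly_funs_curve[OF q(1)] by blast
  hence P': "q (mat2 1 0 z 1) = poly P' z" for z by simp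
  have chart1: "\<phi> g = g $ 2 $ 1 ^ m * poly P (g $ 1 $ 1 / g $ 2 $ 1)" if g: "g \<in> SL2" and c: "g $ 2 $ 1 \<noteq> 0" for g
  proof -
    let ?h = "mat2 (g $ 1 $ 1 / g $ 2 $ 1) (- 1) 1 0 :: 'k ^ 2 ^ 2"
    have h: "?h \<in> SL2" by (simp add: mem_SL2)
    have det: "g $ 1 $ 1 * g $ 2 $ 2 - 1 = g $ 1 $ 2 * g $ 2 $ 1" using g by (simp add: mem_SL2 algebra_simps)
    \<comment> \<open>Over this chart \<open>?h\<close> is a section of the first column up to
      scale; the rest of \<open>g\<close> lies in the torus and the unipotent group, where
      \<open>\<phi>\<close> is known to transform.\<close>
    have "g = ?h ** torus (g $ 2 $ 1) ** upper (g $ 2 $ 2 / g $ 2 $ 1)"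
      by (rule mat2_eqI) (use c det in \<open>simp_all add: mat2_mult torus_def upper_def field_simps\<close>)
    hence "\<phi> g = \<phi> (?h ** torus (g $ 2 $ 1) ** upper (g $ 2 $ 2 / g $ 2 $ 1))" by simp
    also have "\<dots> = g $ 2 $ 1 ^ m * \<phi> ?h" using h c by (simp add: up tor)
    finally show ?thesis using q(2)[OF h] P by simp
  qed
  have chart2: "\<phi> g = g $ 1 $ 1 ^ m * poly P' (g $ 2 $ 1 / g $ 1 $ 1)" if g: "g \<in> SL2" and c: "g $ 1 $ 1 \<noteq> 0" for g
  proof -
    let ?h = "mat2 1 0 (g $ 2 $ 1 / g $ 1 $ 1) 1 :: 'k ^ 2 ^ 2"
    have h: "?h \<in> SL2" by (simp add: mem_SL2)
    have det: "g $ 1 $ 2 * g $ 2 $ 1 + 1 = g $ 1 $ 1 * g $ 2 $ 2" using g by (simp add: mem_SL2 algebra_simps)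
    have "g = ?h ** torus (g $ 1 $ 1) ** upper (g $ 1 $ 2 / g $ 1 $ 1)"
      by (rule mat2_eqI) (use c det in \<open>simp_all add: mat2_mult torus_def upper_def field_simps\<close>)
    hence "\<phi> g = \<phi> (?h ** torus (g $ 1 $ 1) ** upper (g $ 1 $ 2 / g $ 1 $ 1))" by simp
    also have "\<dots> = g $ 1 $ 1 ^ m * \<phi> ?h" using h c by (simp add: up tor)
    finally show ?thesis using q(2)[OF h] P' by simp
  qed
  have glue: "poly P' c = c ^ m * poly P (1 / c)" if "c \<noteq> 0" for c
  proof -
    have "mat2 1 0 c 1 \<in> SL2" by (simp add: mem_SL2)
    from chart1[OF this] chart2[OF this] that show ?thesis by simp
  qed
  \<comment> \<open>Multiplied by c^L the gluing relation is an identity of polynomials. Its right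
    side is divisible by X^L, whereas the coefficient of \<open>P\<close> at \<open>l > m\<close>
    sits at the exponent \<open>m + L - l < L\<close> on the left.\<close>
  have deg: "coeff P l = 0" if "l > m" for l
  proof (cases "l \<le> degree P")
    case True
    define L where "L = degree P"
    define Q where "Q = (\<Sum>i\<le>L. monom (coeff P i) (m + L - i))"
    have "Q = monom 1 L * P'"
    proof (rule poly_eqI_infinite[OF infinite_nonzero])
      fix c :: 'k assume "c \<in> - {0}"
      hence c: "c \<noteq> 0" by simp
      have "poly Q c = (\<Sum>i\<le>L. c ^ L * (c ^ m * (coeff P i * (1 / c) ^ i)))"
        unfolding Q_def poly_sum poly_monom
      proof (rule sum.cong[OF refl])
        fix i assume "i \<in> {..L}"
        hence "c ^ (m + L - i) * c ^ i = c ^ L * c ^ m" by (simp add: add.commute flip: power_add)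
        thus "coeff P i * c ^ (m + L - i) = c ^ L * (c ^ m * (coeff P i * (1 / c) ^ i))"
          using c by (simp add: field_simps power_one_over)
      qed
      also have "\<dots> = c ^ L * (c ^ m * poly P (1 / c))"
        by (simp add: poly_altdef L_def sum_distrib_left)
      finally show "poly Q c = poly (monom 1 L * P') c" using glue[OF c] by (simp add: poly_monom)
    qed
    hence "coeff Q (m + L - l) = 0" using that True by (simp add: coeff_monom_mult L_def)
    moreover have "coeff Q (m + L - l) = (\<Sum>i\<le>L. if i = l then coeff P i else 0)"
      unfolding Q_def coeff_sum by (rule sum.cong) (use True in \<open>auto simp: L_def\<close>)
    ultimately show ?thesis using True by (simp add: L_def)
  qed (simp add: coeff_eq_0)
  have evalP: "poly P z = (\<Sum>l\<le>m. coeff P l * z ^ l)" for z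
  proof -
    have "poly P z = (\<Sum>l\<le>degree P. coeff P l * z ^ l)" by (rule poly_altdef)
    also have "\<dots> = (\<Sum>l\<le>m. coeff P l * z ^ l)"
      by (rule sum.mono_neutral_cong) (use deg in \<open>auto simp: coeff_eq_0 not_le\<close>)
    finally show ?thesis .
  qed
  have homog: "c ^ m * poly P (a / c) = (\<Sum>l\<le>m. coeff P l * (a ^ l * c ^ (m - l)))" if "c \<noteq> 0" for a c
    unfolding evalP sum_distrib_left
  proof (rule sum.cong[OF refl])
    fix l assume "l \<in> {..m}"
    hence "c ^ m = c ^ l * c ^ (m - l)" by (simp flip: power_add)
    thus "c ^ m * (coeff P l * (a / c) ^ l) = coeff P l * (a ^ l * c ^ (m - l))"
      using that by (simp add: field_simps)
  qed
  have "P' = (\<Sum>l\<le>m. monom (coeff P l) (m - l))"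
  proof (rule poly_eqI_infinite[OF infinite_nonzero])
    fix c :: 'k assume "c \<in> - {0}"
    thus "poly P' c = poly (\<Sum>l\<le>m. monom (coeff P l) (m - l)) c"
      using glue[of c] homog[of c 1] by (simp add: poly_sum poly_monom)
  qed
  hence "poly P' 0 = (\<Sum>l\<le>m. if l = m then coeff P l else 0)"
  proof -
    assume "P' = (\<Sum>l\<le>m. monom (coeff P l) (m - l))"
    hence "poly P' 0 = (\<Sum>l\<le>m. coeff P l * 0 ^ (m - l))" by (simp only: poly_sum poly_monom)
    also have "\<dots> = (\<Sum>l\<le>m. if l = m then coeff P l else 0)"
      by (rule sum.cong) (auto simp: power_0_left)
    finally show ?thesis .
  qed
  \<comment> \<open>The value at points with second entry 0 is seen only in the other chart.\<close>
  hence P'0: "poly P' 0 = coeff P m" by simp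
  have "\<phi> g = (\<Sum>l\<le>m. coeff P l * (g $ 1 $ 1 ^ l * g $ 2 $ 1 ^ (m - l)))" if g: "g \<in> SL2" for g
  proof (cases "g $ 2 $ 1 = 0")
    case True
    hence "g $ 1 $ 1 \<noteq> 0" using g by (auto simp: mem_SL2)
    hence "\<phi> g = g $ 1 $ 1 ^ m * coeff P m" using chart2[OF g] True P'0 by simp
    also have "\<dots> = (\<Sum>l\<le>m. if l = m then coeff P l * g $ 1 $ 1 ^ l else 0)" by simp
    also have "\<dots> = (\<Sum>l\<le>m. coeff P l * (g $ 1 $ 1 ^ l * g $ 2 $ 1 ^ (m - l)))"
      by (rule sum.cong) (auto simp: True power_0_left)
    finally show ?thesis .
  qed (simp add: chart1[OF g] homog)
  thus ?thesis by blast
qed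

text \<open>
  The matrix of \<open>g\<close> on the dual of the \<open>n\<close>-th symmetric power, i.e. the coefficients of
  \<open>(g\<^sub>1\<^sub>1 z + g\<^sub>1\<^sub>2)\<^sup>l (g\<^sub>2\<^sub>1 z + g\<^sub>2\<^sub>2)\<^sup>n\<^sup>-\<^sup>l\<close>.
\<close>

definition sym_matrix :: "nat \<Rightarrow> 'k::field ^ 2 ^ 2 \<Rightarrow> nat \<Rightarrow> nat \<Rightarrow> 'k" where
  "sym_matrix n g l i = coeff ([:g $ 1 $ 2, g $ 1 $ 1:] ^ l * [:g $ 2 $ 2, g $ 2 $ 1:] ^ (n - l)) i"

text \<open>Substitutes \<open>B\<close> and \<open>D\<close> for the variables of the binary form
  of degree \<open>n\<close> whose dehomogenisation is \<open>F\<close>.\<close>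

definition homogenize :: "'k::field poly \<Rightarrow> 'k poly \<Rightarrow> nat \<Rightarrow> 'k poly \<Rightarrow> 'k poly" where
  "homogenize B D n F = (\<Sum>i\<le>n. smult (coeff F i) (B ^ i * D ^ (n - i)))"

lemma homogenize_linear_mult:
  assumes "degree F \<le> n"
  shows "homogenize B D (Suc n) ([:y, x:] * F) = (smult x B + smult y D) * homogenize B D n F"
proof -
  have c: "coeff ([:y, x:] * F) i = y * coeff F i + (if i = 0 then 0 else x * coeff F (i - 1))" for i
    by (cases i) (auto simp: mult_pCons_left coeff_pCons)
  have "homogenize B D (Suc n) ([:y, x:] * F) =
      (\<Sum>i\<le>Suc n. smult (y * coeff F i) (B ^ i * D ^ (Suc n - i))) +
      (\<Sum>i\<le>Suc n. smult (if i = 0 then 0 else x * coeff F (i - 1)) (B ^ i * D ^ (Suc n - i)))"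
    unfolding homogenize_def c smult_add_left sum.distrib ..
  also have "(\<Sum>i\<le>Suc n. smult (y * coeff F i) (B ^ i * D ^ (Suc n - i))) =
      (\<Sum>i\<le>n. smult (y * coeff F i) (B ^ i * D ^ (Suc n - i)))"
    using assms by (simp add: coeff_eq_0)
  also have "\<dots> = smult y D * homogenize B D n F"
    unfolding homogenize_def sum_distrib_left
    by (rule sum.cong) (auto simp: Suc_diff_le mult_ac)
  also have "(\<Sum>i\<le>Suc n. smult (if i = 0 then 0 else x * coeff F (i - 1)) (B ^ i * D ^ (Suc n - i))) =
      (\<Sum>i\<le>n. smult (x * coeff F i) (B ^ Suc i * D ^ (n - i)))"
    by (subst sum.atMost_Suc_shift) simp
  also have "\<dots> = smult x B * homogenize B D n F"
    unfolding homogenize_def sum_distrib_left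
    by (rule sum.cong) (auto simp: mult_ac)
  finally show ?thesis by (simp add: algebra_simps)
qed

lemma degree_linear_power: "degree ([:y, x:] ^ k :: 'k::field poly) \<le> k"
  using degree_power_le[of "[:y, x:]" k] by (simp split: if_splits)

lemma homogenize_linear_power_mult:
  assumes "degree F \<le> n"
  shows "homogenize B D (k + n) ([:y, x:] ^ k * F) = (smult x B + smult y D) ^ k * homogenize B D n F"
proof (induction k)
  case (Suc k)
  have "degree ([:y, x:] ^ k * F) \<le> k + n"
    by (rule order_trans[OF degree_mult_le]) (intro add_mono assms degree_linear_power)
  from homogenize_linear_mult[OF this, of B D y x] Suc show ?case
    by (simp only: power_Suc mult.assoc add_Suc)
qed simp

text \<open>With arbitrary polynomials in place of the two variables, this gives both evaluation at
  scalars and multiplicativity of \<open>sym_matrix\<close>.\<close>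

lemma sym_matrix_expand:
  assumes "l \<le> n"
  shows "(smult (g $ 1 $ 1) B + smult (g $ 1 $ 2) D) ^ l * (smult (g $ 2 $ 1) B + smult (g $ 2 $ 2) D) ^ (n - l) =
    (\<Sum>i\<le>n. smult (sym_matrix n g l i) (B ^ i * D ^ (n - i)))"
proof -
  let ?F = "[:g $ 2 $ 2, g $ 2 $ 1:] ^ (n - l)"
  have "homogenize B D (n - l) ?F = (smult (g $ 2 $ 1) B + smult (g $ 2 $ 2) D) ^ (n - l)"
    using homogenize_linear_power_mult[where F = 1 and n = 0 and B = B and D = D and k = "n - l"
        and y = "g $ 2 $ 2" and x = "g $ 2 $ 1"] by (simp add: homogenize_def)
  moreover have "homogenize B D n ([:g $ 1 $ 2, g $ 1 $ 1:] ^ l * ?F) =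
      (smult (g $ 1 $ 1) B + smult (g $ 1 $ 2) D) ^ l * homogenize B D (n - l) ?F"
    using homogenize_linear_power_mult[OF degree_linear_power[of "g $ 2 $ 2" "g $ 2 $ 1" "n - l"],
        where B = B and D = D and k = l and y = "g $ 1 $ 2" and x = "g $ 1 $ 1"] assms
    by simp
  ultimately show ?thesis by (simp add: homogenize_def sym_matrix_def)
qed

lemma sym_matrix_eval:
  assumes "l \<le> n"
  shows "(g $ 1 $ 1 * b + g $ 1 $ 2 * d) ^ l * (g $ 2 $ 1 * b + g $ 2 $ 2 * d) ^ (n - l) =
    (\<Sum>i\<le>n. sym_matrix n g l i * (b ^ i * d ^ (n - i)))"
  using arg_cong[OF sym_matrix_expand[OF assms, of g "[:b:]" "[:d:]"], of "\<lambda>P. poly P 0"]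
  by (simp add: poly_sum)

lemma sym_matrix_mult:
  assumes "l \<le> n"
  shows "sym_matrix n (g ** h) l i = (\<Sum>m\<le>n. sym_matrix n g l m * sym_matrix n h m i)"
proof -
  let ?B = "[:h $ 1 $ 2, h $ 1 $ 1:]" and ?D = "[:h $ 2 $ 2, h $ 2 $ 1:]"
  have "sym_matrix n (g ** h) l i = coeff ((smult (g $ 1 $ 1) ?B + smult (g $ 1 $ 2) ?D) ^ l *
      (smult (g $ 2 $ 1) ?B + smult (g $ 2 $ 2) ?D) ^ (n - l)) i"
    by (simp add: sym_matrix_def mat2_mult)
  also have "\<dots> = (\<Sum>m\<le>n. sym_matrix n g l m * sym_matrix n h m i)"
    unfolding sym_matrix_expand[OF assms] coeff_sum by (simp add: sym_matrix_def)
  finally show ?thesis .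
qed

lemma sym_matrix_one: "sym_matrix n (mat 1) l i = (if i = l then 1 else 0)"
proof -
  have "[:0, 1:] ^ l = (monom 1 l :: 'a poly)" by (simp add: monom_altdef)
  thus ?thesis by (simp add: sym_matrix_def mat_def flip: one_pCons)
qed

lemma sym_matrix_upper: "sym_matrix n (upper b) l i = of_nat (l choose i) * b ^ (l - i)"
proof -
  have "sym_matrix n (upper b) l i = coeff ([:b, 1:] ^ l * [:1:] ^ (n - l)) i"
    by (simp add: sym_matrix_def upper_def)
  also have "[:1:] ^ (n - l) = (1 :: 'a poly)" by (simp only: pCons_one power_one)
  finally have eq: "sym_matrix n (upper b) l i = coeff ([:b, 1:] ^ l) i" by simp
  show ?thesis
  proof (cases "i \<le> l")
    case True
    thus ?thesis by (simp add: eq coeff_linear_poly_power)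
  next
    case False
    hence "degree ([:b, 1:] ^ l) < i" using degree_linear_power[of b 1 l] by simp
    thus ?thesis using False by (simp add: eq coeff_eq_0 binomial_eq_0)
  qed
qed

lemma sym_matrix_torus:
  assumes "s \<noteq> 0" and "l \<le> n"
  shows "sym_matrix n (torus s) l i = (if i = l then s powi (2 * int l - int n) else 0)"
proof -
  have "[:0, s:] ^ l = monom (s ^ l) l"
  proof -
    have "[:0, s:] ^ l = smult s [:0, 1:] ^ l" by simp
    also have "\<dots> = smult (s ^ l) ([:0, 1:] ^ l)" by (rule smult_power)
    finally show ?thesis by (simp add: monom_altdef)
  qed
  moreover have "[:inverse s, 0:] ^ (n - l) = [:inverse s ^ (n - l):]" by (simp add: poly_const_pow)
  moreover have "s ^ l * inverse s ^ (n - l) = s powi (2 * int l - int n)"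
  proof -
    have eq: "2 * int l - int n = int l + - int (n - l)" using assms(2) by simp
    show ?thesis unfolding eq using assms(1)
      by (simp only: power_int_add power_int_minus power_int_of_nat power_inverse simp_thms)
  qed
  ultimately show ?thesis by (simp add: sym_matrix_def torus_def mult.commute)
qed

text \<open>Matrices with first column (z, 1) spread the last basis vector over all others with
  coefficients the powers of \<open>z\<close>, so a polynomial identity in \<open>z\<close> recovers
  every basis vector.\<close>

lemma sym_matrix_column:
  "l \<le> n \<Longrightarrow> sym_matrix n (mat2 z (- 1) 1 0) l n = z ^ l"
proof -
  assume l: "l \<le> n"
  have "sym_matrix n (mat2 z (- 1) 1 0) l n = coeff (monom 1 (n - l) * [:- 1, z:] ^ l) n"
    by (simp add: sym_matrix_def monom_altdef mult.commute)
  also have "\<dots> = coeff ([:- 1, z:] ^ l) l" using l by (simp add: coeff_monom_mult)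
  also have "\<dots> = z ^ l" by (simp add: coeff_linear_poly_power)
  finally show ?thesis .
qed

text \<open>
  The \<open>t\<close>-th powers of linear forms span a submodule of the \<open>t\<close>-th symmetric power; it involves
  only the monomials with non-zero binomial coefficient.
\<close>

lemma sym_matrix_eq_0:
  fixes g :: "'k::alg_closed_field ^ 2 ^ 2"
  assumes "j \<le> t" and "m \<le> t" and "(of_nat (t choose j) :: 'k) \<noteq> 0" and "(of_nat (t choose m) :: 'k) = 0"
  shows "sym_matrix t g j m = 0"
proof -
  let ?X = "[:g $ 1 $ 2, g $ 1 $ 1:]" and ?Y = "[:g $ 2 $ 2, g $ 2 $ 1:]"
  \<comment> \<open>For each \<open>\<alpha>\<close> the combination
    \<open>smult \<alpha> ?X + ?Y\<close> is a linear form, so the coefficient at \<open>m\<close>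
    of its \<open>t\<close>-th power contains the factor \<open>t choose m\<close>, which is 0.
    Hence the expansion of that coefficient in \<open>\<alpha>\<close> vanishes identically.\<close>
  define P where "P = (\<Sum>i\<le>t. monom (of_nat (t choose i) * sym_matrix t g i m) i)"
  have "poly P \<alpha> = 0" for \<alpha>
  proof -
    have "(smult \<alpha> ?X + ?Y) ^ t = (\<Sum>i\<le>t. of_nat (t choose i) * smult \<alpha> ?X ^ i * ?Y ^ (t - i))"
      by (rule binomial_ring)
    also have "\<dots> = (\<Sum>i\<le>t. smult (of_nat (t choose i) * \<alpha> ^ i) (?X ^ i * ?Y ^ (t - i)))"
      by (rule sum.cong[OF refl], simp only: smult_power of_nat_poly) (simp add: mult.commute)
    finally have "coeff ((smult \<alpha> ?X + ?Y) ^ t) m = (\<Sum>i\<le>t. of_nat (t choose i) * \<alpha> ^ i * sym_matrix t g i m)"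
      by (simp add: coeff_sum sym_matrix_def)
    also have "smult \<alpha> ?X + ?Y = [:\<alpha> * g $ 1 $ 2 + g $ 2 $ 2, \<alpha> * g $ 1 $ 1 + g $ 2 $ 1:]" by simp
    also have "coeff (\<dots> ^ t) m = 0" using assms(2,4) by (simp add: coeff_linear_poly_power)
    finally show ?thesis by (simp add: P_def poly_sum poly_monom mult_ac)
  qed
  hence "P = 0" using poly_eqI_infinite[OF infinite_UNIV_alg_closed, of P 0] by simp
  moreover have "coeff P j = of_nat (t choose j) * sym_matrix t g j m"
    using assms(1) by (simp add: P_def coeff_sum)
  ultimately show ?thesis using assms(3) by simp
qed

lemma sym_matrix_poly_funs: "(\<lambda>g. sym_matrix n g l i) \<in> poly_funs"
proof -
  have mult: "\<forall>i. (\<lambda>g. coeff (F g * H g) i) \<in> poly_funs"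
    if "\<forall>i. (\<lambda>g. coeff (F g) i) \<in> poly_funs" "\<forall>i. (\<lambda>g. coeff (H g) i) \<in> poly_funs"
    for F H :: "'a ^ 2 ^ 2 \<Rightarrow> 'a poly"
    unfolding coeff_mult using that by (intro allI poly_funs_sum poly_funs.mult) auto
  have pow: "\<forall>i. (\<lambda>g. coeff (F g ^ k) i) \<in> poly_funs"
    if "\<forall>i. (\<lambda>g. coeff (F g) i) \<in> poly_funs" for F :: "'a ^ 2 ^ 2 \<Rightarrow> 'a poly" and k
  proof (induction k)
    case (Suc k)
    thus ?case using mult[OF that Suc] by simp
  qed (simp add: poly_funs.const)
  have lin: "\<forall>i. (\<lambda>g. coeff [:g $ a $ b, g $ c $ d:] i) \<in> poly_funs" for a b c d :: 2
  proof
    fix i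
    show "(\<lambda>g. coeff [:g $ a $ b, g $ c $ d:] i) \<in> poly_funs"
    proof (cases i)
      case (Suc k)
      thus ?thesis by (cases k) (simp_all add: poly_funs.entry poly_funs.const)
    qed (simp add: poly_funs.entry)
  qed
  show ?thesis unfolding sym_matrix_def using mult[OF pow[OF lin] pow[OF lin]] by blast
qed

lemma restrict_coord_ring: "q \<in> poly_funs \<Longrightarrow> (\<lambda>g. if g \<in> SL2 then q g else 0) \<in> coord_ring"
  by (auto simp: coord_ring_def)

section \<open>Weyl modules\<close>

lemma linear_on_sum:
  assumes "vector_space s" and "vector_space t" and V: "module.subspace s V" and f: "linear_on V s t f"
  shows "finite A \<Longrightarrow> (\<And>i. i \<in> A \<Longrightarrow> x i \<in> V) \<Longrightarrow>
    f (\<Sum>i\<in>A. s (a i) (x i)) = (\<Sum>i\<in>A. t (a i) (f (x i)))"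
proof (induction A rule: finite_induct)
  interpret s: vector_space s by fact
  interpret t: vector_space t by fact
  case empty
  have "f (s 0 0) = t 0 (f 0)" using f s.subspace_0[OF V] unfolding linear_on_def by blast
  thus ?case by simp
next
  interpret s: vector_space s by fact
  interpret t: vector_space t by fact
  case (insert i A)
  have 1: "s (a i) (x i) \<in> V" using insert.prems by (intro s.subspace_scale[OF V]) simp
  have 2: "(\<Sum>i\<in>A. s (a i) (x i)) \<in> V"
    using insert.prems by (intro s.subspace_sum[OF V] s.subspace_scale[OF V]) simp
  have "f (s (a i) (x i) + (\<Sum>i\<in>A. s (a i) (x i))) = f (s (a i) (x i)) + f (\<Sum>i\<in>A. s (a i) (x i))"
    using f 1 2 unfolding linear_on_def by blast
  moreover have "f (s (a i) (x i)) = t (a i) (f (x i))"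
    using f insert.prems[of i] unfolding linear_on_def by blast
  ultimately show ?case using insert by simp
qed

lemma vector_space_fun_scale: "vector_space (fun_scale :: 'k::field \<Rightarrow> ('x \<Rightarrow> 'k) \<Rightarrow> 'x \<Rightarrow> 'k)"
  by unfold_locales (auto simp: fun_scale_def algebra_simps)

lemma vector_space_times: "vector_space ((*) :: 'k::field \<Rightarrow> 'k \<Rightarrow> 'k)"
  by unfold_locales (auto simp: algebra_simps)

text \<open>The second column is the relevant one because the Borel subgroup is lower triangular:
  right multiplication by \<open>b\<close> scales that column by the inverse of
  \<open>b $ 1 $ 1\<close>.\<close>

definition sym_mono :: "nat \<Rightarrow> nat \<Rightarrow> 'k::field ^ 2 ^ 2 \<Rightarrow> 'k" where
  "sym_mono m l g = (if g \<in> SL2 then g $ 1 $ 2 ^ l * g $ 2 $ 2 ^ (m - l) else 0)"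

lemma borel2_entries:
  assumes "b \<in> borel2"
  shows "b \<in> SL2" and "b $ 1 $ 2 = 0" and "b $ 1 $ 1 \<noteq> 0" and "b $ 2 $ 2 = inverse (b $ 1 $ 1)"
proof -
  show "b \<in> SL2" "b $ 1 $ 2 = 0" using assms by (auto simp: borel2_def)
  hence "b $ 1 $ 1 * b $ 2 $ 2 = 1" by (simp add: mem_SL2)
  thus "b $ 1 $ 1 \<noteq> 0" "b $ 2 $ 2 = inverse (b $ 1 $ 1)"
    by (auto simp: inverse_unique)
qed

lemma sym_mono_ind_B:
  assumes "l \<le> m"
  shows "(sym_mono m l :: 'k::field ^ 2 ^ 2 \<Rightarrow> 'k) \<in> gspace (ind_B m)"
proof -
  have "(\<lambda>g :: 'k ^ 2 ^ 2. g $ 1 $ 2 ^ l * g $ 2 $ 2 ^ (m - l)) \<in> poly_funs"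
    by (intro poly_funs.mult poly_funs_power poly_funs.entry)
  hence "(sym_mono m l :: 'k ^ 2 ^ 2 \<Rightarrow> 'k) \<in> coord_ring"
    using restrict_coord_ring by (simp add: sym_mono_def[abs_def])
  moreover have "sym_mono m l (g ** b) = inverse (b $ 1 $ 1 ^ m) * sym_mono m l g"
    if g: "g \<in> SL2" and b: "b \<in> borel2" for g b :: "'k ^ 2 ^ 2"
  proof -
    have "b $ 1 $ 1 ^ m = b $ 1 $ 1 ^ l * b $ 1 $ 1 ^ (m - l)" using assms by (simp flip: power_add)
    thus ?thesis using g borel2_entries[OF b]
      by (simp add: sym_mono_def mat2_mult power_mult_distrib power_inverse)
  qed
  ultimately show ?thesis by (simp add: ind_B_def)
qed

lemma sym_mono_upper: "sym_mono m l (upper z) = z ^ l"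
  by (simp add: sym_mono_def) (simp add: upper_def)

lemma ind_B_subspace: "module.subspace fun_scale (gspace (ind_B m :: ('k::field, _) gmod))"
proof -
  interpret vector_space "fun_scale :: 'k \<Rightarrow> ('k ^ 2 ^ 2 \<Rightarrow> 'k) \<Rightarrow> _" by (rule vector_space_fun_scale)
  show ?thesis
  proof (rule subspaceI)
    show "0 \<in> gspace (ind_B m)" by (auto simp: ind_B_def coord_ring_def intro!: bexI[OF _ poly_funs.const[of 0]])
  next
    fix f h assume f: "f \<in> gspace (ind_B m :: ('k, _) gmod)" and h: "h \<in> gspace (ind_B m :: ('k, _) gmod)"
    obtain q q' where "q \<in> poly_funs" "q' \<in> poly_funs" "\<And>g. g \<in> SL2 \<Longrightarrow> f g = q g" "\<And>g. g \<in> SL2 \<Longrightarrow> h g = q' g"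
      using f h by (auto simp: ind_B_def coord_ring_def)
    hence "f + h \<in> coord_ring"
      using f h by (auto simp: ind_B_def coord_ring_def intro!: bexI[of _ "\<lambda>g. q g + q' g"] poly_funs.add)
    moreover have "(f + h) (g ** b) = inverse (b $ 1 $ 1 ^ m) * (f + h) g" if "g \<in> SL2" "b \<in> borel2" for g b
      using f h that by (simp add: ind_B_def algebra_simps)
    ultimately show "f + h \<in> gspace (ind_B m)" by (simp add: ind_B_def)
  next
    fix c and f assume f: "f \<in> gspace (ind_B m :: ('k, _) gmod)"
    obtain q where "q \<in> poly_funs" "\<And>g. g \<in> SL2 \<Longrightarrow> f g = q g"
      using f by (auto simp: ind_B_def coord_ring_def)
    hence "fun_scale c f \<in> coord_ring"
      using f by (auto simp: ind_B_def coord_ring_def fun_scale_def intro!: bexI[of _ "\<lambda>g. c * q g"] poly_funs.mult poly_funs.const)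
    moreover have "fun_scale c f (g ** b) = inverse (b $ 1 $ 1 ^ m) * fun_scale c f g" if "g \<in> SL2" "b \<in> borel2" for g b
      using f that by (simp add: ind_B_def fun_scale_def)
    ultimately show "fun_scale c f \<in> gspace (ind_B m)" by (simp add: ind_B_def)
  qed
qed

text \<open>Right translation by the Weyl group element \<open>?w\<close> moves the second column to
  the first and the lower triangular matrices to upper triangular ones, where
  \<open>first_column_function\<close> applies.\<close>

lemma ind_B_span:
  fixes f :: "'k::alg_closed_field ^ 2 ^ 2 \<Rightarrow> 'k"
  assumes "f \<in> gspace (ind_B m)"
  shows "\<exists>a. f = (\<Sum>l\<le>m. fun_scale (a l) (sym_mono m l))"
proof -
  let ?w = "mat2 0 1 (- 1) 0 :: 'k ^ 2 ^ 2" and ?w' = "mat2 0 (- 1) 1 0 :: 'k ^ 2 ^ 2"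
  obtain q where q: "q \<in> poly_funs" "\<And>g. g \<in> SL2 \<Longrightarrow> f g = q g" and off: "\<And>g. g \<notin> SL2 \<Longrightarrow> f g = 0"
    and eq: "\<And>g b. g \<in> SL2 \<Longrightarrow> b \<in> borel2 \<Longrightarrow> f (g ** b) = inverse (b $ 1 $ 1 ^ m) * f g"
    using assms by (auto simp: ind_B_def coord_ring_def)
  have w: "?w \<in> SL2" "?w' \<in> SL2" by (simp_all add: mem_SL2)
  have "\<exists>a. \<forall>g\<in>SL2. f (g ** ?w) = (\<Sum>l\<le>m. a l * (g $ 1 $ 1 ^ l * g $ 2 $ 1 ^ (m - l)))"
  proof (rule first_column_function)
    show "(\<lambda>g. q (g ** ?w)) \<in> poly_funs" by (rule poly_funs_right_mult[OF q(1)])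
    show "f (g ** ?w) = q (g ** ?w)" if "g \<in> SL2" for g using that w q(2) by simp
    show "f (g ** upper t ** ?w) = f (g ** ?w)" if g: "g \<in> SL2" for g t
    proof -
      let ?b = "mat2 1 0 (- t) 1 :: 'k ^ 2 ^ 2"
      have "g ** upper t ** ?w = g ** ?w ** ?b"
        by (rule mat2_eqI) (simp_all add: mat2_mult upper_def algebra_simps)
      moreover have "?b \<in> borel2" by (simp add: borel2_def mem_SL2)
      ultimately show ?thesis using eq[of "g ** ?w" ?b] g w by simp
    qed
    show "f (g ** torus s ** ?w) = s ^ m * f (g ** ?w)" if g: "g \<in> SL2" and s: "s \<noteq> 0" for g s
    proof -
      let ?b = "mat2 (inverse s) 0 0 s :: 'k ^ 2 ^ 2"
      have "g ** torus s ** ?w = g ** ?w ** ?b"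
        by (rule mat2_eqI) (simp_all add: mat2_mult torus_def algebra_simps)
      moreover have "?b \<in> borel2" using s by (simp add: borel2_def mem_SL2)
      ultimately show ?thesis using eq[of "g ** ?w" ?b] g w s by (simp add: power_inverse)
    qed
  qed
  then obtain a where a: "\<And>g. g \<in> SL2 \<Longrightarrow> f (g ** ?w) = (\<Sum>l\<le>m. a l * (g $ 1 $ 1 ^ l * g $ 2 $ 1 ^ (m - l)))" by blast
  have "f g = (\<Sum>l\<le>m. fun_scale (a l) (sym_mono m l)) g" for g
  proof (cases "g \<in> SL2")
    case True
    have "g ** ?w' ** ?w = g" by (rule mat2_eqI) (simp_all add: mat2_mult)
    hence "f g = f (g ** ?w' ** ?w)" by simp
    also have "\<dots> = (\<Sum>l\<le>m. a l * (g $ 1 $ 2 ^ l * g $ 2 $ 2 ^ (m - l)))"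
      using a[of "g ** ?w'"] True w by (simp add: mat2_mult)
    finally show ?thesis using True by (simp add: sum_fun_apply fun_scale_def sym_mono_def)
  qed (simp add: off sum_fun_apply fun_scale_def sym_mono_def)
  thus ?thesis by blast
qed

text \<open>On \<open>upper z\<close> the monomials become the powers of \<open>z\<close>.\<close>

lemma sym_mono_independent:
  fixes a b :: "nat \<Rightarrow> 'k::alg_closed_field"
  assumes "(\<Sum>l\<le>m. fun_scale (a l) (sym_mono m l)) = (\<Sum>l\<le>m. fun_scale (b l) (sym_mono m l))" and "l \<le> m"
  shows "a l = b l"
proof -
  have "(\<Sum>l\<le>m. monom (a l) l) = (\<Sum>l\<le>m. monom (b l) l)"
  proof (rule poly_eqI_infinite[OF infinite_UNIV_alg_closed])
    fix z :: 'k
    show "poly (\<Sum>l\<le>m. monom (a l) l) z = poly (\<Sum>l\<le>m. monom (b l) l) z"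
      using fun_cong[OF assms(1), of "upper z"]
      by (simp add: sum_fun_apply fun_scale_def sym_mono_upper poly_sum poly_monom)
  qed
  from arg_cong[OF this, of "\<lambda>P. coeff P l"] assms(2) show ?thesis by (simp add: coeff_sum)
qed

lemma weyl_gspace:
  "\<phi> \<in> gspace (weyl m) \<longleftrightarrow> linear_on (gspace (ind_B m)) fun_scale (*) \<phi> \<and> (\<forall>f. f \<notin> gspace (ind_B m) \<longrightarrow> \<phi> f = 0)"
  by (simp add: weyl_def dual_module_def ind_B_def)

lemma gscale_weyl [simp]: "gscale (weyl m) = fun_scale"
  by (simp add: weyl_def dual_module_def)

lemma weyl_subspace: "module.subspace fun_scale (gspace (weyl m :: ('k::field, _) gmod))"
proof -
  interpret vector_space "fun_scale :: 'k \<Rightarrow> (('k ^ 2 ^ 2 \<Rightarrow> 'k) \<Rightarrow> 'k) \<Rightarrow> _" by (rule vector_space_fun_scale)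
  show ?thesis
    by (rule subspaceI) (auto simp: weyl_gspace linear_on_def fun_scale_def algebra_simps)
qed

lemma weyl_apply:
  fixes \<phi> :: "('k::alg_closed_field ^ 2 ^ 2 \<Rightarrow> 'k) \<Rightarrow> 'k"
  assumes "\<phi> \<in> gspace (weyl m)"
  shows "\<phi> (\<Sum>l\<le>m. fun_scale (a l) (sym_mono m l)) = (\<Sum>l\<le>m. a l * \<phi> (sym_mono m l))"
  by (rule linear_on_sum[OF vector_space_fun_scale vector_space_times ind_B_subspace])
    (use assms in \<open>auto simp: weyl_gspace sym_mono_ind_B\<close>)

lemma weyl_ext:
  fixes \<phi> \<psi> :: "('k::alg_closed_field ^ 2 ^ 2 \<Rightarrow> 'k) \<Rightarrow> 'k"
  assumes "\<phi> \<in> gspace (weyl m)" and "\<psi> \<in> gspace (weyl m)"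
    and "\<And>l. l \<le> m \<Longrightarrow> \<phi> (sym_mono m l) = \<psi> (sym_mono m l)"
  shows "\<phi> = \<psi>"
proof
  fix f
  show "\<phi> f = \<psi> f"
  proof (cases "f \<in> gspace (ind_B m)")
    case True
    then obtain a where f: "f = (\<Sum>l\<le>m. fun_scale (a l) (sym_mono m l))" using ind_B_span by blast
    show ?thesis unfolding f weyl_apply[OF assms(1)] weyl_apply[OF assms(2)]
      by (rule sum.cong) (use assms(3) in auto)
  qed (use assms(1,2) in \<open>auto simp: weyl_gspace\<close>)
qed

lemma matrix_inv_SL2:
  assumes "g \<in> (SL2 :: ('k::field ^ 2 ^ 2) set)"
  shows "g ** matrix_inv g = mat 1" and "matrix_inv g ** g = mat 1" and "matrix_inv g \<in> SL2"
    and "matrix_inv (matrix_inv g) = g"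
proof -
  have *: "h ** matrix_inv h = mat 1 \<and> matrix_inv h ** h = mat 1" if "h \<in> SL2" for h :: "'k ^ 2 ^ 2"
  proof -
    have "invertible h" using that by (simp add: SL2_def invertible_det_nz)
    thus ?thesis unfolding invertible_def matrix_inv_def by (rule someI_ex)
  qed
  show 1: "g ** matrix_inv g = mat 1" and 2: "matrix_inv g ** g = mat 1" using *[OF assms] by auto
  have "det g * det (matrix_inv g) = 1" using 1 by (metis det_I det_mul)
  thus 3: "matrix_inv g \<in> SL2" using assms by (simp add: SL2_def)
  have "matrix_inv (matrix_inv g) = matrix_inv (matrix_inv g) ** (matrix_inv g ** g)" using 2 by simp
  also have "\<dots> = g" using *[OF 3] by (simp add: matrix_mul_assoc)
  finally show "matrix_inv (matrix_inv g) = g" .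
qed

lemma weyl_act_apply:
  assumes "g \<in> SL2"
  shows "gact (weyl m) g \<phi> f = (if f \<in> gspace (ind_B m) then \<phi> (\<lambda>x. f (g ** x)) else 0)"
proof -
  have "gact (ind_B m) h f = (\<lambda>x. f (matrix_inv h ** x))" for h by (simp add: ind_B_def)
  thus ?thesis using matrix_inv_SL2(4)[OF assms] by (simp add: weyl_def dual_module_def)
qed

text \<open>Left translation by \<open>g\<close> substitutes linear forms into monomials in the
  second column, and \<open>sym_matrix\<close> records the coefficients.\<close>

lemma weyl_act:
  fixes \<phi> :: "('k::alg_closed_field ^ 2 ^ 2 \<Rightarrow> 'k) \<Rightarrow> 'k"
  assumes g: "g \<in> SL2" and \<phi>: "\<phi> \<in> gspace (weyl m)" and l: "l \<le> m"
  shows "gact (weyl m) g \<phi> (sym_mono m l) = (\<Sum>i\<le>m. sym_matrix m g l i * \<phi> (sym_mono m i))"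
proof -
  have "(\<lambda>x. sym_mono m l (g ** x)) = (\<Sum>i\<le>m. fun_scale (sym_matrix m g l i) (sym_mono m i))"
  proof
    fix x
    show "sym_mono m l (g ** x) = (\<Sum>i\<le>m. fun_scale (sym_matrix m g l i) (sym_mono m i)) x"
    proof (cases "x \<in> SL2")
      case True
      thus ?thesis using g sym_matrix_eval[OF l, of g "x $ 1 $ 2" "x $ 2 $ 2"]
        by (simp add: sum_fun_apply fun_scale_def sym_mono_def mat2_mult)
    next
      case False
      have "g ** x \<notin> SL2"
      proof
        assume "g ** x \<in> SL2"
        hence "matrix_inv g ** (g ** x) \<in> SL2" using matrix_inv_SL2(3)[OF g] by simp
        thus False using False matrix_inv_SL2(2)[OF g] by (simp add: matrix_mul_assoc)
      qed
      thus ?thesis using False by (simp add: sum_fun_apply fun_scale_def sym_mono_def)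
    qed
  qed
  moreover have "gact (weyl m) g \<phi> (sym_mono m l) = \<phi> (\<lambda>x. sym_mono m l (g ** x))"
    by (simp add: weyl_act_apply[OF g] sym_mono_ind_B[OF l])
  ultimately show ?thesis using weyl_apply[OF \<phi>] by simp
qed

lemma ind_B_translate:
  fixes f :: "'k::field ^ 2 ^ 2 \<Rightarrow> 'k"
  assumes g: "g \<in> SL2" and f: "f \<in> gspace (ind_B m)"
  shows "(\<lambda>x. f (g ** x)) \<in> gspace (ind_B m)"
proof -
  have iff: "g ** x \<in> SL2 \<longleftrightarrow> x \<in> SL2" for x
    using g by (simp add: SL2_def det_mul)
  obtain q where q: "q \<in> poly_funs" "\<And>x. x \<in> SL2 \<Longrightarrow> f x = q x" using f by (auto simp: ind_B_def coord_ring_def)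
  have "(\<lambda>x. q (g ** x)) \<in> poly_funs"
    using q(1)
  proof induction
    case (entry i j)
    show ?case unfolding mat2_mult by (intro poly_funs.add poly_funs.mult poly_funs.entry poly_funs.const)
  qed (simp_all add: poly_funs.intros)
  hence "(\<lambda>x. f (g ** x)) \<in> coord_ring"
    using q(2) f by (auto simp: coord_ring_def iff ind_B_def intro!: bexI[of _ "\<lambda>x. q (g ** x)"])
  moreover have "f (g ** (x ** b)) = inverse (b $ 1 $ 1 ^ m) * f (g ** x)" if "x \<in> SL2" "b \<in> borel2" for x b
    using f that g by (simp add: ind_B_def matrix_mul_assoc)
  ultimately show ?thesis by (simp add: ind_B_def)
qed

lemma weyl_act_mem:
  fixes \<phi> :: "('k::field ^ 2 ^ 2 \<Rightarrow> 'k) \<Rightarrow> 'k"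
  assumes g: "g \<in> SL2" and \<phi>: "\<phi> \<in> gspace (weyl m)"
  shows "gact (weyl m) g \<phi> \<in> gspace (weyl m)"
proof -
  have act: "gact (weyl m) g \<phi> f = (if f \<in> gspace (ind_B m) then \<phi> (\<lambda>x. f (g ** x)) else 0)" for f
    by (rule weyl_act_apply[OF g])
  interpret vector_space "fun_scale :: 'k \<Rightarrow> ('k ^ 2 ^ 2 \<Rightarrow> 'k) \<Rightarrow> _" by (rule vector_space_fun_scale)
  show ?thesis
    unfolding weyl_gspace linear_on_def
  proof (intro conjI ballI allI impI)
    fix f h :: "'k ^ 2 ^ 2 \<Rightarrow> 'k" assume fh: "f \<in> gspace (ind_B m)" "h \<in> gspace (ind_B m)"
    hence "f + h \<in> gspace (ind_B m)" by (rule subspace_add[OF ind_B_subspace])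
    moreover have "\<phi> ((\<lambda>x. f (g ** x)) + (\<lambda>x. h (g ** x))) = \<phi> (\<lambda>x. f (g ** x)) + \<phi> (\<lambda>x. h (g ** x))"
      using \<phi> ind_B_translate[OF g fh(1)] ind_B_translate[OF g fh(2)] unfolding weyl_gspace linear_on_def by blast
    moreover have "(\<lambda>x. f (g ** x)) + (\<lambda>x. h (g ** x)) = (\<lambda>x. (f + h) (g ** x))" by auto
    ultimately show "gact (weyl m) g \<phi> (f + h) = gact (weyl m) g \<phi> f + gact (weyl m) g \<phi> h"
      using fh by (simp only: act if_True)
  next
    fix c and f :: "'k ^ 2 ^ 2 \<Rightarrow> 'k" assume f: "f \<in> gspace (ind_B m)"
    hence "fun_scale c f \<in> gspace (ind_B m)" by (rule subspace_scale[OF ind_B_subspace])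
    moreover have "\<phi> (fun_scale c (\<lambda>x. f (g ** x))) = c * \<phi> (\<lambda>x. f (g ** x))"
      using \<phi> ind_B_translate[OF g f] unfolding weyl_gspace linear_on_def by blast
    moreover have "fun_scale c (\<lambda>x. f (g ** x)) = (\<lambda>x. fun_scale c f (g ** x))" by (simp add: fun_scale_def)
    ultimately show "gact (weyl m) g \<phi> (fun_scale c f) = c * gact (weyl m) g \<phi> f"
      using f by (simp only: act if_True)
  qed (simp add: act)
qed

text \<open>The basis dual to the monomials \<open>sym_mono\<close>; \<open>weyl_vec m m\<close> is
  the highest weight vector.\<close>

definition weyl_vec :: "nat \<Rightarrow> nat \<Rightarrow> ('k::field ^ 2 ^ 2 \<Rightarrow> 'k) \<Rightarrow> 'k" where
  "weyl_vec m l f = (if f \<in> gspace (ind_B m)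
     then (SOME a. f = (\<Sum>l\<le>m. fun_scale (a l) (sym_mono m l))) l else 0)"

lemma weyl_vec_apply:
  fixes a :: "nat \<Rightarrow> 'k::alg_closed_field"
  assumes "l \<le> m"
  shows "weyl_vec m l (\<Sum>l\<le>m. fun_scale (a l) (sym_mono m l)) = a l"
proof -
  interpret vector_space "fun_scale :: 'k \<Rightarrow> ('k ^ 2 ^ 2 \<Rightarrow> 'k) \<Rightarrow> _" by (rule vector_space_fun_scale)
  let ?f = "\<Sum>l\<le>m. fun_scale (a l) (sym_mono m l)"
  define b where "b = (SOME a. ?f = (\<Sum>l\<le>m. fun_scale (a l) (sym_mono m l)))"
  have "?f = (\<Sum>l\<le>m. fun_scale (b l) (sym_mono m l))"
    unfolding b_def by (rule someI[where x = a]) (rule refl)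
  hence "a l = b l" by (rule sym_mono_independent) (rule assms)
  moreover have "?f \<in> gspace (ind_B m)"
    by (intro subspace_sum[OF ind_B_subspace] subspace_scale[OF ind_B_subspace] sym_mono_ind_B) simp
  ultimately show ?thesis by (simp add: weyl_vec_def b_def)
qed

lemma weyl_vec_mem:
  assumes l: "l \<le> m"
  shows "(weyl_vec m l :: ('k::alg_closed_field ^ 2 ^ 2 \<Rightarrow> 'k) \<Rightarrow> 'k) \<in> gspace (weyl m)"
proof -
  interpret vector_space "fun_scale :: 'k \<Rightarrow> ('k ^ 2 ^ 2 \<Rightarrow> 'k) \<Rightarrow> _" by (rule vector_space_fun_scale)
  show ?thesis
    unfolding weyl_gspace linear_on_def
  proof (intro conjI ballI allI impI)
    fix f h :: "'k ^ 2 ^ 2 \<Rightarrow> 'k" assume "f \<in> gspace (ind_B m)" "h \<in> gspace (ind_B m)"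
    then obtain a b where "f = (\<Sum>l\<le>m. fun_scale (a l) (sym_mono m l))" "h = (\<Sum>l\<le>m. fun_scale (b l) (sym_mono m l))"
      using ind_B_span by blast
    moreover from this have "f + h = (\<Sum>l\<le>m. fun_scale (a l + b l) (sym_mono m l))"
      by (simp add: scale_left_distrib sum.distrib)
    ultimately show "weyl_vec m l (f + h) = weyl_vec m l f + weyl_vec m l h"
      by (simp only: weyl_vec_apply[OF l])
  next
    fix c and f :: "'k ^ 2 ^ 2 \<Rightarrow> 'k" assume "f \<in> gspace (ind_B m)"
    then obtain a where "f = (\<Sum>l\<le>m. fun_scale (a l) (sym_mono m l))"
      using ind_B_span by blast
    moreover from this have "fun_scale c f = (\<Sum>l\<le>m. fun_scale (c * a l) (sym_mono m l))"
      by (simp add: scale_sum_right)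
    ultimately show "weyl_vec m l (fun_scale c f) = c * weyl_vec m l f"
      by (simp only: weyl_vec_apply[OF l])
  qed (simp add: weyl_vec_def)
qed

lemma weyl_vec_mono:
  assumes "l \<le> m" and "i \<le> m"
  shows "weyl_vec m l (sym_mono m i :: 'k::alg_closed_field ^ 2 ^ 2 \<Rightarrow> 'k) = (if i = l then 1 else 0)"
proof -
  interpret vector_space "fun_scale :: 'k \<Rightarrow> ('k ^ 2 ^ 2 \<Rightarrow> 'k) \<Rightarrow> _" by (rule vector_space_fun_scale)
  have "(\<Sum>j\<le>m. fun_scale (if j = i then 1 else 0) (sym_mono m j)) = (\<Sum>j\<le>m. if j = i then sym_mono m j else 0 :: 'k ^ 2 ^ 2 \<Rightarrow> 'k)"
    by (rule sum.cong) auto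
  also have "\<dots> = sym_mono m i" using assms(2) by simp
  finally have "(\<Sum>j\<le>m. fun_scale (if j = i then 1 else 0) (sym_mono m j)) = (sym_mono m i :: 'k ^ 2 ^ 2 \<Rightarrow> 'k)" .
  thus ?thesis using weyl_vec_apply[OF assms(1), of "\<lambda>j. if j = i then 1 else (0::'k)"] by simp
qed

lemma weyl_expand:
  fixes \<phi> :: "('k::alg_closed_field ^ 2 ^ 2 \<Rightarrow> 'k) \<Rightarrow> 'k"
  assumes "\<phi> \<in> gspace (weyl m)"
  shows "\<phi> = (\<Sum>l\<le>m. fun_scale (\<phi> (sym_mono m l)) (weyl_vec m l))"
proof -
  interpret vector_space "fun_scale :: 'k \<Rightarrow> (('k ^ 2 ^ 2 \<Rightarrow> 'k) \<Rightarrow> 'k) \<Rightarrow> _" by (rule vector_space_fun_scale)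
  show ?thesis
  proof (rule weyl_ext[OF assms])
    show "(\<Sum>l\<le>m. fun_scale (\<phi> (sym_mono m l)) (weyl_vec m l)) \<in> gspace (weyl m)"
      by (intro subspace_sum[OF weyl_subspace] subspace_scale[OF weyl_subspace] weyl_vec_mem) simp
    fix i assume i: "i \<le> m"
    have "(\<Sum>l\<le>m. fun_scale (\<phi> (sym_mono m l)) (weyl_vec m l)) (sym_mono m i) =
        (\<Sum>l\<le>m. if l = i then \<phi> (sym_mono m i) else 0)"
      unfolding sum_fun_apply by (rule sum.cong) (use i in \<open>auto simp: fun_scale_def weyl_vec_mono\<close>)
    thus "\<phi> (sym_mono m i) = (\<Sum>l\<le>m. fun_scale (\<phi> (sym_mono m l)) (weyl_vec m l)) (sym_mono m i)"
      using i by simp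
  qed
qed

lemma weyl_act_vec:
  assumes g: "g \<in> (SL2 :: ('k::alg_closed_field ^ 2 ^ 2) set)" and j: "j \<le> m"
  shows "gact (weyl m) g (weyl_vec m j) = (\<Sum>l\<le>m. fun_scale (sym_matrix m g l j) (weyl_vec m l))"
proof -
  have "gact (weyl m) g (weyl_vec m j) (sym_mono m l) = sym_matrix m g l j" if "l \<le> m" for l
  proof -
    have "gact (weyl m) g (weyl_vec m j) (sym_mono m l) = (\<Sum>i\<le>m. if i = j then sym_matrix m g l i else 0)"
      unfolding weyl_act[OF g weyl_vec_mem[OF j] that] by (rule sum.cong) (use j in \<open>auto simp: weyl_vec_mono\<close>)
    thus ?thesis using j by simp
  qed
  thus ?thesis using weyl_expand[OF weyl_act_mem[OF g weyl_vec_mem[OF j]]] by simp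
qed

section \<open>Homomorphisms out of a Weyl module\<close>

lemma G_hom_weyl_sum:
  fixes M :: "('k::alg_closed_field, 'v::ab_group_add) gmod"
  assumes "vector_space (gscale M)" and "f \<in> G_hom (weyl m) M"
  shows "f (\<Sum>l\<le>m. fun_scale (a l) (weyl_vec m l)) = (\<Sum>l\<le>m. gscale M (a l) (f (weyl_vec m l)))"
  by (rule linear_on_sum[OF vector_space_fun_scale assms(1) weyl_subspace])
    (use assms(2) in \<open>auto simp: G_hom_def weyl_vec_mem\<close>)

text \<open>The highest weight vector generates the Weyl module: its translates by
  \<open>mat2 z (- 1) 1 0\<close> have the powers of \<open>z\<close> as coordinates, and infinitely
  many \<open>z\<close> separate these.\<close>

lemma G_hom_weyl_eqI:
  fixes M :: "('k::alg_closed_field, 'v::ab_group_add) gmod"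
  assumes M: "rational_module M" and f: "f \<in> G_hom (weyl m) M" and h: "h \<in> G_hom (weyl m) M"
    and eq: "f (weyl_vec m m) = h (weyl_vec m m)"
  shows "f = h"
proof -
  interpret rational_mod M by standard fact
  have l: "f (weyl_vec m l) = h (weyl_vec m l)" if "l \<le> m" for l
  proof -
    have "(\<Sum>l<Suc m. gscale M (z ^ l) (f (weyl_vec m l) - h (weyl_vec m l))) \<in> {0}" for z
    proof -
      let ?g = "mat2 z (- 1) 1 0"
      have g: "?g \<in> SL2" by (simp add: mem_SL2)
      have *: "gact M ?g (f (weyl_vec m m)) = (\<Sum>l\<le>m. gscale M (z ^ l) (f (weyl_vec m l)))" if "f \<in> G_hom (weyl m) M" for f
      proof -
        have "gact M ?g (f (weyl_vec m m)) = f (gact (weyl m) ?g (weyl_vec m m))"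
          using G_homD(4)[OF that g weyl_vec_mem[of m m]] by simp
        also have "\<dots> = f (\<Sum>l\<le>m. fun_scale (sym_matrix m ?g l m) (weyl_vec m l))"
          using weyl_act_vec[OF g, of m m] by simp
        also have "\<dots> = (\<Sum>l\<le>m. gscale M (sym_matrix m ?g l m) (f (weyl_vec m l)))"
          by (rule G_hom_weyl_sum[OF vector_space_axioms that])
        also have "\<dots> = (\<Sum>l\<le>m. gscale M (z ^ l) (f (weyl_vec m l)))"
          by (rule sum.cong) (auto simp: sym_matrix_column)
        finally show ?thesis .
      qed
      show ?thesis using *[OF f] *[OF h] eq
        by (simp only: lessThan_Suc_atMost scale_right_diff_distrib sum_subtractf) simp
    qed
    from poly_coeffs_mem[OF infinite_k _ this, of l] that show ?thesis by (simp add: subspace_single_0)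
  qed
  show ?thesis
  proof
    fix \<phi> show "f \<phi> = h \<phi>"
    proof (cases "\<phi> \<in> gspace (weyl m)")
      case True
      have "f (\<Sum>l\<le>m. fun_scale (\<phi> (sym_mono m l)) (weyl_vec m l)) = h (\<Sum>l\<le>m. fun_scale (\<phi> (sym_mono m l)) (weyl_vec m l))"
        unfolding G_hom_weyl_sum[OF vector_space_axioms f] G_hom_weyl_sum[OF vector_space_axioms h]
        by (rule sum.cong) (auto simp: l)
      thus ?thesis using weyl_expand[OF True] by simp
    qed (simp add: G_homD(5)[OF f] G_homD(5)[OF h])
  qed
qed

lemma G_hom_weyl_vec:
  fixes M :: "('k::alg_closed_field, 'v::ab_group_add) gmod"
  assumes M: "rational_module M" and f: "f \<in> G_hom (weyl m) M" and l: "l \<le> m"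
  shows "f (weyl_vec m l) \<in> wt M (2 * int l - int m)"
    and "E_op M t (f (weyl_vec m l)) =
      (if l + t \<le> m then gscale M (of_nat ((l + t) choose t)) (f (weyl_vec m (l + t))) else 0)"
proof -
  interpret rational_mod M by standard fact
  have act: "gact M g (f (weyl_vec m l)) = (\<Sum>i\<le>m. gscale M (sym_matrix m g i l) (f (weyl_vec m i)))"
    if g: "g \<in> SL2" for g
    using G_homD(4)[OF f g weyl_vec_mem[OF l]] weyl_act_vec[OF g l] G_hom_weyl_sum[OF vector_space_axioms f] by simp
  have "gact M (torus s) (f (weyl_vec m l)) = gscale M (s powi (2 * int l - int m)) (f (weyl_vec m l))"
    if s: "s \<noteq> 0" for s
  proof -
    have "gact M (torus s) (f (weyl_vec m l)) =
        (\<Sum>i\<le>m. if i = l then gscale M (s powi (2 * int l - int m)) (f (weyl_vec m l)) else 0)"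
      unfolding act[OF torus_SL2[OF s]] by (rule sum.cong) (use s in \<open>auto simp: sym_matrix_torus\<close>)
    thus ?thesis using l by simp
  qed
  thus "f (weyl_vec m l) \<in> wt M (2 * int l - int m)"
    using G_homD(1)[OF f weyl_vec_mem[OF l]] by (simp add: wt_def)
  let ?c = "\<lambda>t. if l + t \<le> m then gscale M (of_nat ((l + t) choose t)) (f (weyl_vec m (l + t))) else 0"
  show "E_op M t (f (weyl_vec m l)) = ?c t"
  proof (rule E_op_eqI'[where J = "Suc (m - l)"])
    fix b
    have "gact M (upper b) (f (weyl_vec m l)) =
        (\<Sum>i\<le>m. gscale M (of_nat (i choose l) * b ^ (i - l)) (f (weyl_vec m i)))"
      unfolding act[OF upper_SL2] sym_matrix_upper ..
    also have "\<dots> = (\<Sum>i\<in>{l..m}. gscale M (of_nat (i choose l) * b ^ (i - l)) (f (weyl_vec m i)))"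
      by (rule sum.mono_neutral_right) (auto simp: binomial_eq_0)
    also have "\<dots> = (\<Sum>j<Suc (m - l). gscale M (of_nat ((l + j) choose l) * b ^ j) (f (weyl_vec m (l + j))))"
      by (rule sum.reindex_bij_witness[of _ "\<lambda>j. l + j" "\<lambda>i. i - l"]) (use l in auto)
    also have "\<dots> = (\<Sum>j<Suc (m - l). gscale M (b ^ j) (?c j))"
    proof (rule sum.cong[OF refl])
      fix j assume "j \<in> {..<Suc (m - l)}"
      hence "l + j \<le> m" using l by auto
      moreover have "(l + j) choose l = (l + j) choose j" using binomial_symmetric[of l "l + j"] by simp
      ultimately show "gscale M (of_nat ((l + j) choose l) * b ^ j) (f (weyl_vec m (l + j))) = gscale M (b ^ j) (?c j)"
        by (simp add: mult.commute)
    qed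
    finally show "gact M (upper b) (f (weyl_vec m l)) = (\<Sum>j<Suc (m - l). gscale M (b ^ j) (?c j))" .
  qed (use l in auto)
qed

text \<open>The orbit map of \<open>w\<close> is invariant under the unipotent group and homogeneous
  under the torus, hence a form of degree \<open>m\<close> in the first column of the group element.
  Its vector coefficients \<open>\<mu> l\<close> transform like the basis of \<open>V(m)\<close>. A
  functional reduces the claim about the orbit map to scalar functions.\<close>

lemma (in rational_mod) highest_weight_orbit:
  assumes w: "w \<in> wt M (int m)" and E: "\<And>t. t \<ge> 1 \<Longrightarrow> E_op M t w = 0"
  shows "\<exists>\<mu>. (\<forall>l. \<mu> l \<in> gspace M) \<and> \<mu> m = w \<and>
    (\<forall>h\<in>SL2. \<forall>i\<le>m. gact M h (\<mu> i) = (\<Sum>l\<le>m. gscale M (sym_matrix m h l i) (\<mu> l)))"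
proof -
  note wM = wt_gspace[OF w]
  have up: "gact M (upper b) w = w" for b
  proof -
    obtain J where J: "\<And>K b. J \<le> K \<Longrightarrow> gact M (upper b) w = (\<Sum>j<K. gscale M (b ^ j) (E_op M j w))"
      "\<And>j. J \<le> j \<Longrightarrow> E_op M j w = 0" using act_upper[OF wM] by blast
    have "gact M (upper b) w = (\<Sum>j<Suc J. gscale M (b ^ j) (E_op M j w))" by (rule J(1)) simp
    also have "\<dots> = (\<Sum>j<Suc J. if j = 0 then w else 0)"
      by (rule sum.cong) (auto simp: E E_op_0[OF wM])
    finally show ?thesis by simp
  qed
  have tor: "gact M (torus s) w = gscale M (s ^ m) w" if "s \<noteq> 0" for s
    using w that by (simp add: wt_def)
  obtain N :: nat and e f where ef0: "(\<forall>i<N. e i \<in> gspace M \<and> f i \<in> coord_ring) \<and>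
      (\<forall>g\<in>SL2. gact M g w = (\<Sum>i<N. gscale M (f i g) (e i)))"
    using matrix_coeffs[OF wM] by (elim exE)
  note fc = ef0[THEN conjunct1, rule_format, THEN conjunct2] and ef = ef0[THEN conjunct2, rule_format]
  define q where "q i = (SOME q. q \<in> poly_funs \<and> (\<forall>g\<in>SL2. f i g = q g))" for i
  have q0: "q i \<in> poly_funs \<and> (\<forall>g\<in>SL2. f i g = q i g)" if "i < N" for i
  proof -
    have "\<exists>q. q \<in> poly_funs \<and> (\<forall>g\<in>SL2. f i g = q g)" using fc[OF that] unfolding coord_ring_def by blast
    thus ?thesis unfolding q_def by (rule someI_ex)
  qed
  note q = q0[THEN conjunct1] q0[THEN conjunct2, rule_format]
  let ?w = "mat2 0 (- 1) 1 0 :: 'k ^ 2 ^ 2"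
  have wSL: "?w \<in> SL2" by (simp add: mem_SL2)
  \<comment> \<open>The first column of \<open>upper b ** ?w\<close> is (b, 1), so the coefficient
    of \<open>b ^ l\<close> along this curve must be the coefficient of the form.\<close>
  define \<mu> where "\<mu> l = E_op M l (gact M ?w w)" for l
  have \<mu>M: "\<mu> l \<in> gspace M" for l
    unfolding \<mu>_def by (rule upper_coeffs_E_op(2)[OF act_mem[OF wSL wM]])
  have orbit: "gact M g w = (\<Sum>l\<le>m. gscale M (g $ 1 $ 1 ^ l * g $ 2 $ 1 ^ (m - l)) (\<mu> l))" if g: "g \<in> SL2" for g
  proof (rule ccontr)
    let ?D = "gact M g w - (\<Sum>l\<le>m. gscale M (g $ 1 $ 1 ^ l * g $ 2 $ 1 ^ (m - l)) (\<mu> l))"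
    assume "\<not> ?thesis"
    hence nz: "?D \<notin> {0}" by simp
    obtain \<xi> where \<xi>: "Vector_Spaces.linear (gscale M) (*) \<xi>" "\<xi> ?D = 1"
      by (rule separating_functional[OF subspace_single_0 nz])
    interpret \<xi>: Vector_Spaces.linear "gscale M" "(*)" \<xi> by fact
    have "\<exists>a. \<forall>g\<in>SL2. \<xi> (gact M g w) = (\<Sum>l\<le>m. a l * (g $ 1 $ 1 ^ l * g $ 2 $ 1 ^ (m - l)))"
    proof (rule first_column_function)
      show "(\<lambda>g. \<Sum>i<N. q i g * \<xi> (e i)) \<in> poly_funs"
        by (intro poly_funs_sum poly_funs.mult poly_funs.const q(1)) simp
      show "\<xi> (gact M g w) = (\<Sum>i<N. q i g * \<xi> (e i))" if "g \<in> SL2" for g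
        unfolding ef[OF that] \<xi>.sum \<xi>.scale by (rule sum.cong[OF refl]) (simp add: q(2)[OF _ that])
      show "\<xi> (gact M (g ** upper t) w) = \<xi> (gact M g w)" if "g \<in> SL2" for g t
        using act_mult[OF that upper_SL2 wM] up by simp
      show "\<xi> (gact M (g ** torus s) w) = s ^ m * \<xi> (gact M g w)" if "g \<in> SL2" "s \<noteq> 0" for g s
        using act_mult[OF that(1) torus_SL2[OF that(2)] wM] tor[OF that(2)] act_scale[OF that(1) wM] \<xi>.scale by simp
    qed
    then obtain a where a: "\<And>g. g \<in> SL2 \<Longrightarrow> \<xi> (gact M g w) = (\<Sum>l\<le>m. a l * (g $ 1 $ 1 ^ l * g $ 2 $ 1 ^ (m - l)))" by blast
    obtain J where J: "\<And>K b. J \<le> K \<Longrightarrow> gact M (upper b) (gact M ?w w) = (\<Sum>j<K. gscale M (b ^ j) (\<mu> j))"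
      "\<And>j. J \<le> j \<Longrightarrow> \<mu> j = 0" using act_upper[OF act_mem[OF wSL wM]] unfolding \<mu>_def by blast
    define K where "K = J + Suc m"
    have "(\<Sum>j<K. monom (\<xi> (\<mu> j)) j) = (\<Sum>l\<le>m. monom (a l) l)"
    proof (rule poly_eqI_infinite[OF infinite_k])
      fix b
      have "upper b ** ?w = mat2 b (- 1) 1 0" by (rule mat2_eqI) (simp_all add: mat2_mult upper_def)
      hence "\<xi> (gact M (upper b) (gact M ?w w)) = (\<Sum>l\<le>m. a l * b ^ l)"
        using a[of "upper b ** ?w"] act_mult[OF upper_SL2[of b] wSL wM] by (simp add: mem_SL2)
      moreover have "\<xi> (gact M (upper b) (gact M ?w w)) = (\<Sum>j<K. b ^ j * \<xi> (\<mu> j))"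
        by (subst J(1)[of K]) (simp_all only: K_def le_add1 \<xi>.sum \<xi>.scale)
      ultimately show "poly (\<Sum>j<K. monom (\<xi> (\<mu> j)) j) b = poly (\<Sum>l\<le>m. monom (a l) l) b"
        by (simp add: poly_sum poly_monom mult.commute)
    qed
    note poly_eq = this
    have "\<xi> (\<mu> l) = a l" if "l \<le> m" for l
      using arg_cong[OF poly_eq, of "\<lambda>P. coeff P l"] that by (simp add: coeff_sum K_def split: if_splits)
    hence "\<xi> (\<Sum>l\<le>m. gscale M (g $ 1 $ 1 ^ l * g $ 2 $ 1 ^ (m - l)) (\<mu> l)) = \<xi> (gact M g w)"
      unfolding a[OF g] \<xi>.sum \<xi>.scale by (intro sum.cong) auto
    hence "\<xi> ?D = 0" by (simp only: \<xi>.diff diff_self)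
    thus False using \<xi>(2) by simp
  qed
  have "\<mu> m = w"
  proof -
    have "w = (\<Sum>l\<le>m. gscale M (1 ^ l * 0 ^ (m - l)) (\<mu> l))"
      using orbit[OF SL2_one] act_one[OF wM] by (simp add: mat_def)
    also have "\<dots> = (\<Sum>l\<le>m. if l = m then \<mu> l else 0)" by (rule sum.cong) (auto simp: power_0_left)
    finally show ?thesis by simp
  qed
  moreover have "gact M h (\<mu> i) = (\<Sum>l\<le>m. gscale M (sym_matrix m h l i) (\<mu> l))" if h: "h \<in> SL2" and i: "i \<le> m" for h i
  proof -
    let ?d = "\<lambda>i. gact M h (\<mu> i) - (\<Sum>l\<le>m. gscale M (sym_matrix m h l i) (\<mu> l))"
    \<comment> \<open>Expand the action of \<open>h ** ?g\<close> on \<open>w\<close> in two ways,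
      with (z, 1) as first column of \<open>?g\<close>, and compare powers of
      \<open>z\<close>.\<close>
    have "(\<Sum>i<Suc m. gscale M (z ^ i) (?d i)) \<in> {0}" for z
    proof -
      let ?g = "mat2 z (- 1) 1 0"
      have g: "?g \<in> SL2" by (simp add: mem_SL2)
      have "(\<Sum>i\<le>m. gscale M (z ^ i) (gact M h (\<mu> i))) = gact M h (gact M ?g w)"
        unfolding orbit[OF g] using h \<mu>M by (simp add: act_sum act_scale subspace_scale[OF gspace])
      also have "\<dots> = gact M (h ** ?g) w" using act_mult[OF h g wM] by simp
      also have "\<dots> = (\<Sum>l\<le>m. gscale M ((h $ 1 $ 1 * z + h $ 1 $ 2 * 1) ^ l * (h $ 2 $ 1 * z + h $ 2 $ 2 * 1) ^ (m - l)) (\<mu> l))"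
        using orbit[of "h ** ?g"] h g by (simp add: mat2_mult)
      also have "\<dots> = (\<Sum>l\<le>m. \<Sum>i\<le>m. gscale M (z ^ i) (gscale M (sym_matrix m h l i) (\<mu> l)))"
      proof (rule sum.cong[OF refl])
        fix l assume "l \<in> {..m}"
        hence l: "l \<le> m" by simp
        show "gscale M ((h $ 1 $ 1 * z + h $ 1 $ 2 * 1) ^ l * (h $ 2 $ 1 * z + h $ 2 $ 2 * 1) ^ (m - l)) (\<mu> l) =
            (\<Sum>i\<le>m. gscale M (z ^ i) (gscale M (sym_matrix m h l i) (\<mu> l)))"
          unfolding sym_matrix_eval[OF l] by (simp add: scale_sum_left mult.commute)
      qed
      also have "\<dots> = (\<Sum>i\<le>m. gscale M (z ^ i) (\<Sum>l\<le>m. gscale M (sym_matrix m h l i) (\<mu> l)))"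
        unfolding scale_sum_right by (rule sum.swap)
      finally show ?thesis
        by (simp only: lessThan_Suc_atMost scale_right_diff_distrib sum_subtractf) simp
    qed
    from poly_coeffs_mem[OF infinite_k _ this, of i] i show ?thesis by (simp add: subspace_single_0)
  qed
  ultimately show ?thesis using \<mu>M by blast
qed

text \<open>The existence half of the universal property; with \<open>G_hom_weyl_eqI\<close> it
  identifies homomorphisms from \<open>V(m)\<close> with highest weight vectors.\<close>

lemma weyl_universal:
  fixes M :: "('k::alg_closed_field, 'v::ab_group_add) gmod"
  assumes M: "rational_module M" and w: "w \<in> wt M (int m)" and E: "\<And>t. t \<ge> 1 \<Longrightarrow> E_op M t w = 0"
  shows "\<exists>f\<in>G_hom (weyl m) M. f (weyl_vec m m) = w"
proof -
  interpret rational_mod M by standard fact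
  obtain \<mu> where \<mu>: "\<And>l. \<mu> l \<in> gspace M" "\<mu> m = w"
    "\<And>h i. h \<in> SL2 \<Longrightarrow> i \<le> m \<Longrightarrow> gact M h (\<mu> i) = (\<Sum>l\<le>m. gscale M (sym_matrix m h l i) (\<mu> l))"
    using highest_weight_orbit[OF w E] by blast
  define f where "f \<phi> = (if \<phi> \<in> gspace (weyl m) then \<Sum>l\<le>m. gscale M (\<phi> (sym_mono m l)) (\<mu> l) else 0)" for \<phi>
  have "f \<phi> \<in> gspace M" if "\<phi> \<in> gspace (weyl m)" for \<phi>
    using that \<mu>(1) by (auto simp: f_def intro!: subspace_sum[OF gspace] subspace_scale[OF gspace])
  moreover have "linear_on (gspace (weyl m)) (gscale (weyl m)) (gscale M) f"
  proof -
    interpret F: vector_space "fun_scale :: 'k \<Rightarrow> (('k ^ 2 ^ 2 \<Rightarrow> 'k) \<Rightarrow> 'k) \<Rightarrow> _" by (rule vector_space_fun_scale)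
    show ?thesis
      unfolding linear_on_def gscale_weyl
    proof (intro conjI ballI allI)
      fix \<phi> \<psi> :: "('k ^ 2 ^ 2 \<Rightarrow> 'k) \<Rightarrow> 'k" assume *: "\<phi> \<in> gspace (weyl m)" "\<psi> \<in> gspace (weyl m)"
      have "\<phi> + \<psi> \<in> gspace (weyl m)" by (rule F.subspace_add[OF weyl_subspace *])
      thus "f (\<phi> + \<psi>) = f \<phi> + f \<psi>"
        unfolding f_def by (simp only: * if_True plus_fun_apply scale_left_distrib sum.distrib)
    next
      fix c and \<phi> :: "('k ^ 2 ^ 2 \<Rightarrow> 'k) \<Rightarrow> 'k" assume *: "\<phi> \<in> gspace (weyl m)"
      have "fun_scale c \<phi> \<in> gspace (weyl m)" by (rule F.subspace_scale[OF weyl_subspace *])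
      thus "f (fun_scale c \<phi>) = gscale M c (f \<phi>)"
        unfolding f_def by (simp only: * if_True scale_sum_right scale_scale) (simp add: fun_scale_def)
    qed
  qed
  moreover have "f (gact (weyl m) g \<phi>) = gact M g (f \<phi>)" if g: "g \<in> SL2" and \<phi>: "\<phi> \<in> gspace (weyl m)" for g \<phi>
  proof -
    have "f (gact (weyl m) g \<phi>) = (\<Sum>l\<le>m. gscale M (\<Sum>i\<le>m. sym_matrix m g l i * \<phi> (sym_mono m i)) (\<mu> l))"
      using weyl_act_mem[OF g \<phi>] by (auto simp: f_def weyl_act[OF g \<phi>] intro!: sum.cong)
    also have "\<dots> = (\<Sum>l\<le>m. \<Sum>i\<le>m. gscale M (\<phi> (sym_mono m i)) (gscale M (sym_matrix m g l i) (\<mu> l)))"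
      by (simp add: scale_sum_left mult.commute)
    also have "\<dots> = (\<Sum>i\<le>m. gscale M (\<phi> (sym_mono m i)) (gact M g (\<mu> i)))"
      by (subst sum.swap) (simp add: \<mu>(3)[OF g] scale_sum_right)
    also have "\<dots> = gact M g (f \<phi>)"
      using g \<phi> \<mu>(1) by (simp add: f_def act_sum act_scale subspace_scale[OF gspace])
    finally show ?thesis .
  qed
  ultimately have "f \<in> G_hom (weyl m) M" by (auto simp: G_hom_def f_def)
  moreover have "f (weyl_vec m m) = w"
  proof -
    have "f (weyl_vec m m) = (\<Sum>l\<le>m. if l = m then \<mu> l else 0)"
      using weyl_vec_mem[of m m, where ?'k = 'k] unfolding f_def
      by (simp only: if_True order_refl) (rule sum.cong, auto simp: weyl_vec_mono)
    thus ?thesis using \<mu>(2) by simp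
  qed
  ultimately show ?thesis by blast
qed

section \<open>Injective modules\<close>

text \<open>
  A finite-dimensional module given by a matrix representation, placed in the ambient type on which
  \<open>injective_module\<close> tests the extension property.
\<close>

definition matrix_module ::
  "('k::field \<Rightarrow> 'v \<Rightarrow> 'v) \<Rightarrow> nat set \<Rightarrow> ('k ^ 2 ^ 2 \<Rightarrow> nat \<Rightarrow> nat \<Rightarrow> 'k) \<Rightarrow> ('k, 'v::ab_group_add \<times> (nat \<Rightarrow> 'k)) gmod" where
  "matrix_module s J \<rho> =
     \<lparr>gscale = (\<lambda>c x. (s c (fst x), fun_scale c (snd x))),
      gspace = {x. fst x = 0 \<and> (\<forall>i. i \<notin> J \<longrightarrow> snd x i = 0)},
      gact = (\<lambda>g x. (0, \<lambda>i. if i \<in> J then \<Sum>j\<in>J. \<rho> g i j * snd x j else 0))\<rparr>"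

lemma matrix_module_rational:
  assumes s: "vector_space s" and J: "finite J"
    and poly: "\<And>i j. (\<lambda>g. \<rho> g i j) \<in> poly_funs"
    and one: "\<And>i j. i \<in> J \<Longrightarrow> j \<in> J \<Longrightarrow> \<rho> (mat 1) i j = (if i = j then 1 else 0)"
    and mult: "\<And>g h i j. g \<in> SL2 \<Longrightarrow> h \<in> SL2 \<Longrightarrow> i \<in> J \<Longrightarrow> j \<in> J \<Longrightarrow> \<rho> (g ** h) i j = (\<Sum>l\<in>J. \<rho> g i l * \<rho> h l j)"
  shows "rational_module (matrix_module s J \<rho>)"
proof -
  interpret s: vector_space s by fact
  let ?M = "matrix_module s J \<rho>"
  note M = matrix_module_def
  have vs: "vector_space (gscale ?M)"
    by unfold_locales (auto simp: M fun_scale_def s.scale_right_distrib s.scale_left_distrib algebra_simps prod_eq_iff)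
  interpret V: vector_space "gscale ?M" by fact
  have sub: "V.subspace (gspace ?M)"
    by (rule V.subspaceI) (auto simp: M fun_scale_def)
  moreover have "gact ?M g ` gspace ?M \<subseteq> gspace ?M \<and> linear_on (gspace ?M) (gscale ?M) (gscale ?M) (gact ?M g)" for g
  proof
    show "gact ?M g ` gspace ?M \<subseteq> gspace ?M" by (auto simp: M)
    show "linear_on (gspace ?M) (gscale ?M) (gscale ?M) (gact ?M g)"
      unfolding linear_on_def
    proof (intro conjI ballI allI)
      show "gact ?M g (x + y) = gact ?M g x + gact ?M g y" for x y
        by (rule prod_eqI) (auto simp: M sum.distrib distrib_left)
      show "gact ?M g (gscale ?M c x) = gscale ?M c (gact ?M g x)" for c x
        by (rule prod_eqI) (auto simp: M fun_scale_def sum_distrib_left mult_ac)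
    qed
  qed
  moreover have "gact ?M (mat 1) v = v" if "v \<in> gspace ?M" for v
  proof -
    have "(\<Sum>j\<in>J. \<rho> (mat 1) i j * snd v j) = snd v i" if i: "i \<in> J" for i
    proof -
      have "(\<Sum>j\<in>J. \<rho> (mat 1) i j * snd v j) = (\<Sum>j\<in>J. if j = i then snd v j else 0)"
        by (rule sum.cong) (auto simp: one i)
      thus ?thesis using i J by simp
    qed
    thus ?thesis using that by (auto simp: M prod_eq_iff)
  qed
  moreover have "gact ?M (g ** h) v = gact ?M g (gact ?M h v)" if gh: "g \<in> SL2" "h \<in> SL2" for g h v
  proof -
    have "(\<Sum>j\<in>J. \<rho> (g ** h) i j * snd v j) = (\<Sum>l\<in>J. \<rho> g i l * (\<Sum>j\<in>J. \<rho> h l j * snd v j))" if i: "i \<in> J" for i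
    proof -
      have "(\<Sum>j\<in>J. \<rho> (g ** h) i j * snd v j) = (\<Sum>j\<in>J. \<Sum>l\<in>J. \<rho> g i l * (\<rho> h l j * snd v j))"
        by (rule sum.cong) (auto simp: mult[OF gh i] sum_distrib_right mult.assoc)
      also have "\<dots> = (\<Sum>l\<in>J. \<Sum>j\<in>J. \<rho> g i l * (\<rho> h l j * snd v j))" by (rule sum.swap)
      finally show ?thesis by (simp add: sum_distrib_left)
    qed
    thus ?thesis by (auto simp: M fun_eq_iff intro!: sum.cong)
  qed
  moreover have "\<exists>(N::nat) w f. (\<forall>i<N. w i \<in> gspace ?M \<and> f i \<in> coord_ring) \<and>
      (\<forall>g\<in>SL2. gact ?M g v = (\<Sum>i<N. gscale ?M (f i g) (w i)))" if "v \<in> gspace ?M" for v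
  proof -
    obtain N where N: "J \<subseteq> {..<N}" using J finite_nat_set_iff_bounded[of J] by auto
    define w where "w i = (0 :: 'b, \<lambda>j. if j = i \<and> i \<in> J then 1 else 0 :: 'a)" for i :: nat
    define f where "f i g = (if g \<in> SL2 then \<Sum>j\<in>J. \<rho> g i j * snd v j else 0)" for i g
    have "w i \<in> gspace ?M" for i by (auto simp: M w_def)
    moreover have "f i \<in> coord_ring" for i
    proof -
      have "(\<lambda>g. \<Sum>j\<in>J. \<rho> g i j * snd v j) \<in> poly_funs"
        by (intro poly_funs_sum poly_funs.mult poly poly_funs.const)
      thus ?thesis unfolding f_def[abs_def] by (rule restrict_coord_ring)
    qed
    moreover have "gact ?M g v = (\<Sum>i<N. gscale ?M (f i g) (w i))" if g: "g \<in> SL2" for g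
    proof (rule prod_eqI)
      show "fst (gact ?M g v) = fst (\<Sum>i<N. gscale ?M (f i g) (w i))"
        by (simp add: M fst_sum w_def)
      show "snd (gact ?M g v) = snd (\<Sum>i<N. gscale ?M (f i g) (w i))"
      proof
        fix j
        have "snd (\<Sum>i<N. gscale ?M (f i g) (w i)) j = (\<Sum>i<N. if i = j then (if j \<in> J then f j g else 0) else 0)"
          unfolding snd_sum sum_fun_apply by (rule sum.cong) (auto simp: M fun_scale_def w_def)
        also have "\<dots> = (if j \<in> J then f j g else 0)" using N by (auto simp: sum.delta)
        also have "\<dots> = snd (gact ?M g v) j" using g by (simp add: M f_def)
        finally show "snd (gact ?M g v) j = snd (\<Sum>i<N. gscale ?M (f i g) (w i)) j" by simp
      qed
    qed
    ultimately show ?thesis by blast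
  qed
  ultimately show ?thesis using vs by (simp add: rational_module_def)
qed

text \<open>
  The embedding of \<open>V(y)\<close> into \<open>V(y - t) \<otimes> L\<close>, where \<open>L\<close> is spanned by the monomials of degree \<open>t\<close>
  with non-zero binomial coefficient; it is dual to multiplication of polynomials, which is onto
  because \<open>2 t \<le> y\<close>.
\<close>

lemma injective_socle_extension:
  fixes I :: "('k::alg_closed_field, 'v::ab_group_add) gmod"
  assumes inj: "injective_module I" and w: "w \<in> wt I y" and E: "\<And>j. j \<ge> 1 \<Longrightarrow> E_op I j w = 0"
    and yt: "2 * int t \<le> y"
  shows "\<exists>u\<in>wt I (y - 2 * int t). E_op I t u = w \<and> (\<forall>j. (of_nat (t choose j) :: 'k) = 0 \<longrightarrow> E_op I j u = 0)"
proof -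
  have rat: "rational_module I" using inj by (simp add: injective_module_def)
  interpret I: rational_mod I by standard (rule rat)
  define Y where "Y = nat y"
  have y: "y = int Y" and tY: "2 * t \<le> Y" using yt by (simp_all add: Y_def)
  define n where "n = Y - t"
  have nt: "t \<le> n" "n + t = Y" using tY by (simp_all add: n_def)
  obtain \<mu> where \<mu>: "\<And>l. \<mu> l \<in> gspace I" "\<mu> Y = w"
    "\<And>h i. h \<in> SL2 \<Longrightarrow> i \<le> Y \<Longrightarrow> gact I h (\<mu> i) = (\<Sum>l\<le>Y. gscale I (sym_matrix Y h l i) (\<mu> l))"
    using I.highest_weight_orbit[OF w[unfolded y] E] by blast
  define T where "T = {j. j \<le> t \<and> (of_nat (t choose j) :: 'k) \<noteq> 0}"
  define J where "J = prod_encode ` ({..n} \<times> T)"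
  define \<rho> where "\<rho> g a b = (case (prod_decode a, prod_decode b) of ((l, j), (i, m)) \<Rightarrow>
      sym_matrix n g l i * sym_matrix t g j m)" for g :: "'k ^ 2 ^ 2" and a b
  have finT: "finite T" by (simp add: T_def)
  have T0: "0 \<in> T" "t \<in> T" by (simp_all add: T_def)
  have Tt: "j \<le> t" if "j \<in> T" for j using that by (simp add: T_def)
  have enc_J: "prod_encode (l, j) \<in> J \<longleftrightarrow> l \<le> n \<and> j \<in> T" for l j
    by (auto simp: J_def prod_encode_eq image_iff)
  have sum_J: "(\<Sum>a\<in>J. F (prod_decode a)) = (\<Sum>l\<le>n. \<Sum>j\<in>T. F (l, j))" for F :: "nat \<times> nat \<Rightarrow> 'k"
    unfolding J_def by (subst sum.reindex) (auto simp: inj_on_def prod_encode_eq sum.cartesian_product)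
  \<comment> \<open>By \<open>sym_matrix_eq_0\<close> the rows in \<open>T\<close> have no entries
    outside \<open>T\<close>, so cutting the matrices down to \<open>T\<close> keeps them
    multiplicative.\<close>
  have T_sum: "(\<Sum>m\<in>T. sym_matrix t g j m * F m) = (\<Sum>m\<le>t. sym_matrix t g j m * F m)" if "j \<in> T" for g :: "'k ^ 2 ^ 2" and j F
    by (rule sum.mono_neutral_left) (use that sym_matrix_eq_0 in \<open>auto simp: T_def\<close>)
  let ?M = "matrix_module (gscale I) J \<rho> :: ('k, 'v \<times> (nat \<Rightarrow> 'k)) gmod"
  have ratM: "rational_module ?M"
  proof (rule matrix_module_rational)
    show "vector_space (gscale I)" by (rule I.vector_space_axioms)
    show "finite J" using finT by (simp add: J_def)
    show "(\<lambda>g. \<rho> g a b) \<in> poly_funs" for a b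
      by (cases "prod_decode a"; cases "prod_decode b")
        (simp add: \<rho>_def poly_funs.mult sym_matrix_poly_funs)
    show "\<rho> (mat 1) a b = (if a = b then 1 else 0)" if ab: "a \<in> J" "b \<in> J" for a b
      using ab by (auto simp: J_def \<rho>_def sym_matrix_one)
    show "\<rho> (g ** h) a b = (\<Sum>c\<in>J. \<rho> g a c * \<rho> h c b)" if "g \<in> SL2" "h \<in> SL2" and ab: "a \<in> J" "b \<in> J" for g h a b
    proof -
      obtain l j i m where a: "a = prod_encode (l, j)" "l \<le> n" "j \<in> T" and b: "b = prod_encode (i, m)"
        using ab by (auto simp: J_def)
      have "(\<Sum>c\<in>J. \<rho> g a c * \<rho> h c b) =
          (\<Sum>i'\<le>n. \<Sum>m'\<in>T. (sym_matrix n g l i' * sym_matrix t g j m') * (sym_matrix n h i' i * sym_matrix t h m' m))"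
        using sum_J[of "\<lambda>(i', m'). (sym_matrix n g l i' * sym_matrix t g j m') * (sym_matrix n h i' i * sym_matrix t h m' m)"]
        by (simp add: \<rho>_def a b case_prod_unfold)
      also have "\<dots> = (\<Sum>i'\<le>n. sym_matrix n g l i' * sym_matrix n h i' i * (\<Sum>m'\<in>T. sym_matrix t g j m' * sym_matrix t h m' m))"
        by (simp add: sum_distrib_left mult_ac)
      also have "\<dots> = sym_matrix n (g ** h) l i * sym_matrix t (g ** h) j m"
        by (simp add: T_sum[OF a(3)] sym_matrix_mult[OF a(2)] sym_matrix_mult[OF Tt[OF a(3)]] sum_distrib_right)
      finally show ?thesis by (simp add: \<rho>_def a b)
    qed
  qed
  interpret M: rational_mod ?M by standard (rule ratM)
  have gspaceM: "x \<in> gspace ?M \<longleftrightarrow> fst x = 0 \<and> (\<forall>i. i \<notin> J \<longrightarrow> snd x i = 0)" for x by (simp add: matrix_module_def)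
  have scaleM: "gscale ?M c x = (gscale I c (fst x), fun_scale c (snd x))" for c x by (simp add: matrix_module_def)
  have actM: "snd (gact ?M g x) (prod_encode (l, j)) =
      (\<Sum>i\<le>n. \<Sum>m\<in>T. sym_matrix n g l i * sym_matrix t g j m * snd x (prod_encode (i, m)))"
    if "l \<le> n" "j \<in> T" for g x l j
    using that sum_J[of "\<lambda>(i, m). sym_matrix n g l i * sym_matrix t g j m * snd x (prod_encode (i, m))"]
    by (simp add: matrix_module_def enc_J \<rho>_def case_prod_unfold)
  have eqM: "x = x'" if "x \<in> gspace ?M" "x' \<in> gspace ?M"
    "\<And>l j. l \<le> n \<Longrightarrow> j \<in> T \<Longrightarrow> snd x (prod_encode (l, j)) = snd x' (prod_encode (l, j))" for x x'
  proof (rule prod_eqI)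
    show "fst x = fst x'" using that by (simp add: gspaceM)
    show "snd x = snd x'"
    proof
      fix a
      show "snd x a = snd x' a"
      proof (cases "a \<in> J")
        case True
        thus ?thesis using that(3) by (auto simp: J_def)
      qed (use that(1,2) in \<open>simp add: gspaceM\<close>)
    qed
  qed
  \<comment> \<open>The dual of multiplication of forms of degrees \<open>n\<close> and
    \<open>t\<close>: the pair \<open>(l, j)\<close> reads off the coordinate
    \<open>l + j\<close>.\<close>
  define \<iota> where "\<iota> \<nu> = (0 :: 'v, \<lambda>a. if a \<in> J then (case prod_decode a of (l, j) \<Rightarrow> \<nu> (l + j)) else 0)" for \<nu> :: "nat \<Rightarrow> 'k"
  have \<iota>_nth: "snd (\<iota> \<nu>) (prod_encode (l, j)) = \<nu> (l + j)" if "l \<le> n" "j \<in> T" for \<nu> l j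
    using that by (simp add: \<iota>_def enc_J)
  have \<iota>M: "\<iota> \<nu> \<in> gspace ?M" for \<nu> by (simp add: gspaceM \<iota>_def)
  have \<iota>_add: "\<iota> \<nu> + \<iota> \<nu>' = \<iota> (\<lambda>i. \<nu> i + \<nu>' i)" for \<nu> \<nu>'
    by (rule prod_eqI) (simp_all add: \<iota>_def case_prod_unfold fun_eq_iff)
  have \<iota>_scale: "gscale ?M c (\<iota> \<nu>) = \<iota> (\<lambda>i. c * \<nu> i)" for c \<nu>
    by (rule prod_eqI) (simp_all add: \<iota>_def case_prod_unfold scaleM fun_scale_def fun_eq_iff)
  define act where "act g \<nu> l = (\<Sum>q\<le>Y. sym_matrix Y g l q * \<nu> q)" for g :: "'k ^ 2 ^ 2" and \<nu> :: "nat \<Rightarrow> 'k" and l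
  have \<iota>_act: "gact ?M g (\<iota> \<nu>) = \<iota> (act g \<nu>)" if g: "g \<in> SL2" for g \<nu>
  proof (rule eqM)
    show "gact ?M g (\<iota> \<nu>) \<in> gspace ?M" by (rule M.act_mem[OF g \<iota>M])
    show "\<iota> (act g \<nu>) \<in> gspace ?M" by (rule \<iota>M)
    fix l j assume l: "l \<le> n" and j: "j \<in> T"
    have jt: "j \<le> t" by (rule Tt[OF j])
    have "snd (gact ?M g (\<iota> \<nu>)) (prod_encode (l, j)) =
        (\<Sum>i\<le>n. \<Sum>m\<in>T. sym_matrix n g l i * sym_matrix t g j m * \<nu> (i + m))"
      unfolding actM[OF l j] by (intro sum.cong refl) (simp add: \<iota>_nth)
    also have "\<dots> = (\<Sum>i\<le>n. sym_matrix n g l i * (\<Sum>m\<in>T. sym_matrix t g j m * \<nu> (i + m)))"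
      by (simp add: sum_distrib_left mult.assoc)
    also have "\<dots> = (\<Sum>i\<le>n. \<Sum>m\<le>t. sym_matrix n g l i * sym_matrix t g j m * \<nu> (i + m))"
      by (simp add: T_sum[OF j] sum_distrib_left mult.assoc)
    also have "\<dots> = (\<Sum>q\<le>Y. sym_matrix Y g (l + j) q * \<nu> q)"
    proof -
      let ?lin = "\<lambda>r. [:g $ r $ 2, g $ r $ 1:]"
      let ?P = "?lin 1 ^ l * ?lin 2 ^ (n - l)" and ?Q = "?lin 1 ^ j * ?lin 2 ^ (t - j)"
      have "?lin 1 ^ (l + j) * ?lin 2 ^ (Y - (l + j)) = ?P * ?Q"
      proof -
        have "Y - (l + j) = (n - l) + (t - j)" using l jt nt by simp
        thus ?thesis by (simp only: power_add mult_ac)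
      qed
      hence "sym_matrix Y g (l + j) q = coeff (?P * ?Q) q" for q by (simp only: sym_matrix_def)
      hence "(\<Sum>q\<le>Y. sym_matrix Y g (l + j) q * \<nu> q) = (\<Sum>q\<le>Y. \<Sum>i\<le>q. coeff ?P i * coeff ?Q (q - i) * \<nu> (i + (q - i)))"
        by (simp add: coeff_mult sum_distrib_right)
      also have "\<dots> = (\<Sum>(i, m)\<in>{(i, m). i + m \<le> Y}. coeff ?P i * coeff ?Q m * \<nu> (i + m))"
        by (rule sum.triangle_reindex_eq[symmetric])
      also have "\<dots> = (\<Sum>(i, m)\<in>{..n} \<times> {..t}. coeff ?P i * coeff ?Q m * \<nu> (i + m))"
      proof (rule sum.mono_neutral_right)
        have "{(i, m). i + m \<le> Y} \<subseteq> {..Y} \<times> {..Y}" by auto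
        thus "finite {(i, m). i + m \<le> Y}" by (rule finite_subset) simp
        have dP: "degree ?P \<le> n" and dQ: "degree ?Q \<le> t"
          using degree_mult_le[of "?lin 1 ^ l" "?lin 2 ^ (n - l)"] degree_mult_le[of "?lin 1 ^ j" "?lin 2 ^ (t - j)"]
            degree_linear_power[of "g $ 1 $ 2" "g $ 1 $ 1" l] degree_linear_power[of "g $ 2 $ 2" "g $ 2 $ 1" "n - l"]
            degree_linear_power[of "g $ 1 $ 2" "g $ 1 $ 1" j] degree_linear_power[of "g $ 2 $ 2" "g $ 2 $ 1" "t - j"] l jt
          by linarith+
        show "\<forall>im\<in>{(i, m). i + m \<le> Y} - {..n} \<times> {..t}. (case im of (i, m) \<Rightarrow> coeff ?P i * coeff ?Q m * \<nu> (i + m)) = 0"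
        proof
          fix im assume "im \<in> {(i, m). i + m \<le> Y} - {..n} \<times> {..t}"
          moreover obtain i m where im: "im = (i, m)" by (cases im)
          ultimately have "n < i \<or> t < m" by auto
          hence "coeff ?P i = 0 \<or> coeff ?Q m = 0" using dP dQ coeff_eq_0 by (meson le_less_trans)
          thus "(case im of (i, m) \<Rightarrow> coeff ?P i * coeff ?Q m * \<nu> (i + m)) = 0" by (auto simp: im)
        qed
      qed (use nt in auto)
      also have "\<dots> = (\<Sum>i\<le>n. \<Sum>m\<le>t. sym_matrix n g l i * sym_matrix t g j m * \<nu> (i + m))"
        by (simp add: sum.cartesian_product sym_matrix_def)
      finally show ?thesis by simp
    qed
    also have "\<dots> = snd (\<iota> (act g \<nu>)) (prod_encode (l, j))" using \<iota>_nth[OF l j] by (simp add: act_def)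
    finally show "snd (gact ?M g (\<iota> \<nu>)) (prod_encode (l, j)) = snd (\<iota> (act g \<nu>)) (prod_encode (l, j))" .
  qed
  define A where "A = range \<iota>"
  have subA: "submodule_of A ?M"
    unfolding submodule_of_def
  proof (intro conjI ballI)
    show "A \<subseteq> gspace ?M" using \<iota>M by (auto simp: A_def)
    have "0 = \<iota> (\<lambda>_. 0)" by (rule prod_eqI) (auto simp: \<iota>_def)
    hence "0 \<in> A" by (auto simp: A_def)
    thus "M.subspace A"
      by (intro M.subspaceI) (auto simp: A_def \<iota>_add \<iota>_scale)
    show "gact ?M g ` A \<subseteq> A" if "g \<in> SL2" for g using \<iota>_act[OF that] by (auto simp: A_def)
  qed
  \<comment> \<open>A left inverse of \<open>\<iota>\<close>: an exponent up to \<open>n\<close> is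
    read at \<open>(l, 0)\<close>, a larger one at \<open>(l - t, t)\<close>. The second reading
    needs \<open>t \<le> l\<close>, which \<open>t \<le> n\<close> guarantees; this is where
    \<open>2 * t \<le> y\<close> is used.\<close>
  define cf where "cf x l = (if l \<le> n then snd x (prod_encode (l, 0)) else snd x (prod_encode (l - t, t)))" for x :: "'v \<times> (nat \<Rightarrow> 'k)" and l
  have cf: "cf (\<iota> \<nu>) l = \<nu> l" if "l \<le> Y" for \<nu> l
    using that T0 nt \<iota>_nth[of l 0 \<nu>] \<iota>_nth[of "l - t" t \<nu>] by (auto simp: cf_def)
  define f where "f x = (if x \<in> A then \<Sum>l\<le>Y. gscale I (cf x l) (\<mu> l) else 0)" for x
  have f\<iota>: "f (\<iota> \<nu>) = (\<Sum>l\<le>Y. gscale I (\<nu> l) (\<mu> l))" for \<nu>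
    unfolding f_def using cf by (auto simp: A_def intro!: sum.cong)
  have "f \<in> G_hom (?M\<lparr>gspace := A\<rparr>) I"
    unfolding G_hom_def linear_on_def
  proof (intro CollectI conjI ballI allI impI)
    show "f ` gspace (?M\<lparr>gspace := A\<rparr>) \<subseteq> gspace I"
      using \<mu>(1) by (auto simp: A_def f\<iota> intro!: I.subspace_sum[OF I.gspace] I.subspace_scale[OF I.gspace])
  next
    fix x x' assume "x \<in> gspace (?M\<lparr>gspace := A\<rparr>)" "x' \<in> gspace (?M\<lparr>gspace := A\<rparr>)"
    thus "f (x + x') = f x + f x'"
      by (auto simp: A_def f\<iota> \<iota>_add I.scale_left_distrib sum.distrib)
  next
    fix c x assume "x \<in> gspace (?M\<lparr>gspace := A\<rparr>)"
    thus "f (gscale (?M\<lparr>gspace := A\<rparr>) c x) = gscale I c (f x)"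
      by (auto simp: A_def f\<iota> \<iota>_scale I.scale_sum_right)
  next
    fix g :: "'k ^ 2 ^ 2" and x assume g: "g \<in> SL2" and "x \<in> gspace (?M\<lparr>gspace := A\<rparr>)"
    then obtain \<nu> where x: "x = \<iota> \<nu>" by (auto simp: A_def)
    have "f (gact ?M g x) = (\<Sum>l\<le>Y. \<Sum>q\<le>Y. gscale I (\<nu> q) (gscale I (sym_matrix Y g l q) (\<mu> l)))"
      by (simp add: x \<iota>_act[OF g] f\<iota> act_def I.scale_sum_left mult.commute)
    also have "\<dots> = (\<Sum>q\<le>Y. gscale I (\<nu> q) (gact I g (\<mu> q)))"
      by (subst sum.swap) (simp add: \<mu>(3)[OF g] I.scale_sum_right)
    also have "\<dots> = gact I g (f x)"
      using g \<mu>(1) by (simp add: x f\<iota> I.act_sum I.act_scale I.subspace_scale[OF I.gspace])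
    finally show "f (gact (?M\<lparr>gspace := A\<rparr>) g x) = gact I g (f x)" by simp
  next
    fix x assume "x \<notin> gspace (?M\<lparr>gspace := A\<rparr>)"
    thus "f x = 0" by (simp add: f_def)
  qed
  then obtain h where h: "h \<in> G_hom ?M I" "\<And>a. a \<in> A \<Longrightarrow> h a = f a"
    using inj ratM subA unfolding injective_module_def by blast
  \<comment> \<open>The highest weight vector of \<open>V(n)\<close> tensored with the basis vector
    \<open>j\<close> of the truncated factor, and 0 for \<open>j\<close> outside \<open>T\<close>.
    The divided powers of \<open>\<delta> 0\<close> are exactly these vectors.\<close>
  define \<delta> where "\<delta> j = (0 :: 'v, \<lambda>a. if j \<in> T \<and> a = prod_encode (n, j) then 1 else 0 :: 'k)" for j
  have \<delta>M: "\<delta> j \<in> gspace ?M" for j using enc_J by (auto simp: gspaceM \<delta>_def)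
  have act\<delta>: "snd (gact ?M g (\<delta> 0)) (prod_encode (l, j)) = sym_matrix n g l n * sym_matrix t g j 0"
    if "l \<le> n" "j \<in> T" for g l j
  proof -
    have "snd (gact ?M g (\<delta> 0)) (prod_encode (l, j)) =
        (\<Sum>i\<le>n. \<Sum>m\<in>T. if i = n \<and> m = 0 then sym_matrix n g l n * sym_matrix t g j 0 else 0)"
      unfolding actM[OF that] by (intro sum.cong refl) (auto simp: \<delta>_def prod_encode_eq T0)
    also have "\<dots> = (\<Sum>i\<le>n. if i = n then (\<Sum>m\<in>T. if m = 0 then sym_matrix n g l n * sym_matrix t g j 0 else 0) else 0)"
      by (intro sum.cong refl) auto
    also have "\<dots> = sym_matrix n g l n * sym_matrix t g j 0" using finT T0 by simp
    finally show ?thesis .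
  qed
  define u where "u = h (\<delta> 0)"
  have "gact ?M (torus s) (\<delta> 0) = gscale ?M (s powi (y - 2 * int t)) (\<delta> 0)" if s: "s \<noteq> 0" for s
  proof (rule eqM)
    show "gact ?M (torus s) (\<delta> 0) \<in> gspace ?M" using s by (intro M.act_mem \<delta>M) simp
    show "gscale ?M (s powi (y - 2 * int t)) (\<delta> 0) \<in> gspace ?M" by (rule M.subspace_scale[OF M.gspace \<delta>M])
    fix l j assume l: "l \<le> n" and j: "j \<in> T"
    have "s powi (int n) * s powi (- int t) = s powi (y - 2 * int t)"
    proof -
      have "y - 2 * int t = int n + - int t" using nt y by simp
      thus ?thesis using s by (simp only: power_int_add simp_thms)
    qed
    moreover have "snd (gscale ?M c (\<delta> 0)) (prod_encode (l, j)) = (if l = n \<and> j = 0 then c else 0)" for c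
      using T0 by (simp add: scaleM fun_scale_def \<delta>_def prod_encode_eq)
    ultimately show "snd (gact ?M (torus s) (\<delta> 0)) (prod_encode (l, j)) =
        snd (gscale ?M (s powi (y - 2 * int t)) (\<delta> 0)) (prod_encode (l, j))"
      unfolding act\<delta>[OF l j] using l Tt[OF j] s by (auto simp: sym_matrix_torus)
  qed
  hence "gact I (torus s) u = gscale I (s powi (y - 2 * int t)) u" if "s \<noteq> 0" for s
    using G_homD(3)[OF h(1) \<delta>M] G_homD(4)[OF h(1) torus_SL2[OF that] \<delta>M] that by (metis u_def)
  hence uW: "u \<in> wt I (y - 2 * int t)"
    using G_homD(1)[OF h(1) \<delta>M] by (simp add: wt_def u_def)
  have Eu: "E_op I j u = h (\<delta> j)" for j
  proof (rule I.E_op_eqI'[where J = "Suc t"])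
    fix b
    have "gact ?M (upper b) (\<delta> 0) = (\<Sum>j<Suc t. gscale ?M (b ^ j) (\<delta> j))"
    proof (rule eqM)
      show "gact ?M (upper b) (\<delta> 0) \<in> gspace ?M" by (intro M.act_mem \<delta>M) simp
      show "(\<Sum>j<Suc t. gscale ?M (b ^ j) (\<delta> j)) \<in> gspace ?M"
        by (intro M.subspace_sum[OF M.gspace] M.subspace_scale[OF M.gspace] \<delta>M)
      fix l j assume l: "l \<le> n" and j: "j \<in> T"
      have "snd (\<Sum>j<Suc t. gscale ?M (b ^ j) (\<delta> j)) (prod_encode (l, j)) =
          (\<Sum>i<Suc t. if i = j then (if l = n then b ^ j else 0) else 0)"
        unfolding snd_sum sum_fun_apply
        by (rule sum.cong) (use j in \<open>auto simp: scaleM fun_scale_def \<delta>_def prod_encode_eq\<close>)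
      also have "\<dots> = (if l = n then b ^ j else 0)" using Tt[OF j] by (simp add: sum.delta)
      also have "\<dots> = snd (gact ?M (upper b) (\<delta> 0)) (prod_encode (l, j))"
        using l by (auto simp: act\<delta>[OF l j] sym_matrix_upper binomial_eq_0)
      finally show "snd (gact ?M (upper b) (\<delta> 0)) (prod_encode (l, j)) =
          snd (\<Sum>j<Suc t. gscale ?M (b ^ j) (\<delta> j)) (prod_encode (l, j))" by simp
    qed
    hence "gact I (upper b) u = h (\<Sum>j<Suc t. gscale ?M (b ^ j) (\<delta> j))"
      using G_homD(4)[OF h(1) upper_SL2 \<delta>M, of b 0] by (simp add: u_def)
    also have "\<dots> = (\<Sum>j<Suc t. h (gscale ?M (b ^ j) (\<delta> j)))"
      by (rule G_hom_sum[OF ratM h(1) I.vector_space_axioms]) (auto intro!: M.subspace_scale[OF M.gspace] \<delta>M)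
    also have "\<dots> = (\<Sum>j<Suc t. gscale I (b ^ j) (h (\<delta> j)))"
      using G_homD(3)[OF h(1) \<delta>M] by simp
    finally show "gact I (upper b) u = (\<Sum>j<Suc t. gscale I (b ^ j) (h (\<delta> j)))" .
  next
    fix j assume "Suc t \<le> j"
    hence "\<delta> j = 0" using Tt[of j] by (auto simp: \<delta>_def prod_eq_iff fun_eq_iff)
    thus "h (\<delta> j) = 0" using G_homD(3)[OF h(1) \<delta>M, of 0 0] by simp
  qed
  have "E_op I t u = w"
  proof -
    \<comment> \<open>The coordinate \<open>Y = n + t\<close> is met only at the pair
      \<open>(n, t)\<close>, so this vector is the image of the highest weight vector of
      \<open>V(Y)\<close> and the extension sends it to \<open>w\<close>.\<close>
    have "\<delta> t = \<iota> (\<lambda>i. if i = Y then 1 else 0)"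
    proof (rule eqM[OF \<delta>M \<iota>M])
      fix l j assume l: "l \<le> n" and j: "j \<in> T"
      have "l + j = Y \<longleftrightarrow> l = n \<and> j = t" using l Tt[OF j] nt by auto
      thus "snd (\<delta> t) (prod_encode (l, j)) = snd (\<iota> (\<lambda>i. if i = Y then 1 else 0)) (prod_encode (l, j))"
        using T0 by (auto simp: \<iota>_nth[OF l j] \<delta>_def prod_encode_eq)
    qed
    hence "h (\<delta> t) = (\<Sum>l\<le>Y. gscale I (if l = Y then 1 else 0) (\<mu> l))"
      using h(2)[of "\<delta> t"] by (simp add: A_def f\<iota>)
    also have "\<dots> = (\<Sum>l\<le>Y. if l = Y then \<mu> l else 0)" by (rule sum.cong) auto
    finally show ?thesis using \<mu>(2) Eu by simp
  qed
  moreover have "E_op I j u = 0" if "(of_nat (t choose j) :: 'k) = 0" for j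
  proof -
    have "\<delta> j = 0" using that by (auto simp: \<delta>_def T_def prod_eq_iff fun_eq_iff)
    thus ?thesis using G_homD(3)[OF h(1) \<delta>M, of 0 0] Eu by simp
  qed
  ultimately show ?thesis using uW by blast
qed

section \<open>Ext groups from highest weight vectors\<close>

definition highest_wt :: "('k::field, 'v::ab_group_add) gmod \<Rightarrow> int \<Rightarrow> 'v set" where
  "highest_wt M y = {v \<in> wt M y. \<forall>t\<ge>1. E_op M t v = 0}"

lemma dim_leD:
  assumes "dim_le s N Z B" and "\<And>i. i \<le> N \<Longrightarrow> z i \<in> Z"
  shows "\<exists>a. (\<exists>i\<le>N. a i \<noteq> 0) \<and> (\<Sum>i\<le>N. s (a i) (z i)) \<in> B"
  using assms unfolding dim_le_def by blast

text \<open>In degree 0 the differential tests only the operators \<open>E (p ^ s)\<close>. By Lucas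
  every \<open>E t\<close> with \<open>t \<ge> 1\<close> factors through one of them up to a
  non-zero scalar.\<close>

lemma (in graded_module) cocycles_0D:
  assumes "\<phi> \<in> cocycles x 0"
  shows "\<phi> {#} \<in> W x" and "t \<ge> 1 \<Longrightarrow> E t (\<phi> {#}) = 0"
proof -
  have \<phi>: "\<phi> \<in> cochains x 0" "diff \<phi> = (\<lambda>_. 0)" using assms by (auto simp: cocycles_def)
  show W: "\<phi> {#} \<in> W x" using cochainsD(2)[OF \<phi>(1), of "{#}"] by (simp add: cell_wt_def)
  have "E (p ^ s) (\<phi> {#}) = 0" for s
    using fun_cong[OF \<phi>(2), of "{#s#}"] by (simp add: diff_def step_wt_def)
  hence digit: "t div p ^ s mod p = 0" if "E t (\<phi> {#}) \<noteq> 0" for s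
    using digit_eq_0_of_E[OF W _ that] by blast
  assume "t \<ge> 1"
  thus "E t (\<phi> {#}) = 0" using digit eq_0_if_digits_eq_0[OF p_gt_1, of t] by fastforce
qed

lemma (in graded_module) cocycles_0I:
  assumes "v \<in> W x" and "\<And>t. t \<ge> 1 \<Longrightarrow> E t v = 0"
  shows "(\<lambda>c. if c = {#} then v else 0) \<in> cocycles x 0"
proof -
  have "finite {c. (if c = {#} then v else 0) \<noteq> 0}" by (rule finite_subset[of _ "{{#}}"]) auto
  hence coch: "(\<lambda>c. if c = {#} then v else 0) \<in> cochains x 0"
    using assms(1) by (simp add: cochains_def cell_wt_def W_zero)
  moreover have "diff (\<lambda>c. if c = {#} then v else 0) c = 0" for c
  proof -
    have "step_wt p s (count c s) \<ge> 1" if "s \<in># c" for s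
      using p_ge_3 by (cases "odd (count c s)") (auto simp: step_wt_def)
    thus ?thesis unfolding diff_def using assms(2) by (intro sum.neutral) auto
  qed
  ultimately show ?thesis by (simp add: cocycles_def fun_eq_iff)
qed

lemma vector_space_fun:
  assumes "vector_space s"
  shows "vector_space (\<lambda>c (\<phi> :: 'x \<Rightarrow> 'v::ab_group_add) x. s c (\<phi> x))"
proof -
  interpret vector_space s by fact
  show ?thesis by unfold_locales (auto simp: scale_left_distrib scale_right_distrib)
qed

lemma G_hom_comp:
  assumes N: "rational_module N" and L: "vector_space (gscale L)" and f: "f \<in> G_hom M N" and g: "g \<in> G_hom N L"
  shows "g \<circ> f \<in> G_hom M L"
proof -
  interpret N: vector_space "gscale N" using N by (simp add: rational_module_def)
  interpret L: vector_space "gscale L" by fact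
  have "0 \<in> gspace N" using N N.subspace_0 by (simp add: rational_module_def)
  hence "g 0 = 0" using G_homD(3)[OF g, of 0 0] by simp
  thus ?thesis using G_homD[OF f] G_homD[OF g] by (auto simp: G_hom_def linear_on_def)
qed

lemma G_hom_subspace:
  fixes M :: "('k::field, 'v::ab_group_add) gmod" and N :: "('k, 'w::ab_group_add) gmod"
  assumes "rational_module N"
  shows "module.subspace (\<lambda>c \<phi> x. gscale N c (\<phi> x)) (G_hom M N)"
proof -
  have vs: "vector_space (gscale N)" using assms by (simp add: rational_module_def)
  interpret N: vector_space "gscale N" by fact
  interpret F: vector_space "\<lambda>c (\<phi> :: 'v \<Rightarrow> 'w) x. gscale N c (\<phi> x)" by (rule vector_space_fun[OF vs])
  have sub: "N.subspace (gspace N)" using assms by (simp add: rational_module_def)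
  have lin: "linear_on (gspace N) (gscale N) (gscale N) (gact N g)" if "g \<in> SL2" for g
    using assms that by (simp add: rational_module_def)
  have zero: "gact N g 0 = 0" if "g \<in> SL2" for g
    using lin[OF that] N.subspace_0[OF sub] unfolding linear_on_def by (metis N.scale_zero_left)
  show ?thesis
  proof (rule F.subspaceI)
    show "0 \<in> G_hom M N"
      using zero N.subspace_0[OF sub] by (auto simp: G_hom_def linear_on_def)
  next
    fix f h assume f: "f \<in> G_hom M N" and h: "h \<in> G_hom M N"
    have "gact N g (f v + h v) = gact N g (f v) + gact N g (h v)" if "g \<in> SL2" "v \<in> gspace M" for g v
      using lin[OF that(1)] G_homD(1)[OF f that(2)] G_homD(1)[OF h that(2)] by (simp add: linear_on_def)
    thus "f + h \<in> G_hom M N"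
      using G_homD[OF f] G_homD[OF h] N.subspace_add[OF sub]
      by (auto simp: G_hom_def linear_on_def N.scale_right_distrib add_ac)
  next
    fix c f assume f: "f \<in> G_hom M N"
    have "gact N g (gscale N c (f v)) = gscale N c (gact N g (f v))" if "g \<in> SL2" "v \<in> gspace M" for g v
      using lin[OF that(1)] G_homD(1)[OF f that(2)] by (simp add: linear_on_def)
    thus "(\<lambda>x. gscale N c (f x)) \<in> G_hom M N"
      using G_homD[OF f] N.subspace_scale[OF sub]
      by (auto simp: G_hom_def linear_on_def N.scale_right_distrib mult.commute)
  qed
qed

section \<open>Syzygies of an injective resolution\<close>

locale resolution =
  fixes N :: "('k::alg_closed_field, 'w::ab_group_add) gmod" and \<epsilon> :: "'w \<Rightarrow> 'v::ab_group_add"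
    and I :: "nat \<Rightarrow> ('k, 'v) gmod" and d :: "nat \<Rightarrow> 'v \<Rightarrow> 'v" and p :: nat
  assumes prime_p: "prime p" and odd_p: "odd p" and CHAR_p: "CHAR('k) = p"
    and resolution: "injective_resolution N \<epsilon> I d"
begin

text \<open>The weight spaces of the \<open>n\<close>-th syzygy; for \<open>n = 0\<close> this is
  the resolved module embedded by \<open>\<epsilon>\<close>.\<close>

definition Z :: "nat \<Rightarrow> int \<Rightarrow> 'v set" where
  "Z n y = {v \<in> wt (I n) y. d n v = 0}"

lemma injective: "injective_module (I n)"
  and d_hom: "d n \<in> G_hom (I n) (I (Suc n))"
  and exact: "d n ` gspace (I n) = {x \<in> gspace (I (Suc n)). d (Suc n) x = 0}"
  using resolution by (simp_all add: injective_resolution_def)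

lemma rational: "rational_module (I n)"
  using injective by (simp add: injective_module_def)

lemma rational_mod: "rational_mod (I n)"
  by standard (rule rational)

lemma graded: "graded_module (gscale (I n)) (wt (I n)) (E_op (I n)) p"
  by (rule rational_mod.graded_module[OF rational_mod prime_p odd_p CHAR_p])

lemma socle_extension: "graded_module.socle_extension TYPE('k) (wt (I n)) (E_op (I n))"
  unfolding graded_module.socle_extension_def[OF graded]
  using injective_socle_extension[OF injective] by blast

lemma d_wt: "v \<in> wt (I n) y \<Longrightarrow> v \<in> gspace (I n)"
  by (rule rational_mod.wt_gspace[OF rational_mod])

lemma graded_Z: "graded_module (gscale (I n)) (Z n) (E_op (I n)) p"
  unfolding Z_def
proof (rule graded_module.kernel_graded_module[OF graded])
  interpret S: graded_module "gscale (I (Suc n))" "wt (I (Suc n))" "E_op (I (Suc n))" p by (rule graded)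
  show "vector_space (gscale (I (Suc n)))" by (rule S.vector_space_axioms)
  show "E_op (I (Suc n)) t 0 = 0" for t by (rule S.E_zero)
  show "d n (v + w) = d n v + d n w" if "v \<in> wt (I n) y" "w \<in> wt (I n) y" for v w y
    by (rule G_homD(2)[OF d_hom d_wt[OF that(1)] d_wt[OF that(2)]])
  show "d n (gscale (I n) c v) = gscale (I (Suc n)) c (d n v)" if "v \<in> wt (I n) y" for c v y
    by (rule G_homD(3)[OF d_hom d_wt[OF that]])
  show "d n (E_op (I n) t v) = E_op (I (Suc n)) t (d n v)" if "v \<in> wt (I n) y" for t v y
    by (rule G_hom_E_op[OF rational rational d_hom d_wt[OF that]])
qed

lemma surjection:
  "graded_module_surjection (gscale (I n)) (wt (I n)) (E_op (I n)) (gscale (I (Suc n))) (Z (Suc n)) (E_op (I (Suc n))) p (d n)"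
  unfolding graded_module_surjection_def graded_module_surjection_axioms_def
proof (intro conjI allI impI graded graded_Z)
  show "d n (v + w) = d n v + d n w" if "v \<in> wt (I n) y" "w \<in> wt (I n) y" for v w y
    by (rule G_homD(2)[OF d_hom d_wt[OF that(1)] d_wt[OF that(2)]])
  show "d n (gscale (I n) c v) = gscale (I (Suc n)) c (d n v)" if "v \<in> wt (I n) y" for c v y
    by (rule G_homD(3)[OF d_hom d_wt[OF that]])
  show "d n (E_op (I n) t v) = E_op (I (Suc n)) t (d n v)" if "v \<in> wt (I n) y" for t v y
    by (rule G_hom_E_op[OF rational rational d_hom d_wt[OF that]])
  show "d n ` wt (I n) y = Z (Suc n) y" for y
  proof
    show "d n ` wt (I n) y \<subseteq> Z (Suc n) y"
      using exact[of n] G_hom_wt[OF d_hom] d_wt unfolding Z_def by blast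
    show "Z (Suc n) y \<subseteq> d n ` wt (I n) y"
    proof
      fix z assume z: "z \<in> Z (Suc n) y"
      hence "z \<in> d n ` gspace (I n)" using exact[of n] d_wt unfolding Z_def by blast
      then obtain v where "v \<in> gspace (I n)" "z = d n v" by blast
      thus "z \<in> d n ` wt (I n) y"
        using G_hom_wt_surj[OF rational rational d_hom] z unfolding Z_def by blast
    qed
  qed
qed

abbreviation H_le :: "nat \<Rightarrow> nat \<Rightarrow> int \<Rightarrow> nat \<Rightarrow> bool" where
  "H_le D n x k \<equiv> dim_le (\<lambda>a \<phi> c. gscale (I n) a (\<phi> c)) D
     (graded_module.cocycles (gscale (I n)) (Z n) (E_op (I n)) p x k)
     (graded_module.coboundaries (gscale (I n)) (Z n) (E_op (I n)) p x k)"

text \<open>Each term of the resolution is acyclic in weight \<open>x\<close>, so passing from one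
  syzygy to the next lowers the cohomological degree by one.\<close>

lemma dim_le_syzygy:
  assumes "0 \<le> x"
  shows "H_le D 0 x (Suc (k + n)) \<Longrightarrow> H_le D n x (Suc k)"
proof (induction n arbitrary: k)
  case (Suc n)
  interpret graded_module_surjection "gscale (I n)" "wt (I n)" "E_op (I n)"
    "gscale (I (Suc n))" "Z (Suc n)" "E_op (I (Suc n))" p "d n" by (rule surjection)
  have "H_le D n x (Suc (Suc k))" using Suc.prems by (intro Suc.IH) simp
  thus ?case unfolding Z_def[of n] by (rule dim_le_shift_Suc[OF socle_extension assms])
qed simp

text \<open>The last shift ends in degree 0, where acyclicity of \<open>I j\<close> says nothing.
  There the images of its highest weight vectors stay as the denominator, matching the coboundaries
  of Ext.\<close>

lemma dim_le_highest_wt: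
  assumes le: "H_le D 0 x n" and x: "0 \<le> x"
  shows "dim_le (gscale (I n)) D {v \<in> highest_wt (I n) x. d n v = 0}
    (case n of 0 \<Rightarrow> {0} | Suc j \<Rightarrow> d j ` highest_wt (I j) x)"
  unfolding dim_le_def
proof (intro allI impI)
  interpret Z: graded_module "gscale (I n)" "Z n" "E_op (I n)" p by (rule graded_Z)
  let ?B = "case n of 0 \<Rightarrow> {\<lambda>_. 0} | Suc j \<Rightarrow>
    (\<lambda>\<phi> c. d j (\<phi> c)) ` graded_module.cocycles (gscale (I j)) (wt (I j)) (E_op (I j)) p x 0"
  have le': "dim_le (\<lambda>a \<phi> c. gscale (I n) a (\<phi> c)) D (Z.cocycles x 0) ?B"
  proof (cases n)
    case 0
    thus ?thesis using le Z.coboundaries_def[of x 0] by simp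
  next
    case (Suc j)
    interpret S: graded_module_surjection "gscale (I j)" "wt (I j)" "E_op (I j)"
      "gscale (I (Suc j))" "Z (Suc j)" "E_op (I (Suc j))" p "d j" by (rule surjection)
    have "H_le D 0 x (Suc (0 + j))" using le by (simp only: Suc add_0)
    hence "H_le D j x (Suc 0)" by (rule dim_le_syzygy[OF x])
    hence "dim_le (\<lambda>a \<phi> c. gscale (I (Suc j)) a (\<phi> c)) D (S.B.cocycles x 0) ((\<lambda>\<phi> c. d j (\<phi> c)) ` S.A.cocycles x 0)"
      unfolding Z_def[of j] by (rule S.dim_le_shift)
    thus ?thesis by (simp only: Suc nat.case)
  qed
  fix z assume z: "\<forall>i\<le>D. z i \<in> {v \<in> highest_wt (I n) x. d n v = 0}"
  define \<zeta> where "\<zeta> i c = (if c = {#} then z i else 0)" for i and c :: "nat multiset"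
  have "\<zeta> i \<in> Z.cocycles x 0" if "i \<le> D" for i
    unfolding \<zeta>_def using z that by (intro Z.cocycles_0I) (auto simp: Z_def highest_wt_def)
  then obtain a where a: "\<exists>i\<le>D. a i \<noteq> 0" "(\<Sum>i\<le>D. (\<lambda>c. gscale (I n) (a i) (\<zeta> i c))) \<in> ?B"
    using le'[unfolded dim_le_def, rule_format, of \<zeta>] by blast
  have eq: "(\<Sum>i\<le>D. (\<lambda>c. gscale (I n) (a i) (\<zeta> i c))) {#} = (\<Sum>i\<le>D. gscale (I n) (a i) (z i))"
    by (simp add: sum_fun_apply \<zeta>_def)
  have "(\<Sum>i\<le>D. gscale (I n) (a i) (z i)) \<in> (case n of 0 \<Rightarrow> {0} | Suc j \<Rightarrow> d j ` highest_wt (I j) x)"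
  proof (cases n)
    case 0
    thus ?thesis using a(2) eq by simp
  next
    case (Suc j)
    then obtain \<phi> where \<phi>: "\<phi> \<in> graded_module.cocycles (gscale (I j)) (wt (I j)) (E_op (I j)) p x 0"
      "(\<Sum>i\<le>D. (\<lambda>c. gscale (I n) (a i) (\<zeta> i c))) = (\<lambda>c. d j (\<phi> c))"
      using a(2) by auto
    have "\<phi> {#} \<in> highest_wt (I j) x"
      using graded_module.cocycles_0D[OF graded \<phi>(1)] by (simp add: highest_wt_def)
    moreover have "(\<Sum>i\<le>D. gscale (I n) (a i) (z i)) = d j (\<phi> {#})"
      using eq fun_cong[OF \<phi>(2), of "{#}"] by simp
    ultimately show ?thesis using Suc by simp
  qed
  thus "\<exists>a. (\<exists>i\<le>D. a i \<noteq> 0) \<and> (\<Sum>i\<le>D. gscale (I n) (a i) (z i)) \<in> (case n of 0 \<Rightarrow> {0} | Suc j \<Rightarrow> d j ` highest_wt (I j) x)"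
    using a(1) by blast
qed

lemma weyl_vec_highest_wt:
  fixes f :: "(('k ^ 2 ^ 2 \<Rightarrow> 'k) \<Rightarrow> 'k) \<Rightarrow> 'v"
  assumes "f \<in> G_hom (weyl m) (I n)"
  shows "f (weyl_vec m m) \<in> highest_wt (I n) (int m)"
  using G_hom_weyl_vec[OF rational assms, of m] by (simp add: highest_wt_def)

text \<open>By the universal property a preimage of the highest weight vector extends to a
  homomorphism into \<open>I j\<close>, and agreement on the highest weight vector forces equality
  of homomorphisms.\<close>

lemma coboundaries_weylI:
  fixes f :: "(('k ^ 2 ^ 2 \<Rightarrow> 'k) \<Rightarrow> 'k) \<Rightarrow> 'v"
  assumes f: "f \<in> G_hom (weyl m) (I n)"
    and B: "f (weyl_vec m m) \<in> (case n of 0 \<Rightarrow> {0} | Suc j \<Rightarrow> d j ` highest_wt (I j) (int m))"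
  shows "f \<in> Defs.coboundaries (weyl m) I d n"
proof (cases n)
  case 0
  interpret rational_mod "I n" by (rule rational_mod)
  interpret F: vector_space "\<lambda>c (\<phi> :: (('k ^ 2 ^ 2 \<Rightarrow> 'k) \<Rightarrow> 'k) \<Rightarrow> 'v) x. gscale (I n) c (\<phi> x)"
    by (rule vector_space_fun[OF vector_space_axioms])
  have "0 \<in> G_hom (weyl m) (I n)" by (rule F.subspace_0[OF G_hom_subspace[OF rational]])
  hence "f = 0" using B 0 by (intro G_hom_weyl_eqI[OF rational f]) simp_all
  thus ?thesis using 0 by (simp add: Defs.coboundaries_def zero_fun_def)
next
  case (Suc j)
  then obtain u where u: "u \<in> highest_wt (I j) (int m)" "f (weyl_vec m m) = d j u" using B by auto
  then obtain \<psi> where \<psi>: "\<psi> \<in> G_hom (weyl m) (I j)" "\<psi> (weyl_vec m m) = u"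
    using weyl_universal[OF rational[of j], of u m] by (auto simp: highest_wt_def)
  have "d j \<circ> \<psi> \<in> G_hom (weyl m) (I n)"
    unfolding Suc by (rule G_hom_comp[OF rational _ \<psi>(1) d_hom]) (use rational in \<open>simp add: rational_module_def\<close>)
  hence "f = d j \<circ> \<psi>" using u(2) \<psi>(2) by (intro G_hom_weyl_eqI[OF rational f]) simp_all
  thus ?thesis using \<psi>(1) Suc by (simp add: Defs.coboundaries_def)
qed

lemma coboundaries_subspace:
  fixes M :: "('k, 'b::ab_group_add) gmod"
  shows "module.subspace (\<lambda>c \<phi> x. gscale (I n) c (\<phi> x)) (Defs.coboundaries M I d n)"
proof -
  interpret rational_mod "I n" by (rule rational_mod)
  interpret F: vector_space "\<lambda>c (\<phi> :: 'b \<Rightarrow> 'v) x. gscale (I n) c (\<phi> x)"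
    by (rule vector_space_fun[OF vector_space_axioms])
  show ?thesis
  proof (cases n)
    case 0
    have "F.subspace {\<lambda>_. 0}" using F.subspace_single_0 by (simp only: zero_fun_def)
    thus ?thesis by (simp add: Defs.coboundaries_def 0)
  next
    case (Suc j)
    interpret J: rational_mod "I j" by (rule rational_mod)
    interpret G: vector_space "\<lambda>c (\<phi> :: 'b \<Rightarrow> 'v) x. gscale (I j) c (\<phi> x)"
      by (rule vector_space_fun[OF J.vector_space_axioms])
    note sub = G_hom_subspace[OF rational[of j], of M]
    have mem: "\<psi> x \<in> gspace (I j)" if "\<psi> \<in> G_hom M (I j)" for \<psi> :: "'b \<Rightarrow> 'v" and x
      using G_homD(1,5)[OF that] J.subspace_0[OF J.gspace] by metis
    have cob: "Defs.coboundaries M I d n = (\<lambda>\<psi>. d j \<circ> \<psi>) ` G_hom M (I j)"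
      by (simp add: Defs.coboundaries_def Suc)
    have d_scale: "d j (gscale (I j) c v) = gscale (I n) c (d j v)" if "v \<in> gspace (I j)" for c v
      using G_homD(3)[OF d_hom that] by (simp only: Suc)
    show ?thesis
      unfolding cob
    proof (rule F.subspaceI)
      have "d j 0 = 0" using d_scale[OF J.subspace_0[OF J.gspace], of 0] by simp
      hence "0 = d j \<circ> (0 :: 'b \<Rightarrow> 'v)" by (simp add: fun_eq_iff)
      thus "0 \<in> (\<lambda>\<psi>. d j \<circ> \<psi>) ` G_hom M (I j)" by (rule image_eqI[where f = "(\<circ>) (d j)"]) (rule G.subspace_0[OF sub])
    next
      fix x y assume "x \<in> (\<lambda>\<psi>. d j \<circ> \<psi>) ` G_hom M (I j)" "y \<in> (\<lambda>\<psi>. d j \<circ> \<psi>) ` G_hom M (I j)"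
      then obtain \<psi> \<psi>' where \<psi>: "\<psi> \<in> G_hom M (I j)" "\<psi>' \<in> G_hom M (I j)" "x = d j \<circ> \<psi>" "y = d j \<circ> \<psi>'"
        by blast
      have "x + y = d j \<circ> (\<psi> + \<psi>')"
        unfolding \<psi>(3,4) by (rule ext) (simp add: G_homD(2)[OF d_hom] mem \<psi>(1,2))
      thus "x + y \<in> (\<lambda>\<psi>. d j \<circ> \<psi>) ` G_hom M (I j)"
        by (rule image_eqI[where f = "(\<circ>) (d j)"]) (rule G.subspace_add[OF sub \<psi>(1,2)])
    next
      fix c x assume "x \<in> (\<lambda>\<psi>. d j \<circ> \<psi>) ` G_hom M (I j)"
      then obtain \<psi> where \<psi>: "\<psi> \<in> G_hom M (I j)" "x = d j \<circ> \<psi>" by blast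
      have "(\<lambda>v. gscale (I n) c (x v)) = d j \<circ> (\<lambda>v. gscale (I j) c (\<psi> v))"
        unfolding \<psi>(2) by (rule ext) (simp add: d_scale mem \<psi>(1))
      thus "(\<lambda>v. gscale (I n) c (x v)) \<in> (\<lambda>\<psi>. d j \<circ> \<psi>) ` G_hom M (I j)"
        by (rule image_eqI[where f = "(\<circ>) (d j)"]) (rule G.subspace_scale[OF sub \<psi>(1)])
    qed
  qed
qed

text \<open>Evaluation at the highest weight vector is linear, so a relation found among highest
  weight vectors holds with the same coefficients among the cocycles.\<close>

lemma Ext_dim_le:
  assumes le: "H_le D 0 (int m) n"
  shows "Ext_dim (weyl m) I d n \<le> enat D"
  unfolding Ext_dim_def
proof (rule quotient_dim_le)
  interpret rational_mod "I n" by (rule rational_mod)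
  let ?s = "\<lambda>c (\<phi> :: (('k ^ 2 ^ 2 \<Rightarrow> 'k) \<Rightarrow> 'k) \<Rightarrow> 'v) x. gscale (I n) c (\<phi> x)"
  show vs: "vector_space ?s" by (rule vector_space_fun[OF vector_space_axioms])
  interpret F: vector_space ?s by (rule vs)
  show "F.subspace (Defs.coboundaries (weyl m) I d n)" by (rule coboundaries_subspace)
  show "dim_le ?s D (Defs.cocycles (weyl m) I d n) (Defs.coboundaries (weyl m) I d n)"
    unfolding dim_le_def
  proof (intro allI impI)
    fix \<phi> assume "\<forall>i\<le>D. \<phi> i \<in> Defs.cocycles (weyl m) I d n"
    hence \<phi>: "\<phi> i \<in> G_hom (weyl m) (I n) \<and> d n \<circ> \<phi> i = (\<lambda>_. 0)" if "i \<le> D" for i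
      using that unfolding Defs.cocycles_def by blast
    note hom = \<phi>[THEN conjunct1] and d0 = \<phi>[THEN conjunct2]
    have mem: "\<phi> i (weyl_vec m m) \<in> {v \<in> highest_wt (I n) (int m). d n v = 0}" if "i \<le> D" for i
      using weyl_vec_highest_wt[OF hom[OF that]] fun_cong[OF d0[OF that], of "weyl_vec m m"] by simp
    have "\<exists>a. (\<exists>i\<le>D. a i \<noteq> 0) \<and> (\<Sum>i\<le>D. gscale (I n) (a i) (\<phi> i (weyl_vec m m))) \<in>
        (case n of 0 \<Rightarrow> {0} | Suc j \<Rightarrow> d j ` highest_wt (I j) (int m))"
      by (rule dim_leD[OF dim_le_highest_wt[OF le]]) (rule of_nat_0_le_iff, rule mem)
    then obtain a where a: "(\<exists>i\<le>D. a i \<noteq> 0) \<and> (\<Sum>i\<le>D. gscale (I n) (a i) (\<phi> i (weyl_vec m m))) \<in>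
        (case n of 0 \<Rightarrow> {0} | Suc j \<Rightarrow> d j ` highest_wt (I j) (int m))"
      by (rule exE)
    note sub = G_hom_subspace[OF rational[of n], of "weyl m"]
    have "(\<Sum>i\<le>D. ?s (a i) (\<phi> i)) \<in> Defs.coboundaries (weyl m) I d n"
    proof (rule coboundaries_weylI)
      show "(\<Sum>i\<le>D. ?s (a i) (\<phi> i)) \<in> G_hom (weyl m) (I n)"
        by (rule F.subspace_sum[OF sub], rule F.subspace_scale[OF sub], rule hom) simp
      show "(\<Sum>i\<le>D. ?s (a i) (\<phi> i)) (weyl_vec m m) \<in> (case n of 0 \<Rightarrow> {0} | Suc j \<Rightarrow> d j ` highest_wt (I j) (int m))"
        unfolding sum_fun_apply by (rule conjunct2[OF a])
    qed
    thus "\<exists>a. (\<exists>i\<le>D. a i \<noteq> 0) \<and> (\<Sum>i\<le>D. ?s (a i) (\<phi> i)) \<in> Defs.coboundaries (weyl m) I d n"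
      by (intro exI[of _ a]) (rule conjI[OF conjunct1[OF a]])
  qed
qed

end

text \<open>Exactness at \<open>I 0\<close> identifies the kernel of \<open>d 0\<close> with the
  image of the Weyl module. There a weight vector is a multiple of one basis vector, since the basis
  vectors have pairwise different weights.\<close>

lemma resolution_weyl_graded_module:
  fixes \<epsilon> :: "(('k::alg_closed_field ^ 2 ^ 2 \<Rightarrow> 'k) \<Rightarrow> 'k) \<Rightarrow> 'v::ab_group_add"
  assumes "resolution (weyl m) \<epsilon> I d p"
  shows "weyl_graded_module (gscale (I 0)) (resolution.Z I d 0) (E_op (I 0)) p m (\<lambda>u. \<epsilon> (weyl_vec m u))"
proof -
  interpret resolution "weyl m" \<epsilon> I d p by fact
  interpret rational_mod "I 0" by (rule rational_mod)
  have \<epsilon>: "\<epsilon> \<in> G_hom (weyl m) (I 0)" "inj_on \<epsilon> (gspace (weyl m))"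
    "\<epsilon> ` gspace (weyl m) = {x \<in> gspace (I 0). d 0 x = 0}"
    using resolution unfolding injective_resolution_def by blast+
  interpret F: vector_space "fun_scale :: 'k \<Rightarrow> (('k ^ 2 ^ 2 \<Rightarrow> 'k) \<Rightarrow> 'k) \<Rightarrow> _" by (rule vector_space_fun_scale)
  interpret Z: graded_module "gscale (I 0)" "Z 0" "E_op (I 0)" p by (rule graded_Z)
  have \<epsilon>0: "\<epsilon> 0 = 0"
    using G_homD(3)[OF \<epsilon>(1), of 0 0] F.subspace_0[OF weyl_subspace] by simp
  show ?thesis
  proof unfold_locales
    fix u assume u: "u \<le> m"
    have "weyl_vec m u \<noteq> (0 :: ('k ^ 2 ^ 2 \<Rightarrow> 'k) \<Rightarrow> 'k)"
      using weyl_vec_mono[OF u u] by (metis zero_fun_apply zero_neq_one)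
    thus "\<epsilon> (weyl_vec m u) \<noteq> 0"
      using inj_onD[OF \<epsilon>(2) _ weyl_vec_mem[OF u] F.subspace_0[OF weyl_subspace]] \<epsilon>0 by metis
    show "\<epsilon> (weyl_vec m u) \<in> Z 0 (2 * int u - int m)"
      using G_hom_weyl_vec(1)[OF rational \<epsilon>(1) u] \<epsilon>(3) weyl_vec_mem[OF u] unfolding Z_def by blast
    show "E_op (I 0) t (\<epsilon> (weyl_vec m u)) =
        (if u + t \<le> m then gscale (I 0) (of_nat ((u + t) choose t)) (\<epsilon> (weyl_vec m (u + t))) else 0)" for t
      by (rule G_hom_weyl_vec(2)[OF rational \<epsilon>(1) u])
  next
    fix v y assume v: "v \<in> Z 0 y" "v \<noteq> 0"
    hence "v \<in> {x \<in> gspace (I 0). d 0 x = 0}" using wt_gspace by (auto simp: Z_def)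
    then obtain \<phi> where \<phi>: "\<phi> \<in> gspace (weyl m)" "v = \<epsilon> \<phi>" using \<epsilon>(3) by blast
    define a where "a l = \<phi> (sym_mono m l)" for l
    have "v = \<epsilon> (\<Sum>l\<le>m. fun_scale (a l) (weyl_vec m l))"
      unfolding a_def using weyl_expand[OF \<phi>(1)] \<phi>(2) by simp
    also have "\<dots> = (\<Sum>l\<le>m. gscale (I 0) (a l) (\<epsilon> (weyl_vec m l)))"
      by (rule G_hom_weyl_sum[OF vector_space_axioms \<epsilon>(1)])
    finally have v_eq: "v = (\<Sum>l\<le>m. gscale (I 0) (a l) (\<epsilon> (weyl_vec m l)))" .
    define w where "w l = 2 * int l - int m" for l
    \<comment> \<open>The inverse of \<open>w\<close>, used to index the basis vectors by their
      weights as \<open>weights_independent\<close> requires.\<close>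
    define L where "L n = nat ((n + int m) div 2)" for n
    have Lw: "L (w l) = l" for l by (simp add: L_def w_def)
    define \<mu> where "\<mu> n = gscale (I 0) (a (L n)) (\<epsilon> (weyl_vec m (L n)))" for n
    have "inj_on w {..m}" using Lw by (rule inj_on_inverseI)
    hence v_eq': "v = (\<Sum>n\<in>w ` {..m}. \<mu> n)" unfolding v_eq by (simp add: sum.reindex \<mu>_def Lw)
    have "(\<Sum>n\<in>w ` {..m}. \<mu> n) = (if y \<in> w ` {..m} then \<mu> y else 0)"
    proof (rule weights_independent)
      show "(\<Sum>n\<in>w ` {..m}. \<mu> n) \<in> wt (I 0) y" using v(1) v_eq' by (simp add: Z_def)
      show "\<mu> n \<in> wt (I 0) n" if "n \<in> w ` {..m}" for n
        using that G_hom_weyl_vec(1)[OF rational \<epsilon>(1)]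
        by (auto simp: \<mu>_def Lw intro!: subspace_scale[OF wt_subspace]) (simp add: w_def)
    qed simp
    then obtain u where u: "u \<le> m" "y = w u" "v = \<mu> y" using v_eq' v(2) by (auto split: if_splits)
    hence "v = gscale (I 0) (a u) (\<epsilon> (weyl_vec m u))" by (simp add: \<mu>_def Lw)
    thus "\<exists>u\<le>m. \<exists>c. y = 2 * int u - int m \<and> v = gscale (I 0) c (\<epsilon> (weyl_vec m u))"
      using u(1,2) w_def by blast
  qed
qed

theorem theorem5p4:
  fixes p r m1 m2 n :: nat
    and I :: "nat \<Rightarrow> ('k::alg_closed_field, 'v::ab_group_add) gmod"
    and d :: "nat \<Rightarrow> 'v \<Rightarrow> 'v"
    and \<epsilon> :: "(('k ^ 2 ^ 2 \<Rightarrow> 'k) \<Rightarrow> 'k) \<Rightarrow> 'v"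
  assumes "prime p" and "odd p" and "CHAR('k) = p"
    and "r \<ge> 1" and "m2 < p ^ r"
    and "n \<le> 2 * p - 3"
    and "injective_resolution (weyl m1) \<epsilon> I d"
  shows "Ext_dim (weyl m2) I d n \<le> enat (fib (n + 1) + (r - 1) * fib n)"
proof -
  interpret resolution "weyl m1" \<epsilon> I d p using assms by unfold_locales
  interpret Z: weyl_graded_module "gscale (I 0)" "Z 0" "E_op (I 0)" p m1 "\<lambda>u. \<epsilon> (weyl_vec m1 u)"
    by (rule resolution_weyl_graded_module) (rule resolution_axioms)
  show ?thesis by (rule Ext_dim_le[OF Z.dim_le_fib[OF assms(6,4,5)]])
qed

end
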